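(* Let $\boldsymbol M=\boldsymbol X\boldsymbol Y^T\in\mathbb{R}^{n_1\times n_2}$ have rank $r$, with $\boldsymbol X\in\mathbb{R}^{n_1\times r}$, $\boldsymbol Y\in\mathbb{R}^{n_2\times r}$, $\boldsymbol X^T\boldsymbol X=\boldsymbol Y^T\boldsymbol Y$, let $\boldsymbol Z=[\boldsymbol X^T,\boldsymbol Y^T]^T$, $n=(n_1+n_2)/2$, and let $\bar\kappa=\frac{\|\boldsymbol M\|_F}{\sqrt r\,\sigma_r(\boldsymbol M)}\le\bar\kappa_0$. Let $\boldsymbol A_1,\dots,\boldsymbol A_m\in\mathbb{R}^{n_1\times n_2}$ be sensing matrices generated with i.i.d. $\mathcal N(0,1)$ entries, and let $y_i=\langle\boldsymbol A_i,\boldsymbol M\rangle$ for $i\notin\mathcal S$ and $y_i=\eta_i$ for $i\in\mathcal S$, where $\mathcal S\subset\{1,\dots,m\}$, $|\mathcal S|=sm$, and the outliers $\eta_i$ can take arbitrary values. Set $\alpha_y=2\log\big(r^{1/4}\bar\kappa_0^{1/2}+20\big)$. There exist some constants $0<s_1<1$ and $c_2,c_3,c_4>1$ such that with probability at least $1-n^{-c_2}-\exp(-c_3m)$, if $s\le s_1/(\sqrt r\,\bar\kappa)$ and $m\ge c_4\,\alpha_y^2\,\bar\kappa^2\,nr^2\log n$, the truncated spectral initialization $\boldsymbol W_0$ satisfies $$\mathrm{dist}(\boldsymbol W_0,\boldsymbol Z)\le\tfrac1{24}\sigma_r(\boldsymbol Z).$$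
   Context: $\langle \boldsymbol A,\boldsymbol B\rangle=\mathrm{Tr}(\boldsymbol B^T\boldsymbol A)$; $\sigma_k$ is the $k$th largest singular value; $\|\cdot\|_F$ is the Frobenius norm; $\mathbb{I}$ is an indicator. For a vector, $|\cdot|$ is entrywise and $\mathrm{med}$ is the sample median ($\inf\{x:\hat F(x)\ge1/2\}$, $\hat F$ the empirical CDF of the entries). Distance: $\mathrm{dist}(\boldsymbol W,\boldsymbol Z)=\min_{\boldsymbol P\in\mathbb{R}^{r\times r},\,\boldsymbol P\boldsymbol P^T=\boldsymbol I}\|\boldsymbol W-\boldsymbol Z\boldsymbol P\|_F$. Truncated spectral initialization: let $m_1=\lceil m/2\rceil$, $\boldsymbol y_2=(y_i)_{i=m_1+1}^m$, and $$\boldsymbol K=\frac1{m_1}\sum_{i=1}^{m_1}y_i\boldsymbol A_i\,\mathbb{I}_{\{|y_i|\le\alpha_y\,\mathrm{med}(|\boldsymbol y_2|)\}}.$$ Let $\boldsymbol C_L\boldsymbol\Sigma\boldsymbol C_R^T$ be the rank-$r$ (truncated) SVD of $\boldsymbol K$, with $\boldsymbol C_L\in\mathbb{R}^{n_1\times r}$, $\boldsymbol C_R\in\mathbb{R}^{n_2\times r}$, $\boldsymbol\Sigma\in\mathbb{R}^{r\times r}$. Then $\boldsymbol U_0=\boldsymbol C_L\boldsymbol\Sigma^{1/2}$, $\boldsymbol V_0=\boldsymbol C_R\boldsymbol\Sigma^{1/2}$ and $\boldsymbol W_0=[\boldsymbol U_0^T,\boldsymbol V_0^T]^T$. *)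

theory Defs
  imports
    "HOL-Probability.Probability"
    "Jordan_Normal_Form.DL_Rank"
    "Jordan_Normal_Form.Char_Poly"
begin

text \<open>
  Dimensions range over natural numbers inside the statement, so matrices are the
  carrier-based ones of \<open>Jordan_Normal_Form.Matrix\<close>. Rows and columns are numbered from 0;
  sensing matrices, observations and singular values are numbered from 1.
\<close>

hide_const (open)
  Finite_Cartesian_Product.mat Finite_Cartesian_Product.transpose Finite_Cartesian_Product.vec
  Finite_Cartesian_Product.row Finite_Cartesian_Product.column
  Determinants.trace Determinants.det

definition mat_trace :: "real mat \<Rightarrow> real" where
  "mat_trace A = (\<Sum>i<dim_row A. A $$ (i, i))"

definition mat_inner :: "real mat \<Rightarrow> real mat \<Rightarrow> real" where
  "mat_inner A B = mat_trace (transpose_mat B * A)"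

definition frob_norm :: "real mat \<Rightarrow> real" where
  "frob_norm A = sqrt (\<Sum>i<dim_row A. \<Sum>j<dim_col A. (A $$ (i, j))\<^sup>2)"

text \<open>
  The \<open>k\<close>th largest singular value, for \<open>1 \<le> k \<le> min (dim_row A) (dim_col A)\<close>: the square root
  of the \<open>k\<close>th largest eigenvalue of \<open>A\<^sup>T A\<close>, where eigenvalues are repeated according
  to multiplicity (\<open>proots\<close> is the multiset of roots of a polynomial).
\<close>
definition sing_val :: "real mat \<Rightarrow> nat \<Rightarrow> real" where
  "sing_val A k =
     sqrt (rev (sorted_list_of_multiset (proots (char_poly (transpose_mat A * A)))) ! (k - 1))"

definition kappa_bar :: "real mat \<Rightarrow> nat \<Rightarrow> real" where
  "kappa_bar M r = frob_norm M / (sqrt (real r) * sing_val M r)"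

text \<open>
  The infimum is a minimum, because the orthogonal group is compact and nonempty. \<open>r\<close> is the
  common number of columns of \<open>W\<close> and \<open>Z\<close>.
\<close>
definition mat_dist :: "real mat \<Rightarrow> real mat \<Rightarrow> real" where
  "mat_dist W Z =
     (let r = dim_col Z
      in INF P \<in> {P \<in> carrier_mat r r. P * transpose_mat P = 1\<^sub>m r}. frob_norm (W - Z * P))"

definition empirical_cdf :: "real vec \<Rightarrow> real \<Rightarrow> real" where
  "empirical_cdf v x = real (card {i. i < dim_vec v \<and> v $ i \<le> x}) / real (dim_vec v)"

definition med :: "real vec \<Rightarrow> real" where
  "med v = Inf {x. empirical_cdf v x \<ge> 1 / 2}"

text \<open>
  A full singular value decomposition \<open>K = U S V\<^sup>T\<close>, with \<open>U\<close> and \<open>V\<close> square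
  orthogonal and \<open>S\<close> rectangular diagonal with nonnegative nonincreasing diagonal.
\<close>
definition is_svd :: "real mat \<Rightarrow> real mat \<Rightarrow> real mat \<Rightarrow> real mat \<Rightarrow> bool" where
  "is_svd K U S V \<longleftrightarrow>
     (let n1 = dim_row K; n2 = dim_col K in
        U \<in> carrier_mat n1 n1 \<and> transpose_mat U * U = 1\<^sub>m n1 \<and>
        V \<in> carrier_mat n2 n2 \<and> transpose_mat V * V = 1\<^sub>m n2 \<and>
        S \<in> carrier_mat n1 n2 \<and> diagonal_mat S \<and>
        (\<forall>i < min n1 n2. 0 \<le> S $$ (i, i)) \<and>
        (\<forall>j < min n1 n2. \<forall>i \<le> j. S $$ (j, j) \<le> S $$ (i, i)) \<and>
        K = U * S * transpose_mat V)"

text \<open>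
  Rank-\<open>r\<close> truncated singular value decomposition: keep the \<open>r\<close> leading singular triples of a
  full decomposition. It need not be unique, hence a relation.
\<close>
definition is_trunc_svd ::
    "nat \<Rightarrow> real mat \<Rightarrow> real mat \<Rightarrow> real mat \<Rightarrow> real mat \<Rightarrow> bool" where
  "is_trunc_svd r K CL Sig CR \<longleftrightarrow>
     r \<le> min (dim_row K) (dim_col K) \<and>
     (\<exists>U S V. is_svd K U S V \<and>
        CL = mat (dim_row K) r (\<lambda>(i, j). U $$ (i, j)) \<and>
        Sig = mat r r (\<lambda>(i, j). S $$ (i, j)) \<and>
        CR = mat (dim_col K) r (\<lambda>(i, j). V $$ (i, j)))"

definition observation ::
    "nat set \<Rightarrow> (nat \<Rightarrow> real) \<Rightarrow> real mat \<Rightarrow> (nat \<Rightarrow> real mat) \<Rightarrow> nat \<Rightarrow> real" where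
  "observation S \<eta> M A i = (if i \<in> S then \<eta> i else mat_inner (A i) M)"

definition init_matrix ::
    "nat \<Rightarrow> nat \<Rightarrow> nat \<Rightarrow> real \<Rightarrow> (nat \<Rightarrow> real mat) \<Rightarrow> (nat \<Rightarrow> real) \<Rightarrow> real mat" where
  "init_matrix n1 n2 m \<alpha> A y =
     (let m1 = nat \<lceil>real m / 2\<rceil>;
          y2 = Matrix.vec (m - m1) (\<lambda>j. y (m1 + 1 + j))
      in mat n1 n2 (\<lambda>(j, k).
           1 / real m1 *
           (\<Sum>i = 1..m1. y i * A i $$ (j, k) * of_bool (\<bar>y i\<bar> \<le> \<alpha> * med (map_vec abs y2)))))"

text \<open>
  \<open>W0\<close> is an outcome of the truncated spectral initialization. The entrywise square root
  \<open>map_mat sqrt\<close> of the diagonal nonnegative matrix \<open>Sig\<close> is its matrix square root, and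
  \<open>@\<^sub>r\<close> stacks two matrices on top of each other.
\<close>
definition is_trunc_spectral_init ::
    "nat \<Rightarrow> nat \<Rightarrow> nat \<Rightarrow> nat \<Rightarrow> real \<Rightarrow> (nat \<Rightarrow> real mat) \<Rightarrow> (nat \<Rightarrow> real) \<Rightarrow> real mat \<Rightarrow> bool" where
  "is_trunc_spectral_init n1 n2 r m \<alpha> A y W0 \<longleftrightarrow>
     (\<exists>CL Sig CR. is_trunc_svd r (init_matrix n1 n2 m \<alpha> A y) CL Sig CR \<and>
        W0 = (CL * map_mat sqrt Sig) @\<^sub>r (CR * map_mat sqrt Sig))"

text \<open>
  The joint law of the entries of \<open>m\<close> sensing matrices with i.i.d. standard normal entries. A
  sample point \<open>\<omega>\<close> lists all entries, and \<open>sensing n1 n2 \<omega> i\<close> is the \<open>i\<close>th matrix.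
\<close>
definition gaussian_ensemble :: "nat \<Rightarrow> nat \<Rightarrow> nat \<Rightarrow> (nat \<times> nat \<times> nat \<Rightarrow> real) measure" where
  "gaussian_ensemble n1 n2 m =
     Pi\<^sub>M ({1..m} \<times> {..<n1} \<times> {..<n2}) (\<lambda>_. density lborel std_normal_density)"

definition sensing :: "nat \<Rightarrow> nat \<Rightarrow> (nat \<times> nat \<times> nat \<Rightarrow> real) \<Rightarrow> nat \<Rightarrow> real mat" where
  "sensing n1 n2 \<omega> i = mat n1 n2 (\<lambda>(j, k). \<omega> (i, j, k))"

end

theory Submission
  imports Defs "Jordan_Normal_Form.Schur_Decomposition" "Jordan_Normal_Form.Spectral_Radius"
begin

text \<open>
  The threshold \<open>\<tau>\<close> depends only on the second half of the sample, so one may condition on it. With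
  high probability the sample median is at least \<open>0.66 \<parallel>M\<parallel>\<close> and at most \<open>2 \<parallel>M\<parallel>\<close>. For a frozen threshold and
  fixed vectors \<open>u, v\<close>, the sum \<open>u\<^sup>T K v\<close> over the inliers has mean \<open>c u\<^sup>T M v\<close>, where
  \<open>1 - c\<close> consists of the outlier fraction and of the truncation bias \<open>E[g\<^sup>2; |g| > \<tau> / \<parallel>M\<parallel>]\<close>, and it
  concentrates because a truncated factor times a Gaussian is subgaussian; the outliers that pass the truncation are
  bounded and enjoy the same deviation bound. A union bound over a grid bounds \<open>K - c M\<close> in operator
  norm by a small multiple of \<open>\<sigma>\<^sub>r(M) / \<surd>r\<close>; the factor \<open>log n\<close> in the sample size pays for the crude grid.

  By the Eckart--Young theorem the truncated decomposition \<open>K\<^sub>r\<close> is then close to \<open>M\<close> in Frobenius norm, with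
  a loss of \<open>\<surd>r\<close>. The factors of \<open>K\<^sub>r\<close> are balanced, as are \<open>X\<close> and \<open>Y\<close>, hence
  \<open>\<parallel>W\<^sub>0 W\<^sub>0\<^sup>T - Z Z\<^sup>T\<parallel> \<le> 2 \<parallel>K\<^sub>r - M\<parallel>\<close>, and rotating \<open>Z\<close> by the polar factor of \<open>Z\<^sup>T W\<^sub>0\<close> turns this
  into a bound on the distance.
\<close>

text \<open>The constant 1/24 makes the argument numerical. With d = sigma_r(M) one has sigma_r(Z) =
  sqrt (2 d), the Gram matrices give dist^2 <= 4 q^2 / d where q is the Frobenius error of the
  truncated decomposition, and 1/24 then asks for q <= d / 34, about 0.0294 d. As the truncation
  level is prescribed, no free constant can shrink the truncation bias, which alone takes 0.027 d.
  Outliers (0.0005 d) and sampling error (0.001 d) share the rest and are paid for by s1 and c4. So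
  the lower bound 0.66 for the median has to be close to the true median 0.6745 of |g|, and the
  Gaussian tail has to be estimated with explicit numbers; the upper bound 2 only enters c4 and may
  be crude. The threshold is random, hence so is the centring c M. Once the second half of the
  sample is frozen, c is a constant and c M is exactly the mean, so no continuity in the threshold
  is needed. The sample median concentrates only at a small rate in m. Its failure is therefore
  charged to the power of n, together with the union over the grid, through m >= C n log n.\<close>

no_notation Finite_Cartesian_Product.vec_nth (infixl "$" 90)
no_notation Inner_Product.real_inner_class.inner (infix "\<bullet>" 70)

section \<open>The Frobenius inner product and its adjoint rules\<close>

definition frob_inner :: "real mat \<Rightarrow> real mat \<Rightarrow> real" where
  "frob_inner A B = (\<Sum>i<dim_row A. \<Sum>j<dim_col A. A $$ (i, j) * B $$ (i, j))"

lemma frob_norm_square: "(frob_norm A)\<^sup>2 = frob_inner A A"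
  unfolding frob_norm_def frob_inner_def
  by (simp add: sum_nonneg power2_eq_square[symmetric])

lemma frob_norm_nonneg [simp]: "0 \<le> frob_norm A"
  unfolding frob_norm_def by (simp add: sum_nonneg)

lemma frob_norm_eq_sqrt: "frob_norm A = sqrt (frob_inner A A)"
  unfolding frob_norm_def frob_inner_def by (simp add: power2_eq_square)

lemma frob_inner_self_nonneg [simp]: "0 \<le> frob_inner A A"
  by (metis frob_norm_square zero_le_power2)

lemma frob_inner_commute:
  assumes "A \<in> carrier_mat n m" "B \<in> carrier_mat n m"
  shows "frob_inner A B = frob_inner B A"
  using assms unfolding frob_inner_def by (simp add: mult.commute)

lemma frob_inner_add_left:
  assumes "A \<in> carrier_mat n m" "B \<in> carrier_mat n m" "C \<in> carrier_mat n m"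
  shows "frob_inner (A + B) C = frob_inner A C + frob_inner B C"
  using assms unfolding frob_inner_def by (simp add: algebra_simps sum.distrib)

lemma frob_inner_add_right:
  assumes "A \<in> carrier_mat n m" "B \<in> carrier_mat n m" "C \<in> carrier_mat n m"
  shows "frob_inner C (A + B) = frob_inner C A + frob_inner C B"
  using assms unfolding frob_inner_def by (simp add: algebra_simps sum.distrib)

lemma frob_inner_diff_left:
  assumes "A \<in> carrier_mat n m" "B \<in> carrier_mat n m" "C \<in> carrier_mat n m"
  shows "frob_inner (A - B) C = frob_inner A C - frob_inner B C"
  using assms unfolding frob_inner_def by (simp add: algebra_simps sum_subtractf)

lemma frob_inner_diff_right:
  assumes "A \<in> carrier_mat n m" "B \<in> carrier_mat n m" "C \<in> carrier_mat n m"
  shows "frob_inner C (A - B) = frob_inner C A - frob_inner C B"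
  using assms unfolding frob_inner_def by (simp add: algebra_simps sum_subtractf)

lemma frob_inner_transpose:
  assumes "A \<in> carrier_mat n m" "B \<in> carrier_mat n m"
  shows "frob_inner A\<^sup>T B\<^sup>T = frob_inner A B"
  using assms unfolding frob_inner_def by (simp, subst sum.swap, simp)

lemma mult_mat_index_sum:
  assumes "A \<in> carrier_mat n k" "B \<in> carrier_mat k m" "i < n" "j < m"
  shows "(A * B) $$ (i, j) = (\<Sum>l<k. A $$ (i, l) * B $$ (l, j))"
  using assms by (simp add: scalar_prod_def atLeast0LessThan)

text \<open>A factor moves across the inner product as its transpose. Together with the version for
  right factors this replaces all manipulation of traces.\<close>

lemma frob_inner_mult_left:
  assumes A: "A \<in> carrier_mat n k" and B: "B \<in> carrier_mat k m" and C: "C \<in> carrier_mat n m"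
  shows "frob_inner (A * B) C = frob_inner B (A\<^sup>T * C)"
proof -
  have "frob_inner (A * B) C = (\<Sum>i<n. \<Sum>j<m. \<Sum>l<k. A $$ (i, l) * B $$ (l, j) * C $$ (i, j))"
    unfolding frob_inner_def using assms
    by (intro sum.cong) (auto simp: mult_mat_index_sum[OF A B] sum_distrib_right simp del: index_mult_mat(1))
  also have "\<dots> = (\<Sum>i<n. \<Sum>l<k. \<Sum>j<m. A $$ (i, l) * B $$ (l, j) * C $$ (i, j))"
    by (intro sum.cong refl sum.swap)
  also have "\<dots> = (\<Sum>l<k. \<Sum>i<n. \<Sum>j<m. A $$ (i, l) * B $$ (l, j) * C $$ (i, j))"
    by (rule sum.swap)
  also have "\<dots> = (\<Sum>l<k. \<Sum>j<m. \<Sum>i<n. A $$ (i, l) * B $$ (l, j) * C $$ (i, j))"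
    by (intro sum.cong refl sum.swap)
  also have "\<dots> = frob_inner B (A\<^sup>T * C)"
    unfolding frob_inner_def using assms
    by (intro sum.cong)
      (auto simp: mult_mat_index_sum[of "A\<^sup>T" k n C m] sum_distrib_left mult_ac
          simp del: index_mult_mat(1))
  finally show ?thesis .
qed

lemma frob_inner_mult_right:
  assumes A: "A \<in> carrier_mat n k" and B: "B \<in> carrier_mat k m" and C: "C \<in> carrier_mat n m"
  shows "frob_inner (A * B) C = frob_inner A (C * B\<^sup>T)"
proof -
  have "frob_inner (A * B) C = frob_inner (B\<^sup>T * A\<^sup>T) C\<^sup>T"
    using assms frob_inner_transpose[of "A * B" n m C] by (simp add: transpose_mult)
  also have "\<dots> = frob_inner A\<^sup>T (B * C\<^sup>T)"
    using assms by (subst frob_inner_mult_left[of _ m k _ n]) auto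
  also have "\<dots> = frob_inner A\<^sup>T (C * B\<^sup>T)\<^sup>T"
    using assms by (subst transpose_mult[of C n m "B\<^sup>T" k]) auto
  also have "\<dots> = frob_inner A (C * B\<^sup>T)"
    using assms by (intro frob_inner_transpose) auto
  finally show ?thesis .
qed

lemma frob_inner_Cauchy_Schwarz:
  assumes A: "A \<in> carrier_mat n m" and B: "B \<in> carrier_mat n m"
  shows "frob_inner A B \<le> frob_norm A * frob_norm B"
proof -
  have "frob_inner A B = (\<Sum>p\<in>{..<n}\<times>{..<m}. A $$ p * B $$ p)"
    using A B unfolding frob_inner_def by (simp add: sum.cartesian_product split_def)
  also have "\<dots> \<le> (\<Sum>p\<in>{..<n}\<times>{..<m}. \<bar>A $$ p\<bar> * \<bar>B $$ p\<bar>)"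
    by (intro sum_mono) (simp add: abs_mult[symmetric])
  also have "\<dots> \<le> L2_set (\<lambda>p. A $$ p) ({..<n}\<times>{..<m}) * L2_set (\<lambda>p. B $$ p) ({..<n}\<times>{..<m})"
    by (rule L2_set_mult_ineq)
  also have "\<dots> = frob_norm A * frob_norm B"
    using A B unfolding frob_norm_def L2_set_def by (simp add: sum.cartesian_product split_def)
  finally show ?thesis .
qed

lemma frob_norm_triangle:
  assumes A: "A \<in> carrier_mat n m" and B: "B \<in> carrier_mat n m"
  shows "frob_norm (A + B) \<le> frob_norm A + frob_norm B"
proof -
  have "(frob_norm (A + B))\<^sup>2 = (frob_norm A)\<^sup>2 + 2 * frob_inner A B + (frob_norm B)\<^sup>2"
    unfolding frob_norm_square using assms
    by (simp add: frob_inner_add_left[of _ n m] frob_inner_add_right[of _ n m]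
        frob_inner_commute[of B n m A])
  also have "\<dots> \<le> (frob_norm A + frob_norm B)\<^sup>2"
    using frob_inner_Cauchy_Schwarz[OF A B] by (simp add: power2_sum)
  finally show ?thesis by (rule power2_le_imp_le) simp
qed

lemma frob_norm_smult: "frob_norm (c \<cdot>\<^sub>m A) = \<bar>c\<bar> * frob_norm A"
  unfolding frob_norm_def
  by (simp add: power_mult_distrib sum_distrib_left[symmetric] real_sqrt_mult)

lemma mat_inner_eq_sum:
  assumes A: "A \<in> carrier_mat n m" and B: "B \<in> carrier_mat n m"
  shows "mat_inner A B = (\<Sum>i<n. \<Sum>j<m. A $$ (i, j) * B $$ (i, j))"
proof -
  have "mat_inner A B = (\<Sum>j<m. \<Sum>i<n. B $$ (i, j) * A $$ (i, j))"
    unfolding mat_inner_def mat_trace_def using assms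
    by (intro sum.cong) (auto simp: scalar_prod_def atLeast0LessThan)
  then show ?thesis by (subst sum.swap) (simp add: mult.commute)
qed

section \<open>The real spectral theorem\<close>

text \<open>The number \<open>s\<close>, the Hermitian form of \<open>A\<close> at an eigenvector v,
  is its own conjugate because \<open>A\<close> is real and symmetric, and it equals z |v|^2 with
  |v| nonzero.\<close>

lemma real_symmetric_eigenvalue:
  assumes A: "(A :: real mat) \<in> carrier_mat n n" and sym: "A\<^sup>T = A"
    and e: "eigenvalue (map_mat complex_of_real A) z"
  shows "Im z = 0"
proof -
  let ?C = "map_mat complex_of_real A"
  obtain v where v: "v \<in> carrier_vec n" "v \<noteq> 0\<^sub>v n" and ev: "?C *\<^sub>v v = z \<cdot>\<^sub>v v"
    using e A unfolding eigenvalue_def eigenvector_def by auto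
  have row: "(\<Sum>j<n. complex_of_real (A $$ (i, j)) * v $ j) = z * v $ i" if i: "i < n" for i
  proof -
    have "(?C *\<^sub>v v) $ i = (z \<cdot>\<^sub>v v) $ i" using ev by simp
    then show ?thesis using i v A by (simp add: scalar_prod_def atLeast0LessThan)
  qed
  have sA: "A $$ (i, j) = A $$ (j, i)" if "i < n" "j < n" for i j
    using A that sym by (metis carrier_matD index_transpose_mat(1))
  define s where "s = (\<Sum>i<n. \<Sum>j<n. cnj (v $ i) * (complex_of_real (A $$ (i, j)) * v $ j))"
  have s1: "s = z * (\<Sum>i<n. complex_of_real ((cmod (v $ i))\<^sup>2))"
  proof -
    have "s = (\<Sum>i<n. cnj (v $ i) * (z * v $ i))"
      unfolding s_def by (intro sum.cong refl) (simp add: sum_distrib_left[symmetric] row)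
    also have "\<dots> = (\<Sum>i<n. z * complex_of_real ((cmod (v $ i))\<^sup>2))"
      by (intro sum.cong refl) (simp only: complex_norm_square mult_ac)
    finally show ?thesis by (simp add: sum_distrib_left)
  qed
  have "cnj s = (\<Sum>i<n. \<Sum>j<n. v $ i * (complex_of_real (A $$ (i, j)) * cnj (v $ j)))"
    unfolding s_def by simp
  also have "\<dots> = (\<Sum>j<n. \<Sum>i<n. v $ i * (complex_of_real (A $$ (i, j)) * cnj (v $ j)))"
    by (rule sum.swap)
  also have "\<dots> = s" unfolding s_def
    by (intro sum.cong refl) (simp add: sA mult_ac)
  finally have "Im s = 0" by (metis Reals_cnj_iff complex_is_Real_iff)
  moreover have "Im s = Im z * (\<Sum>i<n. (cmod (v $ i))\<^sup>2)"
    unfolding s1 of_real_sum[symmetric] by simp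
  moreover have "(\<Sum>i<n. (cmod (v $ i))\<^sup>2) \<noteq> 0"
  proof
    assume "(\<Sum>i<n. (cmod (v $ i))\<^sup>2) = 0"
    then have "\<forall>i<n. v $ i = 0" by (simp add: sum_nonneg_eq_0_iff)
    with v have "v = 0\<^sub>v n" by (intro eq_vecI) auto
    with v show False by simp
  qed
  ultimately show ?thesis by simp
qed

text \<open>The polynomial splits over the complex numbers with real roots only, so this
  factorization is the image of a real one under an injective homomorphism.\<close>

lemma real_symmetric_char_poly_splits:
  assumes A: "(A :: real mat) \<in> carrier_mat n n" and sym: "A\<^sup>T = A"
  shows "\<exists>es. char_poly A = (\<Prod>e\<leftarrow>es. [:- e, 1:]) \<and> length es = n"
proof -
  interpret h: inj_comm_ring_hom complex_of_real
    by unfold_locales (auto)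
  interpret hp: map_poly_inj_comm_ring_hom complex_of_real ..
  let ?C = "map_mat complex_of_real A"
  have C: "?C \<in> carrier_mat n n" using A by simp
  obtain as where as: "char_poly ?C = (\<Prod>a\<leftarrow>as. [:- a, 1:])" "length as = n"
    using char_poly_factorized[OF C] by blast
  have "complex_of_real (Re a) = a" if "a \<in> set as" for a
  proof -
    have "poly (char_poly ?C) a = 0"
      unfolding as(1) poly_prod_list using that by (auto simp: prod_list_zero_iff)
    then have "eigenvalue ?C a" using eigenvalue_root_char_poly[OF C] by simp
    from real_symmetric_eigenvalue[OF A sym this] show ?thesis by (simp add: complex_eq_iff)
  qed
  then have eq: "as = map complex_of_real (map Re as)"
    by (simp add: map_idI)
  have "map_poly complex_of_real (char_poly A) = char_poly ?C"
    by (rule of_real_hom.char_poly_hom[OF A, symmetric])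
  also have "\<dots> = (\<Prod>a\<leftarrow>map Re as. [:- complex_of_real a, 1:])"
    unfolding as(1) by (subst eq) (simp add: o_def)
  also have "\<dots> = map_poly complex_of_real (\<Prod>a\<leftarrow>map Re as. [:- a, 1:])"
    by (simp add: hp.hom_prod_list o_def)
  finally have "char_poly A = (\<Prod>a\<leftarrow>map Re as. [:- a, 1:])" by simp
  with as(2) show ?thesis by (intro exI[of _ "map Re as"]) simp
qed

definition diag_fun :: "nat \<Rightarrow> (nat \<Rightarrow> real) \<Rightarrow> real mat" where
  "diag_fun n d = mat n n (\<lambda>(i, j). if i = j then d i else 0)"

lemma diag_fun_carrier [simp]: "diag_fun n d \<in> carrier_mat n n"
  and diag_fun_index [simp]: "i < n \<Longrightarrow> j < n \<Longrightarrow> diag_fun n d $$ (i, j) = (if i = j then d i else 0)"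
  and diag_fun_dim [simp]: "dim_row (diag_fun n d) = n" "dim_col (diag_fun n d) = n"
  and diag_fun_transpose [simp]: "(diag_fun n d)\<^sup>T = diag_fun n d"
  unfolding diag_fun_def by (auto intro!: eq_matI)

lemma diag_fun_mult [simp]: "diag_fun n d * diag_fun n e = diag_fun n (\<lambda>i. d i * e i)"
proof (rule eq_matI)
  fix i j assume "i < dim_row (diag_fun n (\<lambda>i. d i * e i))" "j < dim_col (diag_fun n (\<lambda>i. d i * e i))"
  then have ij: "i < n" "j < n" by auto
  have "(diag_fun n d * diag_fun n e) $$ (i, j) = (\<Sum>l<n. diag_fun n d $$ (i, l) * diag_fun n e $$ (l, j))"
    using ij by (intro mult_mat_index_sum) auto
  also have "\<dots> = (\<Sum>l<n. if l = i then (if i = j then d i * e i else 0) else 0)"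
    using ij by (intro sum.cong) auto
  also have "\<dots> = diag_fun n (\<lambda>i. d i * e i) $$ (i, j)"
    using ij by (simp only: sum.delta finite_lessThan) simp
  finally show "(diag_fun n d * diag_fun n e) $$ (i, j) = diag_fun n (\<lambda>i. d i * e i) $$ (i, j)" .
qed auto

text \<open>Gram-Schmidt leaves the first vector of the completed basis alone, and normalizing the
  columns afterwards does not change it either, as \<open>v\<close> already has length 1.\<close>

lemma real_unit_vec_extends_orthogonal:
  assumes v: "(v :: real vec) \<in> carrier_vec n" and unit: "v \<bullet> v = 1"
  shows "\<exists>W \<in> carrier_mat n n. W\<^sup>T * W = 1\<^sub>m n \<and> col W 0 = v"
proof -
  have v0: "v \<noteq> 0\<^sub>v n" using unit v by auto
  have n: "0 < n" using v unit by (cases "n = 0") (auto simp: scalar_prod_def)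
  interpret cof_vec_space n "TYPE(real)" .
  define b where "b = basis_completion v"
  define ws where "ws = gram_schmidt n b"
  from basis_completion[OF v v0, folded b_def]
  have dist_b: "distinct b" and indep: "\<not> lin_dep (set b)" and b: "set b \<subseteq> carrier_vec n"
    and hdb: "hd b = v" and len_b: "length b = n" by auto
  from hdb len_b n obtain vs where bv: "b = v # vs" by (cases b, auto)
  from gram_schmidt_result[OF b dist_b indep refl, folded ws_def]
  have ws: "set ws \<subseteq> carrier_vec n" "corthogonal ws" "length ws = n"
    by (auto simp: len_b)
  from gram_schmidt_hd[OF v, of vs, folded bv] have hdws: "hd ws = v" unfolding ws_def .
  have ws0: "ws ! 0 = v" using hdws ws(3) n hd_conv_nth[of ws] by (cases ws) auto
  have orth: "ws ! i \<bullet> ws ! j = 0 \<longleftrightarrow> i \<noteq> j" if "i < n" "j < n" for i j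
    using corthogonalD[OF ws(2)] that ws(3) by simp
  have wc: "ws ! i \<in> carrier_vec n" if "i < n" for i
    using ws that nth_mem by blast
  define W where "W = mat n n (\<lambda>(i, j). ws ! j $ i / sqrt (ws ! j \<bullet> ws ! j))"
  have W: "W \<in> carrier_mat n n" by (simp add: W_def)
  have "W\<^sup>T * W = 1\<^sub>m n"
  proof (rule eq_matI)
    fix i j assume "i < dim_row (1\<^sub>m n :: real mat)" "j < dim_col (1\<^sub>m n :: real mat)"
    then have ij: "i < n" "j < n" by auto
    have "(W\<^sup>T * W) $$ (i, j) = (\<Sum>l<n. W $$ (l, i) * W $$ (l, j))"
      using ij W by (subst mult_mat_index_sum[of _ n n _ n]) auto
    also have "\<dots> = (\<Sum>l<n. ws ! i $ l * ws ! j $ l) /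
        (sqrt (ws ! i \<bullet> ws ! i) * sqrt (ws ! j \<bullet> ws ! j))"
      using ij by (simp add: W_def sum_divide_distrib)
    also have "(\<Sum>l<n. ws ! i $ l * ws ! j $ l) = ws ! i \<bullet> ws ! j"
      using wc[OF ij(2)] by (simp add: scalar_prod_def atLeast0LessThan)
    also have "ws ! i \<bullet> ws ! j / (sqrt (ws ! i \<bullet> ws ! i) * sqrt (ws ! j \<bullet> ws ! j)) =
        (if i = j then 1 else 0)"
    proof (cases "i = j")
      case True
      have "ws ! i \<bullet> ws ! i \<ge> 0" by (simp add: scalar_prod_def sum_nonneg)
      then show ?thesis using True orth[OF ij] by (simp add: real_sqrt_mult_self)
    qed (use orth[OF ij] in simp)
    finally show "(W\<^sup>T * W) $$ (i, j) = 1\<^sub>m n $$ (i, j)" using ij by simp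
  qed (use W in auto)
  moreover have "col W 0 = v"
    using n v unit ws0 by (intro eq_vecI) (auto simp: W_def)
  ultimately show ?thesis using W by blast
qed

lemma orthogonal_mat_commute:
  "(Q :: real mat) \<in> carrier_mat n n \<Longrightarrow> Q\<^sup>T * Q = 1\<^sub>m n \<Longrightarrow> Q * Q\<^sup>T = 1\<^sub>m n"
  by (rule mat_mult_left_right_inverse[of "Q\<^sup>T" n Q]) auto

text \<open>Deflation: if a unit eigenvector is the first column of an orthogonal \<open>W\<close>,
  then W^T A W has the eigenvalue in its corner and, by symmetry, zeros in the rest of its first row
  and column. The induction hypothesis diagonalizes the remaining block.\<close>

lemma real_symmetric_spectral:
  "(A :: real mat) \<in> carrier_mat n n \<Longrightarrow> A\<^sup>T = A \<Longrightarrow>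
    \<exists>Q d. Q \<in> carrier_mat n n \<and> Q\<^sup>T * Q = 1\<^sub>m n \<and> A = Q * diag_fun n d * Q\<^sup>T"
proof (induction n arbitrary: A)
  case 0
  then show ?case by (intro exI[of _ "1\<^sub>m 0"] exI[of _ "\<lambda>_. 0"]) (auto intro!: eq_matI)
next
  case (Suc n A)
  let ?N = "Suc n"
  obtain es where es: "char_poly A = (\<Prod>e\<leftarrow>es. [:- e, 1:])" "length es = ?N"
    using real_symmetric_char_poly_splits[OF Suc.prems] by blast
  then obtain e es' where "es = e # es'" by (cases es) auto
  with es have "poly (char_poly A) e = 0" by simp
  then have "eigenvalue A e" using eigenvalue_root_char_poly[OF Suc.prems(1)] by simp
  then obtain u where u: "u \<in> carrier_vec ?N" "u \<noteq> 0\<^sub>v ?N" "A *\<^sub>v u = e \<cdot>\<^sub>v u"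
    using Suc.prems(1) unfolding eigenvalue_def eigenvector_def by auto
  have upos: "u \<bullet> u > 0"
    using conjugate_square_greater_0_vec[OF u(1)] u(2) by simp
  define v where "v = (1 / sqrt (u \<bullet> u)) \<cdot>\<^sub>v u"
  have v: "v \<in> carrier_vec ?N" using u by (simp add: v_def)
  have vv: "v \<bullet> v = 1"
    unfolding v_def using u upos by simp
  have Av: "A *\<^sub>v v = e \<cdot>\<^sub>v v"
    unfolding v_def using u Suc.prems(1)
    by (subst mult_mat_vec[of _ ?N ?N]) (auto simp: smult_smult_assoc mult.commute)
  obtain W where W: "W \<in> carrier_mat ?N ?N" "W\<^sup>T * W = 1\<^sub>m ?N" "col W 0 = v"
    using real_unit_vec_extends_orthogonal[OF v vv] by blast
  have WW: "W * W\<^sup>T = 1\<^sub>m ?N" using orthogonal_mat_commute W by blast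
  define A' where "A' = W\<^sup>T * A * W"
  have A': "A' \<in> carrier_mat ?N ?N" unfolding A'_def using W Suc.prems by auto
  have sym': "A'\<^sup>T = A'"
    unfolding A'_def using W Suc.prems
    by (simp add: transpose_mult[of _ ?N ?N _ ?N] assoc_mult_mat[of _ ?N ?N _ ?N _ ?N])
  have col0: "A' $$ (i, 0) = (if i = 0 then e else 0)" if i: "i < ?N" for i
  proof -
    have "A' $$ (i, 0) = (W\<^sup>T * (A * W)) $$ (i, 0)"
      unfolding A'_def using W Suc.prems by (simp add: assoc_mult_mat[of _ ?N ?N _ ?N _ ?N])
    also have "\<dots> = col W i \<bullet> (A *\<^sub>v col W 0)"
      using i W Suc.prems by (simp add: col_mult2[of _ ?N ?N _ ?N] mult_mat_vec_def)
    also have "\<dots> = e * (W\<^sup>T * W) $$ (i, 0)"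
      unfolding W(3) Av using i W(1) W(3) v by simp
    finally show ?thesis unfolding W(2) using i by simp
  qed
  have row0: "A' $$ (0, j) = (if j = 0 then e else 0)" if j: "j < ?N" for j
    using col0[OF j] sym' A' j by (metis carrier_matD index_transpose_mat(1) zero_less_Suc)
  define B where "B = mat n n (\<lambda>(i, j). A' $$ (Suc i, Suc j))"
  have B: "B \<in> carrier_mat n n" by (simp add: B_def)
  have "B\<^sup>T = B"
  proof (rule eq_matI)
    fix i j assume "i < dim_row B" "j < dim_col B"
    then have "i < n" "j < n" by (auto simp: B_def)
    then show "B\<^sup>T $$ (i, j) = B $$ (i, j)"
      using arg_cong[OF sym', of "\<lambda>A. A $$ (Suc i, Suc j)"] A' by (simp add: B_def)
  qed (auto simp: B_def)
  from Suc.IH[OF B this] obtain Q d where Q: "Q \<in> carrier_mat n n" "Q\<^sup>T * Q = 1\<^sub>m n"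
    and BQ: "B = Q * diag_fun n d * Q\<^sup>T" by blast
  let ?z = "0\<^sub>m 1 n :: real mat" and ?z' = "0\<^sub>m n 1 :: real mat"
  let ?e = "mat 1 1 (\<lambda>_. e)"
  define P where "P = four_block_mat (1\<^sub>m 1) ?z ?z' Q"
  have P: "P \<in> carrier_mat ?N ?N" unfolding P_def using Q by (auto simp: four_block_mat_def)
  have PT: "P\<^sup>T = four_block_mat (1\<^sub>m 1) ?z ?z' Q\<^sup>T"
    unfolding P_def using Q by (subst transpose_four_block_mat[of _ 1 1 _ n _ n]) auto
  define f where "f = (\<lambda>i. if i = 0 then e else d (i - 1))"
  have D: "diag_fun ?N f = four_block_mat ?e ?z ?z' (diag_fun n d)"
    by (intro eq_matI) (auto simp: f_def)
  have A'_block: "A' = four_block_mat ?e ?z ?z' B"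
  proof (rule eq_matI)
    fix i j assume "i < dim_row (four_block_mat ?e ?z ?z' B)" "j < dim_col (four_block_mat ?e ?z ?z' B)"
    then have "i < ?N" "j < ?N" using B by auto
    then show "A' $$ (i, j) = four_block_mat ?e ?z ?z' B $$ (i, j)"
      using B col0[of i] row0[of j] by (auto simp: B_def)
  qed (use A' B in auto)
  note mfb = mult_four_block_mat[of _ 1 1 _ n _ n _ _ 1 _ n]
  have PD: "P * diag_fun ?N f = four_block_mat ?e ?z ?z' (Q * diag_fun n d)"
    unfolding P_def D using Q by (subst mfb) auto
  have PDP: "P * diag_fun ?N f * P\<^sup>T = A'"
    unfolding PD PT A'_block BQ using Q by (subst mfb) auto
  have "P\<^sup>T * P = four_block_mat (1\<^sub>m 1) ?z ?z' (Q\<^sup>T * Q)"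
    unfolding PT unfolding P_def using Q(1) by (subst mfb) auto
  then have PP: "P\<^sup>T * P = 1\<^sub>m ?N" unfolding Q(2) by simp
  let ?D = "diag_fun ?N f"
  have WT: "W\<^sup>T \<in> carrier_mat ?N ?N" and PTc: "P\<^sup>T \<in> carrier_mat ?N ?N" using W P by auto
  have WPT: "(W * P)\<^sup>T = P\<^sup>T * W\<^sup>T" by (rule transpose_mult[OF W(1) P])
  have "(W * P)\<^sup>T * (W * P) = P\<^sup>T * (W\<^sup>T * W) * P"
    unfolding WPT using W(1) P WT PTc by (simp add: assoc_mult_mat[of _ ?N ?N _ ?N _ ?N])
  then have orth: "(W * P)\<^sup>T * (W * P) = 1\<^sub>m ?N" unfolding W(2) using PTc PP by simp
  have gen: "W * (P * D * P\<^sup>T) * W\<^sup>T = (W * P) * D * (P\<^sup>T * W\<^sup>T)"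
    if "D \<in> carrier_mat ?N ?N" for D
    using W(1) P that by (simp add: assoc_mult_mat[of _ ?N ?N _ ?N _ ?N])
  have "A = (W * W\<^sup>T) * A * (W * W\<^sup>T)" unfolding WW using Suc.prems(1) by simp
  also have "\<dots> = W * A' * W\<^sup>T"
    unfolding A'_def using W(1) WT Suc.prems(1) by (simp add: assoc_mult_mat[of _ ?N ?N _ ?N _ ?N])
  also have "\<dots> = (W * P) * ?D * (W * P)\<^sup>T"
    unfolding PDP[symmetric] WPT by (rule gen) simp
  finally show ?case using orth mult_carrier_mat[OF W(1) P]
    by (intro exI[of _ "W * P"] exI[of _ f]) simp
qed

section \<open>Orthogonal alignment of balanced factors\<close>

text \<open>This is \<open>\<parallel>W W\<^sup>T - Z Z\<^sup>T\<parallel>\<close> squared, written with \<open>r \<times> r\<close> matrices only.\<close>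
definition gram_gap :: "real mat \<Rightarrow> real mat \<Rightarrow> real" where
  "gram_gap W Z = frob_inner (W\<^sup>T * W) (W\<^sup>T * W) - 2 * frob_inner (W\<^sup>T * Z) (W\<^sup>T * Z)
     + frob_inner (Z\<^sup>T * Z) (Z\<^sup>T * Z)"


text \<open>Reduces inner products of large outer products to Gram matrices of size \<open>k\<close>
  by \<open>l\<close>; every comparison of W W^T with Z Z^T is computed this way.\<close>

lemma frob_inner_outer:
  assumes A: "A \<in> carrier_mat n k" and B: "B \<in> carrier_mat m k"
    and C: "C \<in> carrier_mat n l" and D: "D \<in> carrier_mat m l"
  shows "frob_inner (A * B\<^sup>T) (C * D\<^sup>T) = frob_inner (A\<^sup>T * C) (B\<^sup>T * D)"
proof -
  have "frob_inner (A * B\<^sup>T) (C * D\<^sup>T) = frob_inner B\<^sup>T (A\<^sup>T * (C * D\<^sup>T))"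
    using assms by (intro frob_inner_mult_left) auto
  also have "A\<^sup>T * (C * D\<^sup>T) = A\<^sup>T * C * D\<^sup>T"
    using assms by (intro assoc_mult_mat[symmetric]) auto
  also have "frob_inner B\<^sup>T (A\<^sup>T * C * D\<^sup>T) = frob_inner (A\<^sup>T * C * D\<^sup>T) B\<^sup>T"
    using assms by (intro frob_inner_commute) auto
  also have "\<dots> = frob_inner (A\<^sup>T * C) (B\<^sup>T * (D\<^sup>T)\<^sup>T)"
    using assms by (intro frob_inner_mult_right) auto
  finally show ?thesis by simp
qed

lemma frob_inner_diff_self:
  assumes A: "A \<in> carrier_mat n m" and B: "B \<in> carrier_mat n m"
  shows "frob_inner (A - B) (A - B) = frob_inner A A - 2 * frob_inner A B + frob_inner B B"
  using assms frob_inner_commute[OF B A]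
  by (simp add: frob_inner_diff_left[of _ n m] frob_inner_diff_right[of _ n m] minus_carrier_mat)

lemma frob_inner_add_self:
  assumes A: "A \<in> carrier_mat n m" and B: "B \<in> carrier_mat n m"
  shows "frob_inner (A + B) (A + B) = frob_inner A A + 2 * frob_inner A B + frob_inner B B"
  using assms frob_inner_commute[OF B A]
  by (simp add: frob_inner_add_left[of _ n m] frob_inner_add_right[of _ n m])

lemma gram_gap_eq:
  assumes W: "W \<in> carrier_mat n r" and Z: "Z \<in> carrier_mat n r"
  shows "gram_gap W Z = (frob_norm (Z * Z\<^sup>T - W * W\<^sup>T))\<^sup>2"
proof -
  have c: "W * W\<^sup>T \<in> carrier_mat n n" "Z * Z\<^sup>T \<in> carrier_mat n n"
    "W\<^sup>T * Z \<in> carrier_mat r r" "Z\<^sup>T * W \<in> carrier_mat r r" using assms by auto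
  have "frob_inner (Z * Z\<^sup>T) (W * W\<^sup>T) = frob_inner (W\<^sup>T * Z) (W\<^sup>T * Z)"
    using frob_inner_outer[OF W W Z Z] frob_inner_commute[OF c(1,2)] by simp
  then show ?thesis
    unfolding frob_norm_square gram_gap_def frob_inner_diff_self[OF c(2,1)]
    by (simp add: frob_inner_outer[OF W W W W] frob_inner_outer[OF Z Z Z Z])
qed

text \<open>Put D = W - Z and T = W + Z. As W^T Z is symmetric, T^T T and D^T D are (a + b) + 2 g
  and (a + b) - 2 g, so |T D^T|^2 = 2 \<open>gram_gap\<close> - |a - b|^2. In the other direction T
  D^T = W D^T + Z D^T, where the cross term is nonnegative by \<open>psd\<close>, so |T D^T|^2 is at
  least |Z D^T|^2, which \<open>lb\<close> bounds below by c |D|^2.\<close>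

lemma aligned_factor_bound:
  assumes W: "W \<in> carrier_mat n r" and Z: "Z \<in> carrier_mat n r"
    and sym: "W\<^sup>T * Z = Z\<^sup>T * W"
    and psd: "\<And>k B. B \<in> carrier_mat r k \<Longrightarrow> 0 \<le> frob_inner (W * B) (Z * B)"
    and lb: "\<And>k B. B \<in> carrier_mat r k \<Longrightarrow> c * frob_inner B B \<le> frob_inner (Z * B) (Z * B)"
  shows "c * (frob_norm (W - Z))\<^sup>2 \<le> 2 * gram_gap W Z"
proof -
  define D where "D = W - Z"
  define T where "T = W + Z"
  define a where "a = W\<^sup>T * W"
  define b where "b = Z\<^sup>T * Z"
  define g where "g = W\<^sup>T * Z"
  have gZ: "Z\<^sup>T * W = g" using sym by (simp add: g_def)
  have DT[simp]: "D \<in> carrier_mat n r" "T \<in> carrier_mat n r" using W Z by (auto simp: D_def T_def)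
  have abg[simp]: "a \<in> carrier_mat r r" "b \<in> carrier_mat r r" "g \<in> carrier_mat r r"
    using W Z by (auto simp: a_def b_def g_def)
  have dims[simp]: "dim_row a = r" "dim_col a = r" "dim_row b = r" "dim_col b = r"
    "dim_row g = r" "dim_col g = r" using abg by (auto simp del: abg)
  have dt: "D\<^sup>T = W\<^sup>T - Z\<^sup>T" "T\<^sup>T = W\<^sup>T + Z\<^sup>T"
    unfolding D_def T_def using W Z by (auto simp: transpose_minus transpose_add)
  have TT: "T\<^sup>T * T = (a + b) + (g + g)"
    unfolding dt unfolding T_def using W Z
    by (simp add: add_mult_distrib_mat[of _ r n _ _ r] mult_add_distrib_mat[of _ r n _ r]
        gZ a_def[symmetric] b_def[symmetric] g_def[symmetric])
      (intro eq_matI, auto)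
  have DD: "D\<^sup>T * D = (a + b) - (g + g)"
    unfolding dt unfolding D_def using W Z
    by (simp add: minus_carrier_mat minus_mult_distrib_mat[of _ r n _ _ r] mult_minus_distrib_mat[of _ r n _ r]
        gZ a_def[symmetric] b_def[symmetric] g_def[symmetric])
      (intro eq_matI, auto)
  have "frob_inner (T * D\<^sup>T) (T * D\<^sup>T) = frob_inner (T\<^sup>T * T) (D\<^sup>T * D)"
    by (rule frob_inner_outer[OF DT(2,1) DT(2,1)])
  also have "\<dots> = frob_inner (a + b) (a + b) - 4 * frob_inner g g"
    unfolding TT DD using abg
    by (simp add: frob_inner_add_left[of "a + b" r r "g + g"] frob_inner_diff_right[of "a + b" r r "g + g"]
        frob_inner_commute[of "g + g" r r "a + b"] frob_inner_add_self[of g r r g])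
  also have "\<dots> = 2 * gram_gap W Z - frob_inner (a - b) (a - b)"
    unfolding gram_gap_def a_def[symmetric] b_def[symmetric] g_def[symmetric]
    by (simp add: frob_inner_add_self[of a r r b] frob_inner_diff_self[of a r r b])
  finally have le: "frob_inner (T * D\<^sup>T) (T * D\<^sup>T) \<le> 2 * gram_gap W Z"
    using frob_inner_self_nonneg[of "a - b"] by linarith
  have "c * (frob_norm (W - Z))\<^sup>2 = c * frob_inner D\<^sup>T D\<^sup>T"
    unfolding frob_norm_square D_def[symmetric] by (simp add: frob_inner_transpose[of _ n r])
  also have "\<dots> \<le> frob_inner (Z * D\<^sup>T) (Z * D\<^sup>T)" by (rule lb[of _ n]) simp
  also have "\<dots> \<le> frob_inner (T * D\<^sup>T) (T * D\<^sup>T)"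
  proof -
    have c: "W * D\<^sup>T \<in> carrier_mat n n" "Z * D\<^sup>T \<in> carrier_mat n n" using W Z DT(1) by auto
    have "T * D\<^sup>T = W * D\<^sup>T + Z * D\<^sup>T"
      unfolding T_def using W Z DT(1) by (intro add_mult_distrib_mat[of _ n r _ _ n]) auto
    then have "frob_inner (T * D\<^sup>T) (T * D\<^sup>T) = frob_inner (W * D\<^sup>T) (W * D\<^sup>T)
        + 2 * frob_inner (W * D\<^sup>T) (Z * D\<^sup>T) + frob_inner (Z * D\<^sup>T) (Z * D\<^sup>T)"
      by (simp add: frob_inner_add_self[OF c])
    then show ?thesis using psd[of "D\<^sup>T" n] frob_inner_self_nonneg[of "W * D\<^sup>T"] by simp
  qed
  finally show ?thesis using le by simp
qed

lemma orthogonal_frob_inner: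
  assumes Q: "Q \<in> carrier_mat n k" "Q\<^sup>T * Q = 1\<^sub>m k" and A: "A \<in> carrier_mat k m"
    and B: "B \<in> carrier_mat k m"
  shows "frob_inner (Q * A) (Q * B) = frob_inner A B"
proof -
  have "frob_inner (Q * A) (Q * B) = frob_inner A (Q\<^sup>T * (Q * B))"
    using assms by (intro frob_inner_mult_left) auto
  also have "Q\<^sup>T * (Q * B) = Q\<^sup>T * Q * B" using assms by (intro assoc_mult_mat[symmetric]) auto
  finally show ?thesis using Q B by simp
qed

lemma orthogonal_frob_inner_right:
  assumes Q: "Q \<in> carrier_mat n k" "Q\<^sup>T * Q = 1\<^sub>m k" and A: "A \<in> carrier_mat m k"
    and B: "B \<in> carrier_mat m k"
  shows "frob_inner (A * Q\<^sup>T) (B * Q\<^sup>T) = frob_inner A B"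
proof -
  have "frob_inner (A * Q\<^sup>T) (B * Q\<^sup>T) = frob_inner (A * Q\<^sup>T)\<^sup>T (B * Q\<^sup>T)\<^sup>T"
    using assms by (intro frob_inner_transpose[symmetric]) auto
  also have "\<dots> = frob_inner (Q * A\<^sup>T) (Q * B\<^sup>T)"
    using Q(1) A B by (simp add: transpose_mult[of _ m k _ n])
  also have "\<dots> = frob_inner A\<^sup>T B\<^sup>T" using assms by (intro orthogonal_frob_inner) auto
  also have "\<dots> = frob_inner A B" using A B by (rule frob_inner_transpose)
  finally show ?thesis .
qed

lemma frob_inner_diag_fun:
  assumes B: "B \<in> carrier_mat n k"
  shows "frob_inner B (diag_fun n d * B) = (\<Sum>i<n. d i * (\<Sum>j<k. (B $$ (i, j))\<^sup>2))"
proof -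
  have "(diag_fun n d * B) $$ (i, j) = d i * B $$ (i, j)" if "i < n" "j < k" for i j
  proof -
    have "(diag_fun n d * B) $$ (i, j) = (\<Sum>l<n. diag_fun n d $$ (i, l) * B $$ (l, j))"
      using that B by (intro mult_mat_index_sum) auto
    also have "\<dots> = (\<Sum>l<n. if l = i then d i * B $$ (i, j) else 0)"
      using that by (intro sum.cong) auto
    finally show ?thesis using that by (simp only: sum.delta finite_lessThan) simp
  qed
  then show ?thesis unfolding frob_inner_def using B
    by (simp add: sum_distrib_left power2_eq_square mult_ac del: index_mult_mat(1))
qed

text \<open>
  For invertible \<open>K\<close> the orthogonal factor of the polar decomposition is
  \<open>P = (K\<^sup>T K)\<^sup>-\<^sup>1\<^sup>/\<^sup>2 K\<^sup>T\<close>.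
\<close>
lemma polar_alignment:
  assumes K: "(K :: real mat) \<in> carrier_mat r r"
    and inj: "\<And>B. B \<in> carrier_mat r 1 \<Longrightarrow> 0 < frob_inner B B \<Longrightarrow> 0 < frob_inner (K * B) (K * B)"
  shows "\<exists>P \<in> carrier_mat r r. P * P\<^sup>T = 1\<^sub>m r \<and> (K * P)\<^sup>T = K * P \<and>
    (\<forall>k. \<forall>B \<in> carrier_mat r k. 0 \<le> frob_inner B (K * P * B))"
proof -
  have KK: "K\<^sup>T * K \<in> carrier_mat r r" "(K\<^sup>T * K)\<^sup>T = K\<^sup>T * K"
    using K by (auto simp: transpose_mult[of _ r r _ r])
  from real_symmetric_spectral[OF this] obtain Q d where Q: "Q \<in> carrier_mat r r"
    "Q\<^sup>T * Q = 1\<^sub>m r" and KKQ: "K\<^sup>T * K = Q * diag_fun r d * Q\<^sup>T" by blast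
  note assoc = assoc_mult_mat[of _ r r _ r _ r]
  have QQ: "Q * Q\<^sup>T = 1\<^sub>m r" using orthogonal_mat_commute Q by blast
  \<comment> \<open>The eigenvalue \<open>d i\<close> is |K Q e|^2 for the i-th coordinate vector e,
    and \<open>inj\<close> applies to Q e.\<close>
  have d: "0 < d i" if i: "i < r" for i
  proof -
    define e :: "real mat" where "e = mat r 1 (\<lambda>(k, _). if k = i then 1 else 0)"
    have e: "e \<in> carrier_mat r 1" by (simp add: e_def)
    have "frob_inner e e = (\<Sum>l<r. if l = i then 1 else 0)"
      unfolding frob_inner_def using e by (intro sum.cong) (auto simp: e_def)
    then have e1: "frob_inner e e = 1" using i by simp
    have Qe: "Q * e \<in> carrier_mat r 1" using Q e by auto
    have "0 < frob_inner (K * (Q * e)) (K * (Q * e))"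
      using inj[OF Qe] orthogonal_frob_inner[OF Q e e] e1 by simp
    also have "\<dots> = frob_inner (Q * e) (K\<^sup>T * (K * (Q * e)))"
      using K Qe by (intro frob_inner_mult_left) auto
    also have "\<dots> = frob_inner (Q * e) (K\<^sup>T * K * (Q * e))"
      using K Qe by (subst assoc_mult_mat[of _ r r _ r _ 1]) auto
    also have "K\<^sup>T * K * (Q * e) = Q * (diag_fun r d * e)"
    proof -
      have g: "Q * D * Q\<^sup>T * (Q * e) = Q * (D * ((Q\<^sup>T * Q) * e))" if "D \<in> carrier_mat r r" for D
        using that Q(1) e by (simp add: assoc assoc_mult_mat[of _ r r _ r _ 1])
      show ?thesis unfolding KKQ using g[of "diag_fun r d"] Q e by simp
    qed
    also have "frob_inner (Q * e) (Q * (diag_fun r d * e)) = frob_inner e (diag_fun r d * e)"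
      using Q e by (intro orthogonal_frob_inner) auto
    also have "\<dots> = (\<Sum>l<r. if l = i then d i else 0)"
      unfolding frob_inner_diag_fun[OF e] by (intro sum.cong) (auto simp: e_def)
    also have "\<dots> = d i" using i by simp
    finally show ?thesis .
  qed
  \<comment> \<open>The inverse square root is split into two factors with exponent -1/4. With F = K
    Q E this exhibits K P as F F^T, which is visibly symmetric and positive semidefinite, while E *
    E serves for the orthogonality of P.\<close>
  define E where "E = diag_fun r (\<lambda>i. d i powr (- (1/4)))"
  have E: "E \<in> carrier_mat r r" "E\<^sup>T = E" by (auto simp: E_def)
  have EDE: "E * E * diag_fun r d * (E * E) = 1\<^sub>m r"
    unfolding E_def
  proof (simp, intro eq_matI)
    have pw: "d i powr - (1/4) * d i powr - (1/4) * d i * (d i powr - (1/4) * d i powr - (1/4)) = 1"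
      if "i < r" for i
      using d[OF that] by (simp add: powr_add[symmetric] powr_mult_base mult.commute)
    fix i j assume "i < dim_row (1\<^sub>m r :: real mat)" "j < dim_col (1\<^sub>m r :: real mat)"
    then have ij: "i < r" "j < r" by auto
    with pw[of j] show "diag_fun r (\<lambda>i. d i powr - (1/4) * d i powr - (1/4) * d i *
      (d i powr - (1/4) * d i powr - (1/4))) $$ (i, j) = 1\<^sub>m r $$ (i, j)" by simp
  qed auto
  define F where "F = K * (Q * E)"
  have F: "F \<in> carrier_mat r r" using K Q E by (auto simp: F_def)
  define P where "P = Q * E * (E * Q\<^sup>T * K\<^sup>T)"
  have P: "P \<in> carrier_mat r r" using K Q E by (auto simp: P_def)
  have FT: "F\<^sup>T = E * Q\<^sup>T * K\<^sup>T"
    unfolding F_def using K Q E by (simp add: transpose_mult[of _ r r _ r] assoc)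
  have KP: "K * P = F * F\<^sup>T"
    unfolding FT unfolding P_def F_def using K Q E by (simp add: assoc)
  have PT: "P\<^sup>T = K * Q * (E * E) * Q\<^sup>T"
    unfolding P_def using K Q E by (simp add: transpose_mult[of _ r r _ r] assoc)
  have P2: "P = Q * (E * E) * Q\<^sup>T * K\<^sup>T"
    unfolding P_def using K Q E by (simp add: assoc)
  have "P * P\<^sup>T = Q * (E * E) * Q\<^sup>T * (K\<^sup>T * K) * Q * (E * E) * Q\<^sup>T"
    unfolding PT unfolding P2 using K Q E by (simp add: assoc)
  also have "\<dots> = Q * (E * E * (Q\<^sup>T * Q) * diag_fun r d * (Q\<^sup>T * Q) * (E * E)) * Q\<^sup>T"
  proof -
    have "Q * (E * E) * Q\<^sup>T * (Q * D * Q\<^sup>T) * Q * (E * E) * Q\<^sup>T =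
      Q * (E * E * (Q\<^sup>T * Q) * D * (Q\<^sup>T * Q) * (E * E)) * Q\<^sup>T" if "D \<in> carrier_mat r r" for D
      using that Q(1) E(1) by (simp add: assoc)
    then show ?thesis unfolding KKQ by simp
  qed
  also have "\<dots> = 1\<^sub>m r" unfolding Q(2) using E Q EDE QQ by simp
  finally have "P * P\<^sup>T = 1\<^sub>m r" .
  moreover have "(K * P)\<^sup>T = K * P" unfolding KP using F by (simp add: transpose_mult[of _ r r _ r])
  moreover have "0 \<le> frob_inner B (K * P * B)" if B: "B \<in> carrier_mat r k" for k B
  proof -
    have "frob_inner (F\<^sup>T * B) (F\<^sup>T * B) = frob_inner B ((F\<^sup>T)\<^sup>T * (F\<^sup>T * B))"
      using F B by (intro frob_inner_mult_left) auto
    also have "(F\<^sup>T)\<^sup>T * (F\<^sup>T * B) = K * P * B"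
      unfolding KP using F B by (simp add: assoc_mult_mat[of _ r r _ r _ k])
    finally show ?thesis using frob_inner_self_nonneg[of "F\<^sup>T * B"] by simp
  qed
  ultimately show ?thesis using P by blast
qed

text \<open>Supplies the invertibility that the polar factor needs. If W^T Z B vanished, V = Z B
  would be orthogonal to the columns of W, so Z Z^T - W W^T tested against V V^T would give |Z^T
  V|^2 >= c |V|^2. By Cauchy-Schwarz \<open>gram_gap\<close> would then be at least c^2.\<close>

lemma cross_gram_injective:
  assumes W: "W \<in> carrier_mat n r" and Z: "Z \<in> carrier_mat n r"
    and c: "0 < c"
    and lb: "\<And>k B. B \<in> carrier_mat r k \<Longrightarrow> c * frob_inner B B \<le> frob_inner (Z * B) (Z * B)"
    and gap: "gram_gap W Z < c\<^sup>2"
    and B: "B \<in> carrier_mat r 1" "0 < frob_inner B B"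
  shows "0 < frob_inner (W\<^sup>T * Z * B) (W\<^sup>T * Z * B)"
proof (rule ccontr)
  assume "\<not> ?thesis"
  then have zero: "frob_inner (W\<^sup>T * Z * B) (W\<^sup>T * Z * B) = 0"
    using frob_inner_self_nonneg[of "W\<^sup>T * Z * B"] by linarith
  define V where "V = Z * B"
  have V: "V \<in> carrier_mat n 1" using Z B by (auto simp: V_def)
  have WV: "W\<^sup>T * V = W\<^sup>T * Z * B" unfolding V_def using W Z B
    by (intro assoc_mult_mat[symmetric]) auto
  let ?v = "frob_norm V" and ?b = "frob_norm B" and ?z = "frob_norm (Z\<^sup>T * V)"
  have b: "0 < ?b" using B(2) by (simp add: frob_norm_eq_sqrt)
  have cb: "c * ?b\<^sup>2 \<le> ?v\<^sup>2" unfolding frob_norm_square V_def by (rule lb[OF B(1)])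
  moreover have "0 < c * ?b\<^sup>2" using c b by simp
  ultimately have "?v \<noteq> 0" by (metis leD zero_power2)
  then have v: "0 < ?v" using frob_norm_nonneg[of V] by linarith
  have "?v\<^sup>2 = frob_inner B (Z\<^sup>T * V)"
    unfolding frob_norm_square unfolding V_def using Z B by (intro frob_inner_mult_left) auto
  also have "\<dots> \<le> ?b * ?z" using B Z V by (intro frob_inner_Cauchy_Schwarz) auto
  finally have vb: "?v\<^sup>2 \<le> ?b * ?z" .
  have "c * (?b\<^sup>2 * ?v\<^sup>2) \<le> ?v\<^sup>2 * ?v\<^sup>2"
    using mult_right_mono[OF cb, of "?v\<^sup>2"] by (simp add: mult_ac)
  also have "\<dots> \<le> (?b * ?z) * (?b * ?z)" using vb by (intro mult_mono) auto
  finally have "?b\<^sup>2 * (c * ?v\<^sup>2) \<le> ?b\<^sup>2 * ?z\<^sup>2" by (simp add: power2_eq_square mult_ac)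
  \<comment> \<open>From c |B|^2 |V|^2 <= |V|^4 <= |B|^2 |Z^T V|^2, cancelling |B|^2.\<close>
  then have zv: "c * ?v\<^sup>2 \<le> ?z\<^sup>2" using b by (simp add: mult_le_cancel_left)
  have outer: "frob_inner (U * U\<^sup>T) (V * V\<^sup>T) = frob_inner (U\<^sup>T * V) (U\<^sup>T * V)"
    if "U \<in> carrier_mat n k" for U k
    using frob_inner_outer[OF that that V V] by simp
  have "?z\<^sup>2 = frob_inner (Z * Z\<^sup>T) (V * V\<^sup>T) - frob_inner (W * W\<^sup>T) (V * V\<^sup>T)"
    unfolding outer[OF Z] outer[OF W] WV zero frob_norm_square by simp
  also have "\<dots> = frob_inner (Z * Z\<^sup>T - W * W\<^sup>T) (V * V\<^sup>T)"
    using W Z V by (intro frob_inner_diff_left[symmetric, of _ n n]) (auto intro: mult_carrier_mat)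
  also have "\<dots> \<le> frob_norm (Z * Z\<^sup>T - W * W\<^sup>T) * frob_norm (V * V\<^sup>T)"
    using W Z V by (intro frob_inner_Cauchy_Schwarz[of _ n n]) (auto intro: minus_carrier_mat mult_carrier_mat)
  also have "frob_norm (V * V\<^sup>T) = ?v\<^sup>2"
  proof -
    have "frob_inner (V * V\<^sup>T) (V * V\<^sup>T) = frob_inner (V\<^sup>T * V) (V\<^sup>T * V)" by (rule outer[OF V])
    also have "\<dots> = (frob_inner V V)\<^sup>2"
      using V unfolding frob_inner_def
      by (simp add: scalar_prod_def atLeast0LessThan power2_eq_square)
    finally show ?thesis unfolding frob_norm_square by (simp add: frob_norm_eq_sqrt[of "V * V\<^sup>T"])
  qed
  finally have "c * ?v\<^sup>2 \<le> frob_norm (Z * Z\<^sup>T - W * W\<^sup>T) * ?v\<^sup>2" using zv by simp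
  then have "c \<le> frob_norm (Z * Z\<^sup>T - W * W\<^sup>T)" using v by simp
  then have "c\<^sup>2 \<le> gram_gap W Z" unfolding gram_gap_eq[OF W Z] using c by (intro power_mono) auto
  with gap show False by simp
qed

lemma mat_dist_le:
  assumes "Z \<in> carrier_mat n r" "P \<in> carrier_mat r r" "P * P\<^sup>T = 1\<^sub>m r"
  shows "mat_dist W Z \<le> frob_norm (W - Z * P)"
  unfolding mat_dist_def Let_def using assms
  by (intro cINF_lower bdd_belowI2[of _ 0]) auto

text \<open>A small gap makes W^T Z invertible, and after rotating Z by its polar factor W^T Z P is
  symmetric and positive semidefinite, as \<open>aligned_factor_bound\<close> requires. The rotation
  changes neither Z Z^T, hence not the gap, nor the lower bound \<open>c\<close>.\<close>

lemma mat_dist_gram_gap: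
  assumes W: "W \<in> carrier_mat n r" and Z: "Z \<in> carrier_mat n r"
    and c: "0 < c"
    and lb: "\<And>k B. B \<in> carrier_mat r k \<Longrightarrow> c * frob_inner B B \<le> frob_inner (Z * B) (Z * B)"
    and gap: "gram_gap W Z < c\<^sup>2"
  shows "mat_dist W Z \<le> sqrt (2 * gram_gap W Z / c)"
proof -
  have WZ: "W\<^sup>T * Z \<in> carrier_mat r r" using W Z by auto
  have inj: "0 < frob_inner (W\<^sup>T * Z * B) (W\<^sup>T * Z * B)"
    if "B \<in> carrier_mat r 1" "0 < frob_inner B B" for B
    by (rule cross_gram_injective[OF W Z c lb gap that])
  obtain P where P: "P \<in> carrier_mat r r" "P * P\<^sup>T = 1\<^sub>m r"
    and sym: "(W\<^sup>T * Z * P)\<^sup>T = W\<^sup>T * Z * P"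
    and psd: "\<And>k B. B \<in> carrier_mat r k \<Longrightarrow> 0 \<le> frob_inner B (W\<^sup>T * Z * P * B)"
    using polar_alignment[OF WZ inj] by blast
  have PP: "P\<^sup>T * P = 1\<^sub>m r" using mat_mult_left_right_inverse[OF P(1) _ P(2)] P(1) by auto
  define Z' where "Z' = Z * P"
  have Z': "Z' \<in> carrier_mat n r" using Z P by (auto simp: Z'_def)
  have WZ': "W\<^sup>T * Z' = W\<^sup>T * Z * P" unfolding Z'_def using W Z P
    by (intro assoc_mult_mat[symmetric]) auto
  have "c * (frob_norm (W - Z'))\<^sup>2 \<le> 2 * gram_gap W Z'"
  proof (rule aligned_factor_bound[OF W Z'])
    have "W\<^sup>T * Z' = (W\<^sup>T * Z')\<^sup>T" unfolding WZ' sym ..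
    also have "\<dots> = Z'\<^sup>T * W" using W Z' by (simp add: transpose_mult[of _ r n _ r])
    finally show "W\<^sup>T * Z' = Z'\<^sup>T * W" .
  next
    fix k and B :: "real mat" assume B: "B \<in> carrier_mat r k"
    have "frob_inner (W * B) (Z' * B) = frob_inner B (W\<^sup>T * (Z' * B))"
      using W B Z' by (intro frob_inner_mult_left) auto
    also have "W\<^sup>T * (Z' * B) = W\<^sup>T * Z * P * B"
      unfolding WZ'[symmetric] using W B Z' by (intro assoc_mult_mat[symmetric]) auto
    finally show "0 \<le> frob_inner (W * B) (Z' * B)" using psd[OF B] by simp
  next
    fix k and B :: "real mat" assume B: "B \<in> carrier_mat r k"
    have "c * frob_inner B B = c * frob_inner (P * B) (P * B)"
      using orthogonal_frob_inner[OF P(1) PP B B] by simp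
    also have "\<dots> \<le> frob_inner (Z * (P * B)) (Z * (P * B))" using P B by (intro lb) auto
    also have "Z * (P * B) = Z' * B" unfolding Z'_def using Z P B
      by (intro assoc_mult_mat[symmetric]) auto
    finally show "c * frob_inner B B \<le> frob_inner (Z' * B) (Z' * B)" .
  qed
  also have "gram_gap W Z' = gram_gap W Z"
  proof -
    have ZZ: "Z' * Z'\<^sup>T = Z * (P * P\<^sup>T) * Z\<^sup>T"
      unfolding Z'_def using Z P(1)
      by (simp add: transpose_mult[of _ n r _ r] assoc_mult_mat[of _ n r _ r _ n]
          assoc_mult_mat[of _ r r _ r _ n] assoc_mult_mat[of _ n r _ r _ r])
    then show ?thesis unfolding gram_gap_eq[OF W Z] gram_gap_eq[OF W Z'] ZZ P(2) using Z by simp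
  qed
  finally have "(frob_norm (W - Z'))\<^sup>2 \<le> 2 * gram_gap W Z / c" using c by (simp add: field_simps)
  then have "frob_norm (W - Z') \<le> sqrt (2 * gram_gap W Z / c)" by (rule real_le_rsqrt)
  with mat_dist_le[OF Z P, of W] show ?thesis unfolding Z'_def by simp
qed

section \<open>Exponential moments\<close>

text \<open>With y = -x the claim is 1 <= (1 - y + y^2) exp y, and the quadratic Taylor polynomial
  of exp y is already enough: all terms of the product beyond 1 are nonnegative.\<close>

lemma exp_le_quadratic_neg: "exp (x :: real) \<le> 1 + x + x\<^sup>2" if "x \<le> 0"
proof -
  define y where "y = - x"
  have y: "y \<ge> 0" using that by (simp add: y_def)
  have "1 + y + y\<^sup>2 / 2 \<le> exp y" using exp_lower_Taylor_quadratic[OF y] by simp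
  then have "(1 - y + y\<^sup>2) * (1 + y + y\<^sup>2 / 2) \<le> (1 - y + y\<^sup>2) * exp y"
  proof (rule mult_left_mono)
    have "0 \<le> (y - 1/2)\<^sup>2" by simp
    then have "y \<le> 1/4 + y\<^sup>2" by (simp add: power2_diff power_divide)
    then show "0 \<le> 1 - y + y\<^sup>2" by simp
  qed
  moreover have "(1 - y + y\<^sup>2) * (1 + y + y\<^sup>2 / 2) = 1 + y\<^sup>2 / 2 + y^3 / 2 + y^4 / 2"
    by (simp add: power2_eq_square power3_eq_cube power4_eq_xxxx field_simps)
  moreover have "1 \<le> 1 + y\<^sup>2 / 2 + y^3 / 2 + y^4 / 2" using y by simp
  ultimately have "1 \<le> (1 - y + y\<^sup>2) * exp y" by linarith
  then have "exp (- y) \<le> 1 - y + y\<^sup>2" by (simp add: exp_minus field_simps)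
  then show ?thesis by (simp add: y_def)
qed

text \<open>The linear term has mean zero for a centred variable, so a moment generating function is
  controlled by an exponential moment of the square.\<close>

lemma exp_le_add_exp_square: "exp (x :: real) \<le> x + exp (x\<^sup>2)"
proof -
  have q: "1 + x\<^sup>2 \<le> exp (x\<^sup>2)" by (rule exp_ge_add_one_self)
  consider "x \<le> 0" | "0 \<le> x" "x \<le> 1" | "1 \<le> x" by linarith
  then show ?thesis
  proof cases
    case 1
    then show ?thesis using exp_le_quadratic_neg[of x] q by linarith
  next
    case 2
    then show ?thesis using exp_bound[of x] q by linarith
  next
    case 3
    then have "x \<le> x\<^sup>2" by (simp add: power2_eq_square)
    then have "exp x \<le> exp (x\<^sup>2)" by simp
    with 3 show ?thesis by linarith
  qed
qed

text \<open>Stated with nonnegative integrals: an infinite right-hand side makes the bound trivial,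
  and a finite one provides the integrability needed to integrate
  \<open>exp_le_add_exp_square\<close>.\<close>

lemma (in prob_space) centered_mgf_le:
  assumes X: "integrable M X" and mean: "expectation X = \<mu>"
  shows "(\<integral>\<^sup>+x. ennreal (exp (l * (X x - \<mu>))) \<partial>M) \<le> (\<integral>\<^sup>+x. ennreal (exp (l\<^sup>2 * (X x - \<mu>)\<^sup>2)) \<partial>M)"
proof (cases "(\<integral>\<^sup>+x. ennreal (exp (l\<^sup>2 * (X x - \<mu>)\<^sup>2)) \<partial>M) = \<infinity>")
  case False
  note [measurable] = borel_measurable_integrable[OF X]
  have int: "integrable M (\<lambda>x. exp (l\<^sup>2 * (X x - \<mu>)\<^sup>2))"
    using False by (intro integrableI_nonneg) (auto simp: less_top)
  have lin: "integrable M (\<lambda>x. l * (X x - \<mu>))" using X by simp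
  have le: "exp (l * (X x - \<mu>)) \<le> l * (X x - \<mu>) + exp (l\<^sup>2 * (X x - \<mu>)\<^sup>2)" for x
    using exp_le_add_exp_square[of "l * (X x - \<mu>)"] by (simp add: power_mult_distrib)
  have int': "integrable M (\<lambda>x. exp (l * (X x - \<mu>)))"
  proof (rule Bochner_Integration.integrable_bound)
    show "integrable M (\<lambda>x. l * (X x - \<mu>) + exp (l\<^sup>2 * (X x - \<mu>)\<^sup>2))" using int lin by simp
    show "AE x in M. norm (exp (l * (X x - \<mu>))) \<le> norm (l * (X x - \<mu>) + exp (l\<^sup>2 * (X x - \<mu>)\<^sup>2))"
      using le by (intro AE_I2) (smt (verit) exp_gt_zero real_norm_def)
  qed simp
  have "expectation (\<lambda>x. exp (l * (X x - \<mu>))) \<le>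
      expectation (\<lambda>x. l * (X x - \<mu>) + exp (l\<^sup>2 * (X x - \<mu>)\<^sup>2))"
    using int' int lin le by (intro integral_mono) auto
  also have "\<dots> = expectation (\<lambda>x. exp (l\<^sup>2 * (X x - \<mu>)\<^sup>2))"
    using int lin X mean by (simp add: prob_space)
  finally show ?thesis using int int'
    by (simp add: nn_integral_eq_integral)
qed simp

text \<open>Multiplying the density by exp (a h^2) gives t / s times the normal density of variance
  t^2 = s^2 / (1 - 2 a s^2), so the integral is exactly (1 - x) to the power -1/2 with x = 2 a s^2.
  For x <= 1/2 this is at most exp x.\<close>

lemma gaussian_exp_square:
  assumes s: "0 < s" and a: "4 * a * s\<^sup>2 \<le> 1" "0 \<le> a"
  shows "(\<integral>\<^sup>+h. ennreal (normal_density 0 s h) * ennreal (exp (a * h\<^sup>2)) \<partial>lborel) \<le> ennreal (exp (2 * a * s\<^sup>2))"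
proof -
  define x where "x = 2 * a * s\<^sup>2"
  have x: "0 \<le> x" "x \<le> 1/2" using a s by (auto simp: x_def)
  define t where "t = s / sqrt (1 - x)"
  have t: "0 < t" using s x by (simp add: t_def)
  have t2: "t\<^sup>2 = s\<^sup>2 / (1 - x)" using x by (simp add: t_def power_divide)
  have eq: "normal_density 0 s h * exp (a * h\<^sup>2) = t / s * normal_density 0 t h" for h
  proof -
    have "- h\<^sup>2 / (2 * s\<^sup>2) + a * h\<^sup>2 = - h\<^sup>2 / (2 * t\<^sup>2)"
      unfolding t2 x_def using s by (simp add: field_simps)
    then have e: "exp (- h\<^sup>2 / (2 * s\<^sup>2)) * exp (a * h\<^sup>2) = exp (- h\<^sup>2 / (2 * t\<^sup>2))"
      by (simp add: exp_add[symmetric])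
    show ?thesis using s t e unfolding normal_density_def
      by (simp add: real_sqrt_mult field_simps)
  qed
  have "(\<integral>\<^sup>+h. ennreal (normal_density 0 s h) * ennreal (exp (a * h\<^sup>2)) \<partial>lborel) =
      (\<integral>\<^sup>+h. ennreal (t / s) * ennreal (normal_density 0 t h) \<partial>lborel)"
    using s t by (intro nn_integral_cong) (simp add: ennreal_mult[symmetric] eq)
  also have "\<dots> = ennreal (t / s) * (\<integral>\<^sup>+h. ennreal (normal_density 0 t h) \<partial>lborel)"
    by (intro nn_integral_cmult) simp
  also have "(\<integral>\<^sup>+h. ennreal (normal_density 0 t h) \<partial>lborel) = 1"
    using t by (simp add: nn_integral_eq_integral)
  also have "ennreal (t / s) * 1 \<le> ennreal (exp x)"
  proof -
    have "2 * x ^ 3 \<le> x"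
    proof -
      have "x\<^sup>2 \<le> (1/2)\<^sup>2" using x by (intro power_mono) auto
      then have "x * (2 * x\<^sup>2) \<le> x * 1" using x by (intro mult_left_mono) (auto simp: power2_eq_square)
      then show ?thesis by (simp add: power2_eq_square power3_eq_cube mult_ac)
    qed
    then have "1 \<le> (1 - x) * (1 + 2 * x + (2 * x)\<^sup>2 / 2)"
      by (simp add: power2_eq_square power3_eq_cube field_simps)
    also have "\<dots> \<le> (1 - x) * exp (2 * x)"
      using x exp_lower_Taylor_quadratic[of "2 * x"] by (intro mult_left_mono) auto
    finally have "1 / (1 - x) \<le> exp (2 * x)" using x by (simp add: field_simps)
    then have "(t / s)\<^sup>2 \<le> (exp x)\<^sup>2"
      using s t2 by (simp add: power_divide exp_double[symmetric])
    then have "t / s \<le> exp x" using power2_le_imp_le[of "t / s" "exp x"] by simp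
    then show ?thesis by (simp add: ennreal_leI)
  qed
  finally show ?thesis by (simp add: x_def)
qed

text \<open>The inequality 2 s |h| <= s^2 + h^2 reduces everything to the second moment of
  \<open>h\<close> and yields E |h| <= s.\<close>

lemma (in prob_space) dominated_gaussian_integrable:
  assumes h: "distributed M lborel h (normal_density 0 s)" and s: "0 < s"
    and X[measurable]: "X \<in> borel_measurable M" and dom: "\<And>x. x \<in> space M \<Longrightarrow> \<bar>X x\<bar> \<le> \<tau> * \<bar>h x\<bar>"
    and \<tau>: "0 \<le> \<tau>"
  shows "integrable M X" "\<bar>expectation X\<bar> \<le> \<tau> * s"
proof -
  have h_meas[measurable]: "h \<in> borel_measurable M" using distributed_measurable[OF h] by simp
  have ih2: "integrable M (\<lambda>x. (h x)\<^sup>2)"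
    using distributed_integrable[OF h, of "\<lambda>x. x\<^sup>2"] integrable_normal_moment[OF s, of 0 2]
    by (simp add: normal_density_nonneg)
  have Eh2: "expectation (\<lambda>x. (h x)\<^sup>2) = s\<^sup>2"
    using distributed_integral[OF h, of "\<lambda>x. x\<^sup>2"] integral_normal_moment_even[OF s, of 0 1]
    by (simp add: normal_density_nonneg)
  have le: "\<tau> * \<bar>h x\<bar> \<le> \<tau> * ((s\<^sup>2 + (h x)\<^sup>2) / (2 * s))" for x
  proof (rule mult_left_mono[OF _ \<tau>])
    have "0 \<le> (s - \<bar>h x\<bar>)\<^sup>2" by simp
    then show "\<bar>h x\<bar> \<le> (s\<^sup>2 + (h x)\<^sup>2) / (2 * s)"
      using s by (simp add: power2_diff field_simps power2_eq_square[symmetric])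
  qed
  have i: "integrable M (\<lambda>x. \<tau> * ((s\<^sup>2 + (h x)\<^sup>2) / (2 * s)))" using ih2 by simp
  show iX: "integrable M X"
  proof (rule Bochner_Integration.integrable_bound[OF i])
    show "AE x in M. norm (X x) \<le> norm (\<tau> * ((s\<^sup>2 + (h x)\<^sup>2) / (2 * s)))"
      using dom le by (intro AE_I2) (smt (verit) real_norm_def)
  qed simp
  have "\<bar>expectation X\<bar> \<le> expectation (\<lambda>x. \<bar>X x\<bar>)" by (rule integral_abs_bound)
  also have "\<dots> \<le> expectation (\<lambda>x. \<tau> * ((s\<^sup>2 + (h x)\<^sup>2) / (2 * s)))"
    using iX i dom le by (intro integral_mono) (auto intro: order_trans)
  also have "\<dots> = \<tau> * s" using ih2 s by (simp add: Eh2 prob_space) (simp add: power2_eq_square)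
  finally show "\<bar>expectation X\<bar> \<le> \<tau> * s" .
qed

text \<open>Made for products of a truncated variable with a Gaussian \<open>h\<close> that may be
  correlated with it: domination by |h| gives (X - E X)^2 <= 2 \<tau>^2 s^2 + 2 \<tau>^2 h^2,
  whatever the dependence, and \<open>gaussian_exp_square\<close> does the rest.\<close>

lemma (in prob_space) dominated_gaussian_mgf:
  assumes h: "distributed M lborel h (normal_density 0 s)" and s: "0 < s"
    and X[measurable]: "X \<in> borel_measurable M" and dom: "\<And>x. x \<in> space M \<Longrightarrow> \<bar>X x\<bar> \<le> \<tau> * \<bar>h x\<bar>"
    and \<tau>: "0 \<le> \<tau>" and l: "8 * l\<^sup>2 * \<tau>\<^sup>2 * s\<^sup>2 \<le> 1"
  shows "(\<integral>\<^sup>+x. ennreal (exp (l * (X x - expectation X))) \<partial>M) \<le> ennreal (exp (6 * l\<^sup>2 * \<tau>\<^sup>2 * s\<^sup>2))"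
proof -
  let ?\<mu> = "expectation X"
  have h_meas[measurable]: "h \<in> borel_measurable M" using distributed_measurable[OF h] by simp
  note dg = dominated_gaussian_integrable[OF h s X dom \<tau>]
  define a where "a = 2 * l\<^sup>2 * \<tau>\<^sup>2"
  have mu2: "?\<mu>\<^sup>2 \<le> \<tau>\<^sup>2 * s\<^sup>2"
    using power_mono[OF dg(2), of 2] by (simp add: power_mult_distrib)
  have "(\<integral>\<^sup>+x. ennreal (exp (l * (X x - ?\<mu>))) \<partial>M) \<le> (\<integral>\<^sup>+x. ennreal (exp (l\<^sup>2 * (X x - ?\<mu>)\<^sup>2)) \<partial>M)"
    by (rule centered_mgf_le[OF dg(1) refl])
  also have "\<dots> \<le> (\<integral>\<^sup>+x. ennreal (exp (2 * l\<^sup>2 * \<tau>\<^sup>2 * s\<^sup>2)) * ennreal (exp (a * (h x)\<^sup>2)) \<partial>M)"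
  proof (intro nn_integral_mono)
    fix x assume x: "x \<in> space M"
    have "(X x)\<^sup>2 \<le> \<tau>\<^sup>2 * (h x)\<^sup>2"
      using power_mono[OF dom[OF x], of 2] by (simp add: power_mult_distrib)
    moreover have "(X x - ?\<mu>)\<^sup>2 \<le> 2 * (X x)\<^sup>2 + 2 * ?\<mu>\<^sup>2"
      using sum_squares_ge_zero[of "X x + ?\<mu>" 0] by (simp add: power2_eq_square algebra_simps)
    ultimately have "(X x - ?\<mu>)\<^sup>2 \<le> 2 * \<tau>\<^sup>2 * s\<^sup>2 + 2 * \<tau>\<^sup>2 * (h x)\<^sup>2" using mu2 by linarith
    then have "l\<^sup>2 * (X x - ?\<mu>)\<^sup>2 \<le> l\<^sup>2 * (2 * \<tau>\<^sup>2 * s\<^sup>2 + 2 * \<tau>\<^sup>2 * (h x)\<^sup>2)"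
      by (intro mult_left_mono) auto
    then have "exp (l\<^sup>2 * (X x - ?\<mu>)\<^sup>2) \<le> exp (2 * l\<^sup>2 * \<tau>\<^sup>2 * s\<^sup>2 + a * (h x)\<^sup>2)"
      by (simp add: a_def algebra_simps)
    then show "ennreal (exp (l\<^sup>2 * (X x - ?\<mu>)\<^sup>2)) \<le> ennreal (exp (2 * l\<^sup>2 * \<tau>\<^sup>2 * s\<^sup>2)) * ennreal (exp (a * (h x)\<^sup>2))"
      by (simp add: exp_add ennreal_mult[symmetric] ennreal_leI)
  qed
  also have "\<dots> = ennreal (exp (2 * l\<^sup>2 * \<tau>\<^sup>2 * s\<^sup>2)) * (\<integral>\<^sup>+x. ennreal (exp (a * (h x)\<^sup>2)) \<partial>M)"
    by (intro nn_integral_cmult) simp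
  also have "(\<integral>\<^sup>+x. ennreal (exp (a * (h x)\<^sup>2)) \<partial>M) =
      (\<integral>\<^sup>+y. ennreal (normal_density 0 s y) * ennreal (exp (a * y\<^sup>2)) \<partial>lborel)"
    by (rule distributed_nn_integral[OF h, symmetric]) simp
  also have "ennreal (exp (2 * l\<^sup>2 * \<tau>\<^sup>2 * s\<^sup>2)) * \<dots> \<le>
      ennreal (exp (2 * l\<^sup>2 * \<tau>\<^sup>2 * s\<^sup>2)) * ennreal (exp (2 * a * s\<^sup>2))"
    using l by (intro mult_left_mono gaussian_exp_square s) (auto simp: a_def mult_ac)
  also have "\<dots> = ennreal (exp (6 * l\<^sup>2 * \<tau>\<^sup>2 * s\<^sup>2))"
    by (simp add: ennreal_mult[symmetric] exp_add[symmetric] a_def algebra_simps)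
  finally show ?thesis .
qed

text \<open>The centred variable has square at most 1. The exponent l^2 is weaker than Hoeffding's
  l^2 / 8, but it falls out of the same centring inequality.\<close>

lemma (in prob_space) bounded_mgf:
  assumes X[measurable]: "X \<in> borel_measurable M" and bound: "\<And>x. x \<in> space M \<Longrightarrow> X x \<in> {0..1}"
  shows "(\<integral>\<^sup>+x. ennreal (exp (l * (X x - expectation X))) \<partial>M) \<le> ennreal (exp (l\<^sup>2))"
proof -
  let ?\<mu> = "expectation X"
  have i: "integrable M X" using bound by (intro integrable_const_bound[of _ 1]) auto
  have "0 \<le> ?\<mu>" using bound by (intro integral_nonneg_AE) auto
  moreover have "?\<mu> \<le> 1" using bound by (intro integral_le_const i) auto
  ultimately have sq: "(X x - ?\<mu>)\<^sup>2 \<le> 1" if "x \<in> space M" for x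
    using bound[OF that] by (simp add: abs_square_le_1 abs_le_iff)
  have "(\<integral>\<^sup>+x. ennreal (exp (l * (X x - ?\<mu>))) \<partial>M) \<le> (\<integral>\<^sup>+x. ennreal (exp (l\<^sup>2 * (X x - ?\<mu>)\<^sup>2)) \<partial>M)"
    by (rule centered_mgf_le[OF i refl])
  also have "\<dots> \<le> (\<integral>\<^sup>+x. ennreal (exp (l\<^sup>2)) \<partial>M)"
    using sq by (intro nn_integral_mono ennreal_leI) (simp add: mult_left_le)
  finally show ?thesis by (simp add: emeasure_space_1)
qed

text \<open>The functions may vary with the index, because at an outlier the observation is a
  constant and elsewhere it is a linear form.\<close>

lemma (in product_sigma_finite) chernoff_PiM:
  assumes I: "finite I" and f[measurable]: "\<And>i. i \<in> I \<Longrightarrow> f i \<in> borel_measurable (M i)"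
    and l: "0 < l" and mgf: "\<And>i. i \<in> I \<Longrightarrow> (\<integral>\<^sup>+x. ennreal (exp (l * f i x)) \<partial>M i) \<le> ennreal (exp b)"
  shows "emeasure (Pi\<^sub>M I M) {x \<in> space (Pi\<^sub>M I M). t \<le> (\<Sum>i\<in>I. f i (x i))}
    \<le> ennreal (exp (real (card I) * b - l * t))"
proof -
  let ?P = "Pi\<^sub>M I M"
  have [measurable]: "(\<lambda>x. \<Sum>i\<in>I. f i (x i)) \<in> borel_measurable ?P"
    by (intro borel_measurable_sum) measurable
  have "emeasure ?P {x \<in> space ?P. t \<le> (\<Sum>i\<in>I. f i (x i))}
    \<le> ennreal (exp (- l * t)) * (\<integral>\<^sup>+x\<in>space ?P. ennreal (exp (l * (\<Sum>i\<in>I. f i (x i)))) \<partial>?P)"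
    by (intro Chernoff_ineq_nn_integral_ge l) auto
  also have "(\<integral>\<^sup>+x\<in>space ?P. ennreal (exp (l * (\<Sum>i\<in>I. f i (x i)))) \<partial>?P) =
      (\<integral>\<^sup>+x. (\<Prod>i\<in>I. ennreal (exp (l * f i (x i)))) \<partial>?P)"
    using I by (intro nn_integral_cong) (simp add: sum_distrib_left exp_sum prod_ennreal)
  also have "\<dots> = (\<Prod>i\<in>I. \<integral>\<^sup>+x. ennreal (exp (l * f i x)) \<partial>M i)"
    using I by (intro product_nn_integral_prod) auto
  also have "\<dots> \<le> (\<Prod>i\<in>I. ennreal (exp b))"
    using mgf by (intro prod_mono_ennreal) auto
  also have "\<dots> = ennreal (exp (real (card I) * b))"
    by (simp add: ennreal_power exp_of_nat_mult)
  finally have "emeasure ?P {x \<in> space ?P. t \<le> (\<Sum>i\<in>I. f i (x i))}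
      \<le> ennreal (exp (- l * t)) * ennreal (exp (real (card I) * b))"
    by (meson mult_left_mono order_trans zero_le)
  then show ?thesis by (simp add: ennreal_mult[symmetric] exp_add[symmetric])
qed

section \<open>Stacked matrices and pairs of balanced factors\<close>

lemma sum_lessThan_add:
  "(\<Sum>l<a + b. f l) = (\<Sum>l<a. f l) + (\<Sum>l<(b::nat). (f (a + l) :: 'a :: comm_monoid_add))"
  by (induction b) (simp_all add: add.assoc)

lemma append_rows_gram:
  assumes U: "(U :: real mat) \<in> carrier_mat n1 r" and V: "V \<in> carrier_mat n2 r"
    and X: "X \<in> carrier_mat n1 k" and Y: "Y \<in> carrier_mat n2 k"
  shows "(U @\<^sub>r V)\<^sup>T * (X @\<^sub>r Y) = U\<^sup>T * X + V\<^sup>T * Y"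
proof (rule eq_matI)
  fix i j assume "i < dim_row (U\<^sup>T * X + V\<^sup>T * Y)" "j < dim_col (U\<^sup>T * X + V\<^sup>T * Y)"
  then have ij: "i < r" "j < k" using V Y by auto
  have UV: "U @\<^sub>r V \<in> carrier_mat (n1 + n2) r" and XY: "X @\<^sub>r Y \<in> carrier_mat (n1 + n2) k"
    using assms by auto
  note dimUV = carrier_matD[OF UV] and dimXY = carrier_matD[OF XY]
  have idx: "(A @\<^sub>r B) $$ (l, c) = (if l < n1 then A $$ (l, c) else B $$ (l - n1, c))"
    if "A \<in> carrier_mat n1 q" "B \<in> carrier_mat n2 q" "l < n1 + n2" "c < q"
    for A B :: "real mat" and q l c
    using that unfolding append_rows_def by auto
  have "((U @\<^sub>r V)\<^sup>T * (X @\<^sub>r Y)) $$ (i, j) = (\<Sum>l<n1 + n2. (U @\<^sub>r V) $$ (l, i) * (X @\<^sub>r Y) $$ (l, j))"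
    using UV XY ij by (subst mult_mat_index_sum[of _ r "n1 + n2" _ k]) auto
  also have "\<dots> = (\<Sum>l<n1. U $$ (l, i) * X $$ (l, j)) + (\<Sum>l<n2. V $$ (l, i) * Y $$ (l, j))"
    unfolding sum_lessThan_add using ij
    by (simp add: idx[OF U V] idx[OF X Y])
  also have "\<dots> = (U\<^sup>T * X + V\<^sup>T * Y) $$ (i, j)"
  proof -
    have "(U\<^sup>T * X) $$ (i, j) = (\<Sum>l<n1. U $$ (l, i) * X $$ (l, j))"
      using U X ij by (subst mult_mat_index_sum[of _ r n1 _ k]) auto
    moreover have "(V\<^sup>T * Y) $$ (i, j) = (\<Sum>l<n2. V $$ (l, i) * Y $$ (l, j))"
      using V Y ij by (subst mult_mat_index_sum[of _ r n2 _ k]) auto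
    moreover have "(U\<^sup>T * X + V\<^sup>T * Y) $$ (i, j) = (U\<^sup>T * X) $$ (i, j) + (V\<^sup>T * Y) $$ (i, j)"
      using V Y ij by (intro index_add_mat) auto
    ultimately show ?thesis by simp
  qed
  finally show "((U @\<^sub>r V)\<^sup>T * (X @\<^sub>r Y)) $$ (i, j) = (U\<^sup>T * X + V\<^sup>T * Y) $$ (i, j)" .
next
  have UV: "U @\<^sub>r V \<in> carrier_mat (n1 + n2) r" and XY: "X @\<^sub>r Y \<in> carrier_mat (n1 + n2) k"
    using assms by auto
  show "dim_row ((U @\<^sub>r V)\<^sup>T * (X @\<^sub>r Y)) = dim_row (U\<^sup>T * X + V\<^sup>T * Y)"
    "dim_col ((U @\<^sub>r V)\<^sup>T * (X @\<^sub>r Y)) = dim_col (U\<^sup>T * X + V\<^sup>T * Y)"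
    using carrier_matD[OF UV] carrier_matD[OF XY] V Y by simp_all
qed

text \<open>By the two balance conditions both sides are expressions in a = U^T U, b = X^T X, A =
  U^T X and B = V^T Y. Their difference is exactly 2 |A - B|^2.\<close>

lemma balanced_gram_gap:
  assumes U: "U \<in> carrier_mat n1 r" and V: "V \<in> carrier_mat n2 r"
    and X: "X \<in> carrier_mat n1 r" and Y: "Y \<in> carrier_mat n2 r"
    and UV: "U\<^sup>T * U = V\<^sup>T * V" and XY: "X\<^sup>T * X = Y\<^sup>T * Y"
  shows "gram_gap (U @\<^sub>r V) (X @\<^sub>r Y) \<le> 4 * (frob_norm (U * V\<^sup>T - X * Y\<^sup>T))\<^sup>2"
proof -
  define a b A B where "a = U\<^sup>T * U" and "b = X\<^sup>T * X" and "A = U\<^sup>T * X" and "B = V\<^sup>T * Y"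
  have c[simp]: "a \<in> carrier_mat r r" "b \<in> carrier_mat r r" "A \<in> carrier_mat r r" "B \<in> carrier_mat r r"
    using assms by (auto simp: a_def b_def A_def B_def)
  have P: "U * V\<^sup>T \<in> carrier_mat n1 n2" "X * Y\<^sup>T \<in> carrier_mat n1 n2" using assms by auto
  have gap: "gram_gap (U @\<^sub>r V) (X @\<^sub>r Y) =
      4 * frob_inner a a - 2 * frob_inner (A + B) (A + B) + 4 * frob_inner b b"
    unfolding gram_gap_def append_rows_gram[OF U V U V] append_rows_gram[OF U V X Y]
      append_rows_gram[OF X Y X Y] UV[symmetric] XY[symmetric]
    by (simp add: a_def[symmetric] b_def[symmetric] A_def[symmetric] B_def[symmetric]
        frob_inner_add_self[of a r r a] frob_inner_add_self[of b r r b])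
  have nrm: "(frob_norm (U * V\<^sup>T - X * Y\<^sup>T))\<^sup>2 = frob_inner a a - 2 * frob_inner A B + frob_inner b b"
    unfolding frob_norm_square frob_inner_diff_self[OF P]
    unfolding frob_inner_outer[OF U V U V] frob_inner_outer[OF U V X Y] frob_inner_outer[OF X Y X Y]
      UV[symmetric] XY[symmetric]
    by (simp add: a_def[symmetric] b_def[symmetric] A_def[symmetric] B_def[symmetric])
  show ?thesis unfolding gap nrm frob_inner_add_self[OF c(3,4)]
    using frob_inner_self_nonneg[of "A - B"] unfolding frob_inner_diff_self[OF c(3,4)]
    by (simp add: algebra_simps)
qed

section \<open>Truncated singular value decompositions\<close>

text \<open>Says that the spectral norm of \<open>E\<close> is at most \<open>e\<close>. Bilinear
  forms in index functions are what the grid argument delivers. The condition 0 <= e is included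
  because it would not follow when a dimension is 0.\<close>

definition bilin_bound :: "real mat \<Rightarrow> real \<Rightarrow> bool" where
  "bilin_bound E e \<longleftrightarrow> 0 \<le> e \<and> (\<forall>u v.
     \<bar>\<Sum>i<dim_row E. \<Sum>j<dim_col E. u i * E $$ (i, j) * v j\<bar>
       \<le> e * L2_set u {..<dim_row E} * L2_set v {..<dim_col E})"

lemma bilin_bound_transpose:
  assumes "bilin_bound E e"
  shows "bilin_bound E\<^sup>T e"
  unfolding bilin_bound_def
proof (intro conjI allI)
  show "0 \<le> e" using assms by (simp add: bilin_bound_def)
  fix u v :: "nat \<Rightarrow> real"
  have eq: "(\<Sum>i<dim_row E\<^sup>T. \<Sum>j<dim_col E\<^sup>T. u i * E\<^sup>T $$ (i, j) * v j) =
      (\<Sum>j<dim_row E. \<Sum>i<dim_col E. v j * E $$ (j, i) * u i)"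
    by (subst sum.swap) (simp add: mult_ac)
  have "\<bar>\<Sum>j<dim_row E. \<Sum>i<dim_col E. v j * E $$ (j, i) * u i\<bar>
      \<le> e * L2_set v {..<dim_row E} * L2_set u {..<dim_col E}"
    using assms unfolding bilin_bound_def by blast
  then show "\<bar>\<Sum>i<dim_row E\<^sup>T. \<Sum>j<dim_col E\<^sup>T. u i * E\<^sup>T $$ (i, j) * v j\<bar>
      \<le> e * L2_set u {..<dim_row E\<^sup>T} * L2_set v {..<dim_col E\<^sup>T}"
    unfolding eq by (simp add: mult_ac)
qed

text \<open>Column by column: testing the form at u = E v and v gives |E v|^2 <= e |E v| |v|, and
  one factor |E v| cancels.\<close>

lemma bilin_bound_mult:
  assumes E: "E \<in> carrier_mat n m" and bb: "bilin_bound E e" and B: "B \<in> carrier_mat m k"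
  shows "frob_inner (E * B) (E * B) \<le> e\<^sup>2 * frob_inner B B"
proof -
  have e: "0 \<le> e" using bb by (simp add: bilin_bound_def)
  have col: "(\<Sum>i<n. ((E * B) $$ (i, c))\<^sup>2) \<le> e\<^sup>2 * (\<Sum>j<m. (B $$ (j, c))\<^sup>2)" if c: "c < k" for c
  proof -
    define u where "u = (\<lambda>i. (E * B) $$ (i, c))"
    define v where "v = (\<lambda>j. B $$ (j, c))"
    have u: "u i = (\<Sum>j<m. E $$ (i, j) * v j)" if "i < n" for i
      unfolding u_def v_def using that c E B by (intro mult_mat_index_sum) auto
    have "(L2_set u {..<n})\<^sup>2 = (\<Sum>i<n. u i * u i)"
      by (simp add: L2_set_def sum_nonneg power2_eq_square)
    also have "\<dots> = (\<Sum>i<n. u i * (\<Sum>j<m. E $$ (i, j) * v j))"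
      by (intro sum.cong refl) (simp add: u[symmetric])
    also have "\<dots> = (\<Sum>i<n. \<Sum>j<m. u i * E $$ (i, j) * v j)"
      by (simp add: sum_distrib_left mult.assoc)
    also have "\<dots> \<le> e * L2_set u {..<n} * L2_set v {..<m}"
      using conjunct2[OF bb[unfolded bilin_bound_def], rule_format, of u v] E
      by (simp add: abs_le_iff)
    finally have le: "L2_set u {..<n} * L2_set u {..<n} \<le> L2_set u {..<n} * (e * L2_set v {..<m})"
      by (simp add: power2_eq_square mult_ac)
    have "L2_set u {..<n} \<le> e * L2_set v {..<m}"
    proof (cases "L2_set u {..<n} = 0")
      case False
      then have "0 < L2_set u {..<n}" using L2_set_nonneg[of u "{..<n}"] by linarith
      with le show ?thesis by simp
    qed (use e in simp)
    then have "(L2_set u {..<n})\<^sup>2 \<le> (e * L2_set v {..<m})\<^sup>2" by (intro power_mono) auto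
    then show ?thesis
      by (simp add: power_mult_distrib L2_set_def sum_nonneg u_def v_def)
  qed
  have "frob_inner (E * B) (E * B) = (\<Sum>c<k. \<Sum>i<n. ((E * B) $$ (i, c))\<^sup>2)"
    unfolding frob_inner_def using E B
    by (subst sum.swap) (simp add: power2_eq_square del: index_mult_mat(1))
  also have "\<dots> \<le> (\<Sum>c<k. e\<^sup>2 * (\<Sum>j<m. (B $$ (j, c))\<^sup>2))" using col by (intro sum_mono) auto
  also have "\<dots> = e\<^sup>2 * frob_inner B B"
  proof -
    have "frob_inner B B = (\<Sum>c<k. \<Sum>j<m. (B $$ (j, c))\<^sup>2)"
      unfolding frob_inner_def using B by (subst sum.swap) (simp add: power2_eq_square)
    then show ?thesis by (simp add: sum_distrib_left)
  qed
  finally show ?thesis .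
qed

lemma frob_inner_one: "frob_inner (1\<^sub>m r) (1\<^sub>m r) = real r"
proof -
  have "frob_inner (1\<^sub>m r) (1\<^sub>m r) = (\<Sum>i<r. \<Sum>j<r. if j = i then 1 else 0)"
    unfolding frob_inner_def by (intro sum.cong) auto
  then show ?thesis by simp
qed

lemma frob_inner_orthonormal:
  assumes "Q \<in> carrier_mat n r" "Q\<^sup>T * Q = 1\<^sub>m r"
  shows "frob_inner Q Q = real r"
  using orthogonal_frob_inner[OF assms one_carrier_mat one_carrier_mat] assms(1)
  by (simp add: frob_inner_one)

text \<open>Ky Fan's maximum principle: \<open>r\<close> orthonormal directions capture at most the top \<open>r\<close> terms.\<close>
lemma sum_top_weights:
  fixes s p :: "nat \<Rightarrow> real"
  assumes rn: "r \<le> n" and nonneg: "\<And>i. i < n \<Longrightarrow> 0 \<le> s i"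
    and dec: "\<And>i j. j < n \<Longrightarrow> i \<le> j \<Longrightarrow> s j \<le> s i"
    and p: "\<And>i. i < n \<Longrightarrow> 0 \<le> p i" "\<And>i. i < n \<Longrightarrow> p i \<le> 1" "(\<Sum>i<n. p i) \<le> real r"
  shows "(\<Sum>i<n. s i * p i) \<le> (\<Sum>i<r. s i)"
proof (cases "r = 0")
  case True
  then have "(\<Sum>i<n. p i) = 0" using p by (intro antisym sum_nonneg) auto
  then have "\<forall>i<n. p i = 0" using p(1) sum_nonneg_eq_0_iff[of "{..<n}" p] by auto
  then show ?thesis using True by simp
next
  case False
  define t where "t = s (r - 1)"
  have t: "0 \<le> t" using nonneg[of "r - 1"] False rn by (simp add: t_def)
  have split: "{..<n} = {..<r} \<union> {r..<n}" using rn by auto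
  have "(\<Sum>i<n. s i * p i) = (\<Sum>i<n. (s i - t) * p i) + t * (\<Sum>i<n. p i)"
    by (simp add: algebra_simps sum.distrib[symmetric] sum_distrib_left)
  also have "(\<Sum>i<n. (s i - t) * p i) = (\<Sum>i<r. (s i - t) * p i) + (\<Sum>i=r..<n. (s i - t) * p i)"
    unfolding split by (rule sum.union_disjoint) auto
  also have "(\<Sum>i<r. (s i - t) * p i) \<le> (\<Sum>i<r. (s i - t) * 1)"
    using dec[of "r - 1"] p(2) rn False by (intro sum_mono mult_left_mono) (auto simp: t_def)
  also have "(\<Sum>i=r..<n. (s i - t) * p i) \<le> 0"
    using dec[of _ "r - 1"] p(1) False by (intro sum_nonpos mult_nonpos_nonneg) (auto simp: t_def)
  also have "t * (\<Sum>i<n. p i) \<le> t * real r" using p(3) t by (intro mult_left_mono)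
  finally show ?thesis by (simp add: sum_subtractf mult.commute)
qed

text \<open>Everything used later about a truncated decomposition, so that the full factors do not
  reappear. The last clause is the optimality of the leading left singular vectors: in the
  coordinates R = V^T Q the energy of K Q is a sum of squared singular values with weights
  \<open>p i\<close>, the squared row lengths of R, and \<open>sum_top_weights\<close>
  applies.\<close>

lemma trunc_svdE:
  assumes K: "K \<in> carrier_mat n1 n2" and svd: "is_trunc_svd r K CL Sig CR"
  obtains "CL \<in> carrier_mat n1 r" "CR \<in> carrier_mat n2 r" "Sig \<in> carrier_mat r r"
    "CL\<^sup>T * CL = 1\<^sub>m r" "CR\<^sup>T * CR = 1\<^sub>m r" "CL\<^sup>T * K = Sig * CR\<^sup>T"
    "\<And>i. i < r \<Longrightarrow> 0 \<le> Sig $$ (i, i)"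
    "\<And>i j. i < r \<Longrightarrow> j < r \<Longrightarrow> i \<noteq> j \<Longrightarrow> Sig $$ (i, j) = 0"
    "\<And>Q. Q \<in> carrier_mat n2 r \<Longrightarrow> Q\<^sup>T * Q = 1\<^sub>m r \<Longrightarrow>
       frob_inner (K * Q) (K * Q) \<le> frob_inner (CL\<^sup>T * K) (CL\<^sup>T * K)"
proof -
  define mn where "mn = min n1 n2"
  have rmn: "r \<le> mn" using svd K unfolding is_trunc_svd_def mn_def by auto
  obtain U S V where sv: "is_svd K U S V" and
    CL: "CL = mat n1 r (\<lambda>(i, j). U $$ (i, j))" and
    Sig: "Sig = mat r r (\<lambda>(i, j). S $$ (i, j))" and
    CR: "CR = mat n2 r (\<lambda>(i, j). V $$ (i, j))"
    using svd K unfolding is_trunc_svd_def by auto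
  have U: "U \<in> carrier_mat n1 n1" "U\<^sup>T * U = 1\<^sub>m n1" and V: "V \<in> carrier_mat n2 n2" "V\<^sup>T * V = 1\<^sub>m n2"
    and S: "S \<in> carrier_mat n1 n2" "diagonal_mat S"
    and Snn: "\<And>i. i < mn \<Longrightarrow> 0 \<le> S $$ (i, i)"
    and Sdec: "\<And>i j. j < mn \<Longrightarrow> i \<le> j \<Longrightarrow> S $$ (j, j) \<le> S $$ (i, i)"
    and KU: "K = U * S * V\<^sup>T"
    using sv K unfolding is_svd_def Let_def mn_def by auto
  have S0: "S $$ (i, j) = 0" if "i < n1" "j < n2" "i \<noteq> j" for i j
    using S that unfolding diagonal_mat_def by auto
  have CLc: "CL \<in> carrier_mat n1 r" and CRc: "CR \<in> carrier_mat n2 r" and Sigc: "Sig \<in> carrier_mat r r"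
    by (auto simp: CL CR Sig)
  have rn: "r \<le> n1" "r \<le> n2" using rmn by (auto simp: mn_def)
  have trunc_orth: "(mat n r (\<lambda>(i, j). A $$ (i, j)))\<^sup>T * A = mat r n (\<lambda>(i, j). if i = j then 1 else 0)"
    if A: "A \<in> carrier_mat n n" "A\<^sup>T * A = 1\<^sub>m n" and "r \<le> n" for A :: "real mat" and n
  proof (rule eq_matI)
    fix i j assume "i < dim_row (mat r n (\<lambda>(i, j). if i = j then 1 else 0 :: real))"
      "j < dim_col (mat r n (\<lambda>(i, j). if i = j then 1 else 0 :: real))"
    then have ij: "i < r" "j < n" by auto
    have "((mat n r (\<lambda>(i, j). A $$ (i, j)))\<^sup>T * A) $$ (i, j) = (\<Sum>l<n. A $$ (l, i) * A $$ (l, j))"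
      using A ij by (subst mult_mat_index_sum[of _ r n _ n]) auto
    also have "\<dots> = (A\<^sup>T * A) $$ (i, j)"
      using A(1) ij \<open>r \<le> n\<close> by (subst mult_mat_index_sum[of _ n n _ n]) auto
    finally show "((mat n r (\<lambda>(i, j). A $$ (i, j)))\<^sup>T * A) $$ (i, j) =
        mat r n (\<lambda>(i, j). if i = j then 1 else 0) $$ (i, j)"
      using ij A(2) \<open>r \<le> n\<close> by simp
  qed (use that in auto)
  have orth_trunc: "C\<^sup>T * C = 1\<^sub>m r"
    if C: "C = mat n r (\<lambda>(i, j). A $$ (i, j))" and A: "A \<in> carrier_mat n n" "A\<^sup>T * A = 1\<^sub>m n"
      and "r \<le> n" for A C :: "real mat" and n
  proof (rule eq_matI)
    have Cc: "C \<in> carrier_mat n r" by (simp add: C)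
    fix i j assume "i < dim_row (1\<^sub>m r :: real mat)" "j < dim_col (1\<^sub>m r :: real mat)"
    then have ij: "i < r" "j < r" by auto
    have "(C\<^sup>T * C) $$ (i, j) = (\<Sum>l<n. C\<^sup>T $$ (i, l) * C $$ (l, j))"
      using Cc ij by (intro mult_mat_index_sum) auto
    also have "\<dots> = (\<Sum>l<n. C\<^sup>T $$ (i, l) * A $$ (l, j))" using ij by (intro sum.cong) (auto simp: C)
    also have "\<dots> = (C\<^sup>T * A) $$ (i, j)"
      using Cc A(1) ij \<open>r \<le> n\<close> by (intro mult_mat_index_sum[of _ r n _ n, symmetric]) auto
    also have "\<dots> = (1\<^sub>m r :: real mat) $$ (i, j)"
      unfolding C trunc_orth[OF A \<open>r \<le> n\<close>] using ij \<open>r \<le> n\<close> by simp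
    finally show "(C\<^sup>T * C) $$ (i, j) = 1\<^sub>m r $$ (i, j)" .
  qed (auto simp: C)
  have 1: "CL\<^sup>T * CL = 1\<^sub>m r" by (rule orth_trunc[OF CL U rn(1)])
  have 2: "CR\<^sup>T * CR = 1\<^sub>m r" by (rule orth_trunc[OF CR V rn(2)])
  define J where "J = mat r n1 (\<lambda>(i, j). if i = j then 1 else 0 :: real)"
  have J: "J \<in> carrier_mat r n1" by (simp add: J_def)
  have CLU: "CL\<^sup>T * U = J" unfolding CL J_def by (rule trunc_orth[OF U rn(1)])
  have JS: "(J * S) $$ (i, j) = S $$ (i, j)" if "i < r" "j < n2" for i j
  proof -
    have "(J * S) $$ (i, j) = (\<Sum>l<n1. J $$ (i, l) * S $$ (l, j))"
      using that J S by (intro mult_mat_index_sum) auto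
    also have "\<dots> = (\<Sum>l<n1. if l = i then S $$ (i, j) else 0)"
      using that by (intro sum.cong) (auto simp: J_def)
    finally show ?thesis using that rn by simp
  qed
  have "CL\<^sup>T * K = CL\<^sup>T * U * S * V\<^sup>T"
    unfolding KU using CLc U S V
    by (simp add: assoc_mult_mat[of _ r n1 _ n1 _ n2] assoc_mult_mat[of _ n1 n1 _ n2 _ n2]
        assoc_mult_mat[of _ r n1 _ n2 _ n2])
  then have CLK: "CL\<^sup>T * K = J * S * V\<^sup>T" by (simp add: CLU)
  have 3: "CL\<^sup>T * K = Sig * CR\<^sup>T" unfolding CLK
  proof (rule eq_matI)
    fix i j assume "i < dim_row (Sig * CR\<^sup>T)" "j < dim_col (Sig * CR\<^sup>T)"
    then have ij: "i < r" "j < n2" using CRc Sigc by auto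
    have i: "i < n1" "i < n2" using ij rn by auto
    have "(J * S * V\<^sup>T) $$ (i, j) = (\<Sum>l<n2. (J * S) $$ (i, l) * V\<^sup>T $$ (l, j))"
      using ij J S V by (intro mult_mat_index_sum) auto
    also have "\<dots> = (\<Sum>l<n2. if l = i then S $$ (i, i) * V $$ (j, i) else 0)"
      using ij V i S0 by (intro sum.cong) (auto simp: JS simp del: index_mult_mat(1))
    also have "\<dots> = S $$ (i, i) * V $$ (j, i)" using i by simp
    also have "\<dots> = (\<Sum>l<r. if l = i then S $$ (i, i) * V $$ (j, i) else 0)" using ij by simp
    also have "\<dots> = (\<Sum>l<r. Sig $$ (i, l) * CR\<^sup>T $$ (l, j))"
      using ij S0 i rn by (intro sum.cong) (auto simp: Sig CR)
    also have "\<dots> = (Sig * CR\<^sup>T) $$ (i, j)"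
      using ij Sigc CRc by (intro mult_mat_index_sum[symmetric]) auto
    finally show "(J * S * V\<^sup>T) $$ (i, j) = (Sig * CR\<^sup>T) $$ (i, j)" .
  qed (use J V Sigc CRc in auto)
  have 4: "0 \<le> Sig $$ (i, i)" if "i < r" for i using that rmn Snn by (auto simp: Sig)
  have 5: "Sig $$ (i, j) = 0" if "i < r" "j < r" "i \<noteq> j" for i j
    using that S0 rn by (auto simp: Sig)
  have top: "frob_inner (CL\<^sup>T * K) (CL\<^sup>T * K) = (\<Sum>i<r. (S $$ (i, i))\<^sup>2)"
  proof -
    have "frob_inner (CL\<^sup>T * K) (CL\<^sup>T * K) = frob_inner Sig Sig"
      unfolding 3 by (rule orthogonal_frob_inner_right[OF CRc 2 Sigc Sigc])
    also have "\<dots> = (\<Sum>i<r. \<Sum>j<r. if j = i then (S $$ (i, i))\<^sup>2 else 0)"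
      unfolding frob_inner_def using S0 rn
      by (intro sum.cong) (auto simp: Sig power2_eq_square)
    finally show ?thesis by simp
  qed
  have 6: "frob_inner (K * Q) (K * Q) \<le> frob_inner (CL\<^sup>T * K) (CL\<^sup>T * K)"
    if Q: "Q \<in> carrier_mat n2 r" "Q\<^sup>T * Q = 1\<^sub>m r" for Q
  proof -
    define R where "R = V\<^sup>T * Q"
    have R: "R \<in> carrier_mat n2 r" using V Q by (auto simp: R_def)
    have VV: "V * V\<^sup>T = 1\<^sub>m n2" by (rule orthogonal_mat_commute[OF V])
    have "R\<^sup>T * R = Q\<^sup>T * (V * V\<^sup>T) * Q"
      unfolding R_def using V(1) Q(1)
      by (simp add: transpose_mult[of _ n2 n2 _ r] assoc_mult_mat[of _ r n2 _ n2 _ r]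
          assoc_mult_mat[of _ n2 n2 _ n2 _ r] assoc_mult_mat[of _ r n2 _ n2 _ n2])
    then have RR: "R\<^sup>T * R = 1\<^sub>m r" unfolding VV using Q by simp
    have KQ: "K * Q = U * (S * R)"
      unfolding KU R_def using U V S Q
      by (simp add: assoc_mult_mat[of _ n1 n1 _ n2 _ n2] assoc_mult_mat[of _ n1 n1 _ n2 _ r]
          assoc_mult_mat[of _ n1 n2 _ n2 _ r])
    have SR: "S * R \<in> carrier_mat n1 r" using S R by auto
    define p where "p = (\<lambda>i. \<Sum>j<r. (R $$ (i, j))\<^sup>2)"
    have SRi: "(S * R) $$ (i, j) = (if i < n2 then S $$ (i, i) * R $$ (i, j) else 0)"
      if "i < n1" "j < r" for i j
    proof -
      have "(S * R) $$ (i, j) = (\<Sum>l<n2. S $$ (i, l) * R $$ (l, j))"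
        using that S R by (intro mult_mat_index_sum) auto
      also have "\<dots> = (\<Sum>l<n2. if l = i then S $$ (i, i) * R $$ (i, j) else 0)"
        using that S0 by (intro sum.cong) auto
      finally show ?thesis by simp
    qed
    have "frob_inner (K * Q) (K * Q) = frob_inner (S * R) (S * R)"
      unfolding KQ by (rule orthogonal_frob_inner[OF U SR SR])
    also have "\<dots> = (\<Sum>i<n1. if i < n2 then (S $$ (i, i))\<^sup>2 * p i else 0)"
      unfolding frob_inner_def p_def using SR R S
      by (intro sum.cong) (auto simp: SRi power2_eq_square sum_distrib_left mult_ac simp del: index_mult_mat(1))
    also have "\<dots> = (\<Sum>i<mn. (S $$ (i, i))\<^sup>2 * p i)"
    proof -
      have "{..<mn} = {..<n1} \<inter> {i. i < n2}" by (auto simp: mn_def)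
      then show ?thesis by (simp add: sum.inter_restrict)
    qed
    also have "\<dots> \<le> (\<Sum>i<r. (S $$ (i, i))\<^sup>2)"
    proof (rule sum_top_weights[OF rmn])
      show "0 \<le> (S $$ (i, i))\<^sup>2" for i by simp
      show "(S $$ (j, j))\<^sup>2 \<le> (S $$ (i, i))\<^sup>2" if "j < mn" "i \<le> j" for i j
        using Sdec[OF that] Snn[OF that(1)] by (intro power_mono) auto
      show "0 \<le> p i" for i by (simp add: p_def sum_nonneg)
      have "(\<Sum>i<mn. p i) \<le> (\<Sum>i<n2. p i)"
        by (intro sum_mono2) (auto simp: p_def mn_def sum_nonneg)
      also have "\<dots> = frob_inner R R"
        using R unfolding p_def frob_inner_def by (simp add: power2_eq_square)
      finally show "(\<Sum>i<mn. p i) \<le> real r" using frob_inner_orthonormal[OF R RR] by simp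
      \<comment> \<open>The weight is a diagonal entry of the projection R R^T. As that matrix is
        symmetric and idempotent, its diagonal entry is a sum of squares that contains its own
        square.\<close>
      show "p i \<le> 1" if "i < mn" for i
      proof -
        have i: "i < n2" using that by (simp add: mn_def)
        have RT: "R\<^sup>T \<in> carrier_mat r n2" "R * R\<^sup>T \<in> carrier_mat n2 n2" using R by auto
        have idem: "R * R\<^sup>T * (R * R\<^sup>T) = R * R\<^sup>T"
        proof -
          have "R * R\<^sup>T * (R * R\<^sup>T) = R * (R\<^sup>T * R) * R\<^sup>T"
            using R by (simp add: assoc_mult_mat[of _ n2 r _ n2 _ n2] assoc_mult_mat[of _ r n2 _ r _ n2]
                assoc_mult_mat[of _ n2 r _ r _ n2])
          then show ?thesis unfolding RR using R by simp
        qed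
        have g: "(R * R\<^sup>T) $$ (a, b) = (\<Sum>l<r. R $$ (a, l) * R $$ (b, l))" if "a < n2" "b < n2" for a b
          using that R by (subst mult_mat_index_sum[of _ n2 r _ n2]) auto
        have pi: "(R * R\<^sup>T) $$ (i, i) = p i" unfolding g[OF i i] p_def by (simp add: power2_eq_square)
        have "p i = (\<Sum>l<n2. (R * R\<^sup>T) $$ (i, l) * (R * R\<^sup>T) $$ (l, i))"
          unfolding pi[symmetric] using mult_mat_index_sum[OF RT(2) RT(2) i i] unfolding idem .
        also have "\<dots> = (\<Sum>l<n2. ((R * R\<^sup>T) $$ (i, l))\<^sup>2)"
          using i by (intro sum.cong refl) (simp add: g power2_eq_square mult.commute del: index_mult_mat(1))
        also have "\<dots> \<ge> ((R * R\<^sup>T) $$ (i, i))\<^sup>2"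
          using i member_le_sum[of i "{..<n2}" "\<lambda>l. ((R * R\<^sup>T) $$ (i, l))\<^sup>2"] by simp
        finally have "p i * p i \<le> p i * 1" unfolding pi by (simp add: power2_eq_square)
        moreover have "0 \<le> p i" by (simp add: p_def sum_nonneg)
        ultimately show ?thesis by (metis mult_le_cancel_left_pos order_le_less zero_le_one)
      qed
    qed
    finally show ?thesis unfolding top .
  qed
  show thesis by (rule that[OF CLc CRc Sigc 1 2 3 4 5 6])
qed

text \<open>Optimality of the truncation K_r yields |N|^2 <= 2 <E, N> for N = K_r - B and E = K - B.
  Cauchy-Schwarz with the Frobenius norm of E would be too lossy, so N is split into its projection
  N1 to the range of CL and the rest N2. The columns of N1 lie in an r-dimensional space and so do
  the rows of N2, hence each pairs with E at a cost of sqrt r * e * |N|.\<close>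

lemma trunc_svd_perturbation:
  assumes K: "K \<in> carrier_mat n1 n2" and svd: "is_trunc_svd r K CL Sig CR"
    and B: "B \<in> carrier_mat n1 n2" and Q: "Q \<in> carrier_mat n2 r" "Q\<^sup>T * Q = 1\<^sub>m r"
    and BQ: "B * Q * Q\<^sup>T = B" and bb: "bilin_bound (K - B) e"
  shows "frob_norm (CL * Sig * CR\<^sup>T - B) \<le> 4 * sqrt (real r) * e"
proof (rule trunc_svdE[OF K svd])
  assume CL: "CL \<in> carrier_mat n1 r" and CR: "CR \<in> carrier_mat n2 r" and Sig: "Sig \<in> carrier_mat r r"
    and CL1: "CL\<^sup>T * CL = 1\<^sub>m r" and CLK: "CL\<^sup>T * K = Sig * CR\<^sup>T"
    and EY: "\<And>Q. Q \<in> carrier_mat n2 r \<Longrightarrow> Q\<^sup>T * Q = 1\<^sub>m r \<Longrightarrow>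
       frob_inner (K * Q) (K * Q) \<le> frob_inner (CL\<^sup>T * K) (CL\<^sup>T * K)"
  have e: "0 \<le> e" using bb by (simp add: bilin_bound_def)
  define Kr where "Kr = CL * (CL\<^sup>T * K)"
  have Kr: "CL * Sig * CR\<^sup>T = Kr" unfolding Kr_def CLK using CL Sig CR
    by (intro assoc_mult_mat) auto
  have Krc: "Kr \<in> carrier_mat n1 n2" using CL K by (auto simp: Kr_def)
  define E where "E = K - B"
  define N where "N = Kr - B"
  have Ec: "E \<in> carrier_mat n1 n2" and Nc: "N \<in> carrier_mat n1 n2"
    using K B Krc by (auto simp: E_def N_def minus_carrier_mat)
  have CLT: "CL\<^sup>T * A \<in> carrier_mat r n2" if "A \<in> carrier_mat n1 n2" for A using that CL by auto
  have proj: "frob_inner A (CL * (CL\<^sup>T * A')) = frob_inner (CL\<^sup>T * A) (CL\<^sup>T * A')"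
    if "A \<in> carrier_mat n1 n2" "A' \<in> carrier_mat n1 n2" for A A'
  proof -
    have "frob_inner A (CL * (CL\<^sup>T * A')) = frob_inner (CL * (CL\<^sup>T * A')) A"
      using that CL by (intro frob_inner_commute) auto
    also have "\<dots> = frob_inner (CL\<^sup>T * A') (CL\<^sup>T * A)" using that CL by (intro frob_inner_mult_left) auto
    also have "\<dots> = frob_inner (CL\<^sup>T * A) (CL\<^sup>T * A')" using that by (intro frob_inner_commute[of _ r n2] CLT)
    finally show ?thesis .
  qed
  have right: "frob_inner A A' = frob_inner (A * Q) (A' * Q)"
    if "A \<in> carrier_mat n1 n2" "A' \<in> carrier_mat n1 n2" "A' * Q * Q\<^sup>T = A'" for A A'
  proof -
    have c: "A' * Q \<in> carrier_mat n1 r" "A * Q \<in> carrier_mat n1 r" using that Q by auto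
    have "frob_inner (A * Q) (A' * Q) = frob_inner A (A' * Q * Q\<^sup>T)"
      using that Q by (intro frob_inner_mult_right) auto
    then show ?thesis using that by simp
  qed
  have KrKr: "frob_inner Kr Kr = frob_inner (CL\<^sup>T * K) (CL\<^sup>T * K)"
    unfolding Kr_def by (rule orthogonal_frob_inner[OF CL CL1 CLT[OF K] CLT[OF K]])
  have KKr: "frob_inner K Kr = frob_inner Kr Kr" unfolding KrKr unfolding Kr_def by (rule proj[OF K K])
  \<comment> \<open>The Eckart-Young comparison |K - K_r| <= |K - B| with |K|^2 cancelled. Since the
    rows of B lie in the span of Q, the pairing of K with B only sees K Q, whose energy is bounded
    by that of K_r.\<close>
  have "2 * frob_inner K B \<le> frob_inner Kr Kr + frob_inner B B"
  proof -
    have c: "K * Q \<in> carrier_mat n1 r" "B * Q \<in> carrier_mat n1 r" using K B Q by auto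
    have "2 * frob_inner K B = 2 * frob_inner (K * Q) (B * Q)" using right[OF K B BQ] by simp
    also have "\<dots> \<le> frob_inner (K * Q) (K * Q) + frob_inner (B * Q) (B * Q)"
      using frob_inner_self_nonneg[of "K * Q - B * Q"] unfolding frob_inner_diff_self[OF c] by linarith
    also have "\<dots> \<le> frob_inner Kr Kr + frob_inner B B"
      unfolding KrKr right[OF B B BQ] using EY[OF Q] by simp
    finally show ?thesis .
  qed
  moreover have "frob_inner E N = frob_inner Kr Kr - frob_inner K B - frob_inner Kr B + frob_inner B B"
    unfolding E_def N_def using K B Krc KKr frob_inner_commute[OF B Krc]
    by (simp add: frob_inner_diff_left[of _ n1 n2] frob_inner_diff_right[of _ n1 n2] minus_carrier_mat)
  moreover have "frob_inner N N = frob_inner Kr Kr - 2 * frob_inner Kr B + frob_inner B B"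
    unfolding N_def by (rule frob_inner_diff_self[OF Krc B])
  ultimately have NE: "frob_inner N N \<le> 2 * frob_inner E N" by linarith
  define N1 where "N1 = CL * (CL\<^sup>T * N)"
  define N2 where "N2 = N - N1"
  have N1c: "N1 \<in> carrier_mat n1 n2" using CL Nc by (auto simp: N1_def)
  have N2c: "N2 \<in> carrier_mat n1 n2" using N1c Nc by (auto simp: N2_def minus_carrier_mat)
  have N1N1: "frob_inner N1 N1 = frob_inner (CL\<^sup>T * N) (CL\<^sup>T * N)"
    unfolding N1_def by (rule orthogonal_frob_inner[OF CL CL1 CLT[OF Nc] CLT[OF Nc]])
  have NN1: "frob_inner N N1 = frob_inner N1 N1" unfolding N1N1 unfolding N1_def by (rule proj[OF Nc Nc])
  have NN: "frob_inner N N = frob_inner N1 N1 + frob_inner N2 N2"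
    unfolding N2_def frob_inner_diff_self[OF Nc N1c] NN1 by simp
  have n1: "frob_norm (CL\<^sup>T * N) \<le> frob_norm N"
    unfolding frob_norm_eq_sqrt N1N1[symmetric] NN by simp
  have n2: "frob_norm N2 \<le> frob_norm N" unfolding frob_norm_eq_sqrt NN by simp
  have PKr: "CL * (CL\<^sup>T * Kr) = Kr"
  proof -
    have "CL\<^sup>T * Kr = CL\<^sup>T * CL * (CL\<^sup>T * K)"
      unfolding Kr_def using CL K by (intro assoc_mult_mat[symmetric]) auto
    also have "\<dots> = CL\<^sup>T * K" unfolding CL1 by (rule left_mult_one_mat[OF CLT[OF K]])
    finally show ?thesis by (simp add: Kr_def)
  qed
  \<comment> \<open>K_r is fixed by the projection to the range of CL and cancels, so the rows of N2
    are inherited from B and lie in the span of Q.\<close>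
  have N2B: "N2 = CL * (CL\<^sup>T * B) - B"
  proof -
    have "CL\<^sup>T * N = CL\<^sup>T * Kr - CL\<^sup>T * B"
      unfolding N_def using CL Krc B by (intro mult_minus_distrib_mat) auto
    then have "N1 = CL * (CL\<^sup>T * Kr) - CL * (CL\<^sup>T * B)"
      unfolding N1_def using CL CLT[OF Krc] CLT[OF B] by (simp add: mult_minus_distrib_mat[of _ n1 r _ n2])
    then have N1': "N1 = Kr - CL * (CL\<^sup>T * B)" unfolding PKr .
    have "(A1 - A2) - (A1 - A3) = A3 - A2"
      if "A1 \<in> carrier_mat n1 n2" "A2 \<in> carrier_mat n1 n2" "A3 \<in> carrier_mat n1 n2"
      for A1 A2 A3 :: "real mat"
      using that by (intro eq_matI) auto
    moreover have "CL * (CL\<^sup>T * B) \<in> carrier_mat n1 n2" using CL B by auto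
    ultimately show ?thesis unfolding N2_def N1' N_def using Krc B by blast
  qed
  have N2Q: "N2 * Q * Q\<^sup>T = N2"
  proof -
    have c: "CL * (CL\<^sup>T * B) \<in> carrier_mat n1 n2" "B * Q \<in> carrier_mat n1 r" using CL B Q by auto
    have "CL * (CL\<^sup>T * B) * Q * Q\<^sup>T = CL * (CL\<^sup>T * (B * Q * Q\<^sup>T))"
      using CL B Q
      by (simp add: assoc_mult_mat[of _ n1 r _ n2 _ r] assoc_mult_mat[of _ n1 r _ r _ n2]
          assoc_mult_mat[of _ r n1 _ n2 _ r] assoc_mult_mat[of _ r n1 _ r _ n2]
          assoc_mult_mat[of _ n1 n2 _ r _ n2] assoc_mult_mat[of _ r n2 _ r _ n2])
    then have "CL * (CL\<^sup>T * B) * Q * Q\<^sup>T - B * Q * Q\<^sup>T = CL * (CL\<^sup>T * B) - B" unfolding BQ by simp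
    moreover have "N2 * Q = CL * (CL\<^sup>T * B) * Q - B * Q"
      unfolding N2B using c(1) B Q by (intro minus_mult_distrib_mat[of _ n1 n2 _ _ r]) auto
    moreover have "(CL * (CL\<^sup>T * B) * Q - B * Q) * Q\<^sup>T = CL * (CL\<^sup>T * B) * Q * Q\<^sup>T - B * Q * Q\<^sup>T"
      using c Q by (intro minus_mult_distrib_mat[of _ n1 r _ _ n2]) (auto intro: mult_carrier_mat)
    ultimately show ?thesis unfolding N2B by (simp only:)
  qed
  have re: "sqrt (e\<^sup>2 * real r) = sqrt (real r) * e" using e by (simp add: real_sqrt_mult)
  have bE: "bilin_bound E e" using bb by (simp add: E_def)
  have "frob_inner E N1 \<le> frob_norm (CL\<^sup>T * E) * frob_norm (CL\<^sup>T * N)"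
    unfolding N1_def proj[OF Ec Nc] by (rule frob_inner_Cauchy_Schwarz[OF CLT[OF Ec] CLT[OF Nc]])
  also have "\<dots> \<le> (sqrt (real r) * e) * frob_norm N"
  proof (intro mult_mono n1)
    have "frob_inner (CL\<^sup>T * E) (CL\<^sup>T * E) = frob_inner (CL\<^sup>T * E)\<^sup>T (CL\<^sup>T * E)\<^sup>T"
      by (rule frob_inner_transpose[symmetric, OF CLT[OF Ec] CLT[OF Ec]])
    also have "(CL\<^sup>T * E)\<^sup>T = E\<^sup>T * CL" using CL Ec by (simp add: transpose_mult[of _ r n1 _ n2])
    also have "frob_inner (E\<^sup>T * CL) (E\<^sup>T * CL) \<le> e\<^sup>2 * frob_inner CL CL"
      using Ec CL by (intro bilin_bound_mult bilin_bound_transpose bE) auto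
    also have "frob_inner CL CL = real r" by (rule frob_inner_orthonormal[OF CL CL1])
    finally show "frob_norm (CL\<^sup>T * E) \<le> sqrt (real r) * e"
      unfolding frob_norm_eq_sqrt re[symmetric] by simp
  qed (use e in auto)
  finally have E1: "frob_inner E N1 \<le> sqrt (real r) * e * frob_norm N" .
  have c: "E * Q \<in> carrier_mat n1 r" "N2 * Q \<in> carrier_mat n1 r" using Ec N2c Q by auto
  have "frob_inner E N2 = frob_inner (E * Q) (N2 * Q)" by (rule right[OF Ec N2c N2Q])
  also have "\<dots> \<le> frob_norm (E * Q) * frob_norm (N2 * Q)" by (rule frob_inner_Cauchy_Schwarz[OF c])
  also have "\<dots> \<le> (sqrt (real r) * e) * frob_norm N"
  proof (intro mult_mono)
    have "frob_inner (E * Q) (E * Q) \<le> e\<^sup>2 * frob_inner Q Q" by (rule bilin_bound_mult[OF Ec bE Q(1)])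
    also have "frob_inner Q Q = real r" by (rule frob_inner_orthonormal[OF Q])
    finally show "frob_norm (E * Q) \<le> sqrt (real r) * e"
      unfolding frob_norm_eq_sqrt re[symmetric] by simp
    show "frob_norm (N2 * Q) \<le> frob_norm N"
      using n2 unfolding frob_norm_eq_sqrt right[OF N2c N2c N2Q] .
  qed (use e in auto)
  finally have E2: "frob_inner E N2 \<le> sqrt (real r) * e * frob_norm N" .
  have "frob_inner E N2 = frob_inner E N - frob_inner E N1"
    unfolding N2_def by (rule frob_inner_diff_right[OF Nc N1c Ec])
  with NE E1 E2 have "frob_norm N * frob_norm N \<le> frob_norm N * (4 * sqrt (real r) * e)"
    by (simp add: frob_norm_square[unfolded power2_eq_square] algebra_simps)
  then have "frob_norm N \<le> 4 * sqrt (real r) * e"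
    using e frob_norm_nonneg[of N] by (cases "frob_norm N = 0") (auto simp: mult_le_cancel_left)
  then show ?thesis unfolding Kr N_def .
qed

section \<open>Spectra of the factored matrix\<close>

lemma char_poly_spectral:
  assumes Q: "Q \<in> carrier_mat n n" "Q\<^sup>T * Q = 1\<^sub>m n"
  shows "char_poly (Q * diag_fun n d * Q\<^sup>T) = (\<Prod>i\<leftarrow>[0..<n]. [:- d i, 1:])"
proof -
  have "similar_mat (Q * diag_fun n d * Q\<^sup>T) (diag_fun n d)"
    unfolding similar_mat_def similar_mat_wit_def Let_def
    using Q orthogonal_mat_commute[OF Q] by (intro exI[of _ Q] exI[of _ "Q\<^sup>T"]) auto
  then have "char_poly (Q * diag_fun n d * Q\<^sup>T) = char_poly (diag_fun n d)" by (rule char_poly_similar)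
  also have "\<dots> = (\<Prod>a\<leftarrow>diag_mat (diag_fun n d). [:- a, 1:])"
    by (rule char_poly_upper_triangular[OF diag_fun_carrier]) (auto simp: upper_triangular_def)
  also have "diag_mat (diag_fun n d) = map d [0..<n]"
    unfolding diag_mat_def by simp
  finally show ?thesis by (simp add: o_def)
qed

lemma proots_linear_factors: "proots (\<Prod>i\<leftarrow>is. [:- d i, 1 :: real:]) = image_mset d (mset is)"
proof (induction "is")
  case (Cons a js)
  have "(\<Prod>i\<leftarrow>js. [:- d i, 1:]) \<noteq> 0" by (auto simp: prod_list_zero_iff)
  then have "proots ([:- d a, 1:] * (\<Prod>i\<leftarrow>js. [:- d i, 1:])) =
      proots [:- d a, 1:] + proots (\<Prod>i\<leftarrow>js. [:- d i, 1:])"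
    by (intro proots_mult) auto
  with Cons show ?case by (simp del: mult_pCons_left)
qed simp

lemma proots_char_poly_spectral:
  assumes "Q \<in> carrier_mat n n" "Q\<^sup>T * Q = 1\<^sub>m n"
  shows "proots (char_poly (Q * diag_fun n d * Q\<^sup>T)) = image_mset d (mset_set {..<n})"
  unfolding char_poly_spectral[OF assms] proots_linear_factors
  by (metis atLeast0LessThan mset_upt)

lemma proots_char_poly_zero: "proots (char_poly (0\<^sub>m n n :: real mat)) = replicate_mset n 0"
proof -
  have "1\<^sub>m n * diag_fun n (\<lambda>_. 0) * (1\<^sub>m n)\<^sup>T = 0\<^sub>m n n"
    by (simp add: diag_fun_def) (intro eq_matI, auto)
  then have "proots (char_poly (0\<^sub>m n n)) = image_mset (\<lambda>_. 0 :: real) (mset_set {..<n})"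
    using proots_char_poly_spectral[of "1\<^sub>m n" n "\<lambda>_. 0"] by simp
  then show ?thesis by (simp add: image_mset_const_eq)
qed

text \<open>Sylvester's identity, by conjugating \<open>[[AB, 0], [B, 0]]\<close> to \<open>[[0, 0], [B, BA]]\<close>.\<close>
lemma proots_char_poly_swap:
  assumes A: "(A :: real mat) \<in> carrier_mat n r" and B: "B \<in> carrier_mat r n"
    and symAB: "(A * B)\<^sup>T = A * B" and symBA: "(B * A)\<^sup>T = B * A"
  shows "proots (char_poly (A * B)) + replicate_mset r 0 = replicate_mset n 0 + proots (char_poly (B * A))"
proof -
  have AB: "A * B \<in> carrier_mat n n" and BA: "B * A \<in> carrier_mat r r" using A B by auto
  let ?P = "four_block_mat (A * B) (0\<^sub>m n r) B (0\<^sub>m r r)"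
  let ?R = "four_block_mat (0\<^sub>m n n) (0\<^sub>m n r) B (B * A)"
  let ?S = "four_block_mat (1\<^sub>m n) A (0\<^sub>m r n) (1\<^sub>m r)"
  let ?T = "four_block_mat (1\<^sub>m n) (- A) (0\<^sub>m r n) (1\<^sub>m r)"
  note mfb = mult_four_block_mat[of _ n n _ r _ r _ _ n _ r]
  have c: "?P \<in> carrier_mat (n + r) (n + r)" "?R \<in> carrier_mat (n + r) (n + r)"
    "?S \<in> carrier_mat (n + r) (n + r)" "?T \<in> carrier_mat (n + r) (n + r)"
    using A B AB BA by auto
  have one: "four_block_mat (1\<^sub>m n) (0\<^sub>m n r) (0\<^sub>m r n) (1\<^sub>m r) = (1\<^sub>m (n + r) :: real mat)"
    by (intro eq_matI) auto
  have ST: "?S * ?T = 1\<^sub>m (n + r)"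
  proof -
    have [simp]: "- 0\<^sub>m r r = (0\<^sub>m r r :: real mat)" by (intro eq_matI) auto
    have "?S * ?T = four_block_mat (1\<^sub>m n) (0\<^sub>m n r) (0\<^sub>m r n) (1\<^sub>m r)"
      using A by (subst mfb) (auto intro!: arg_cong4[where f = four_block_mat])
    then show ?thesis by (simp only: one)
  qed
  have TS: "?T * ?S = 1\<^sub>m (n + r)" by (rule mat_mult_left_right_inverse[OF c(3,4) ST])
  have ABA: "A * B * A = A * (B * A)" using A B by (intro assoc_mult_mat) auto
  have PS: "?P * ?S = four_block_mat (A * B) (A * B * A) B (B * A)"
    using A B AB BA by (subst mfb) (auto simp: ABA intro!: arg_cong4[where f = four_block_mat])
  have SR: "?S * ?R = four_block_mat (A * B) (A * B * A) B (B * A)"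
    using A B AB BA by (subst mfb) (auto simp: ABA intro!: arg_cong4[where f = four_block_mat])
  have "?P = ?P * (?S * ?T)" unfolding ST using c(1) by (rule right_mult_one_mat[symmetric])
  also have "\<dots> = ?P * ?S * ?T" by (rule assoc_mult_mat[symmetric, OF c(1,3,4)])
  also have "\<dots> = ?S * ?R * ?T" unfolding PS SR ..
  finally have "similar_mat_wit ?P ?R ?S ?T"
    by (intro similar_mat_witI[OF ST TS _ c])
  then have "similar_mat ?P ?R" unfolding similar_mat_def by blast
  then have eq: "char_poly ?P = char_poly ?R" by (rule char_poly_similar)
  have z: "(0\<^sub>m k k :: real mat)\<^sup>T = 0\<^sub>m k k" for k by auto
  \<comment> \<open>\<open>char_poly_0_block'\<close> is applied to diagonal blocks whose
    characteristic polynomials split; the symmetry of A B and of B A is what guarantees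
    this.\<close>
  have split: "\<exists>es. char_poly S = (\<Prod>e\<leftarrow>es. [:- e, 1:])" if "S \<in> carrier_mat k k" "S\<^sup>T = S"
    for S :: "real mat" and k
    using real_symmetric_char_poly_splits[OF that] by blast
  have cP: "char_poly ?P = char_poly (A * B) * char_poly (0\<^sub>m r r)"
    by (rule char_poly_0_block'[OF refl split[OF AB symAB] split[OF zero_carrier_mat z] AB B zero_carrier_mat])
  have cR: "char_poly ?R = char_poly (0\<^sub>m n n) * char_poly (B * A)"
    by (rule char_poly_0_block'[OF refl split[OF zero_carrier_mat z] split[OF BA symBA] zero_carrier_mat B BA])
  have nz: "char_poly S \<noteq> 0" if "S \<in> carrier_mat k k" for S :: "real mat" and k
    using degree_monic_char_poly[OF that] by auto
  have "proots (char_poly (A * B) * char_poly (0\<^sub>m r r)) = proots (char_poly (0\<^sub>m n n) * char_poly (B * A))"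
    using eq unfolding cP cR by simp
  then show ?thesis
    using nz[OF AB] nz[OF BA] nz[of "0\<^sub>m r r" r] nz[of "0\<^sub>m n n" n]
    by (simp add: proots_mult proots_char_poly_zero)
qed

text \<open>Subadditivity of rank over rank-one terms. It will exclude a vanishing eigenvalue of X^T
  X, since a lost column would leave only r - 1 terms.\<close>

lemma rank_sum_outer_le:
  assumes "finite I"
  shows "vec_space.rank n (mat n m (\<lambda>(i, j). \<Sum>k\<in>I. f i k * g k j :: real)) \<le> card I"
  using assms
proof (induction I rule: finite_induct)
  case empty
  have "mat n m (\<lambda>(i, j). \<Sum>k\<in>{}. f i k * g k j :: real) = 0\<^sub>m n m" by (intro eq_matI) auto
  show ?case unfolding \<open>mat n m _ = 0\<^sub>m n m\<close> using vec_space.rank_0I[of n m] by simp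
next
  case (insert x I)
  let ?A = "mat n m (\<lambda>(i, j). f i x * g x j :: real)"
  let ?B = "mat n m (\<lambda>(i, j). \<Sum>k\<in>I. f i k * g k j :: real)"
  have "mat n m (\<lambda>(i, j). \<Sum>k\<in>insert x I. f i k * g k j :: real) = ?A + ?B"
    using insert by (intro eq_matI) auto
  moreover have "vec_space.rank n (?A + ?B) \<le> vec_space.rank n ?A + vec_space.rank n ?B"
    by (rule vec_space.rank_subadditive[of _ n m]) auto
  moreover have "vec_space.rank n ?A \<le> 1"
    by (rule vec_space.rank_le_1_product_entries[of _ n m "\<lambda>i. f i x" "\<lambda>j. g x j"]) auto
  ultimately show ?case using insert by simp
qed

text \<open>Evaluates \<open>sing_val\<close> at \<open>r\<close>: in decreasing order the r
  positive entries precede the padding zeros, so position r - 1, counted from 0, holds the least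
  positive one.\<close>

lemma rev_sorted_mset_nth:
  assumes r: "size D = r" "1 \<le> r" and pos: "\<And>x. x \<in># D \<Longrightarrow> (0 :: real) < x"
  shows "rev (sorted_list_of_multiset (replicate_mset k 0 + D)) ! (r - 1) = Min (set_mset D)"
proof -
  define L where "L = sorted_list_of_multiset D"
  have L: "sorted L" "mset L = D" "length L = r" "set L = set_mset D"
    using r by (auto simp: L_def) (metis mset_sorted_list_of_multiset size_mset)
  have "sorted_list_of_multiset (replicate_mset k 0 + D) = replicate k 0 @ L"
  proof -
    have "sorted (replicate k 0 @ L)"
      using L pos by (auto simp: sorted_append intro: less_imp_le)
    moreover have "mset (replicate k 0 @ L) = replicate_mset k 0 + D" using L by simp
    ultimately show ?thesis
      by (metis sorted_list_of_multiset_mset sorted_sort_id)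
  qed
  then have "rev (sorted_list_of_multiset (replicate_mset k 0 + D)) ! (r - 1) = L ! 0"
    using L r by (simp add: nth_append rev_nth)
  also have "\<dots> = Min (set_mset D)"
  proof (rule Min_eqI[symmetric])
    show "L ! 0 \<in> set_mset D" using L r by (metis nth_mem Suc_le_lessD One_nat_def)
    fix y assume "y \<in> set_mset D"
    then obtain i where "i < length L" "L ! i = y" using L by (metis in_set_conv_nth)
    then show "L ! 0 \<le> y" using L sorted_nth_mono[of L 0 i] by auto
  qed simp
  finally show ?thesis .
qed

text \<open>All quantities are read off the common Gram matrix G = X^T X = Y^T Y with least
  eigenvalue \<open>d\<close>. The nonzero eigenvalues of M^T M = Y (G Y^T) are those of (G Y^T) Y =
  G^2, the Gram matrix of the stacked factor is 2 G, and |M|^2 is the sum of the squared eigenvalues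
  of G.\<close>

lemma balanced_factor_spectrum:
  assumes r: "1 \<le> r" and X: "X \<in> carrier_mat n1 r" and Y: "Y \<in> carrier_mat n2 r"
    and M: "M = X * Y\<^sup>T" and rank: "vec_space.rank n1 M = r" and XY: "X\<^sup>T * X = Y\<^sup>T * Y"
  obtains d Q where "0 < d" "sing_val M r = d" "sing_val (X @\<^sub>r Y) r = sqrt (2 * d)"
    "real r * d\<^sup>2 \<le> (frob_norm M)\<^sup>2"
    "\<And>k B. B \<in> carrier_mat r k \<Longrightarrow>
       2 * d * frob_inner B B \<le> frob_inner ((X @\<^sub>r Y) * B) ((X @\<^sub>r Y) * B)"
    "Q \<in> carrier_mat n2 r" "Q\<^sup>T * Q = 1\<^sub>m r" "M * Q * Q\<^sup>T = M"
proof -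
  define G where "G = X\<^sup>T * X"
  have GY: "Y\<^sup>T * Y = G" using XY by (simp add: G_def)
  have G: "G \<in> carrier_mat r r" using X by (auto simp: G_def)
  have Gsym: "G\<^sup>T = G" unfolding G_def using X by (simp add: transpose_mult[of _ r n1 _ r])
  obtain P ds where P: "P \<in> carrier_mat r r" "P\<^sup>T * P = 1\<^sub>m r" and GP: "G = P * diag_fun r ds * P\<^sup>T"
    using real_symmetric_spectral[OF G Gsym] by blast
  have PP: "P * P\<^sup>T = 1\<^sub>m r" by (rule orthogonal_mat_commute[OF P])
  define X' where "X' = X * P"
  define Y' where "Y' = Y * P"
  have X': "X' \<in> carrier_mat n1 r" and Y': "Y' \<in> carrier_mat n2 r" using X Y P by (auto simp: X'_def Y'_def)
  have gram: "(A * P)\<^sup>T * (A * P) = diag_fun r ds" if "A \<in> carrier_mat n r" "A\<^sup>T * A = G" for A n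
  proof -
    have "(A * P)\<^sup>T * (A * P) = P\<^sup>T * (A\<^sup>T * A) * P"
      using that(1) P(1) by (simp add: transpose_mult[of _ n r _ r] assoc_mult_mat[of _ r r _ n _ r]
          assoc_mult_mat[of _ r n _ r _ r] assoc_mult_mat[of _ r r _ r _ r])
    also have "\<dots> = (P\<^sup>T * P) * diag_fun r ds * (P\<^sup>T * P)"
    proof -
      have "P\<^sup>T * (P * D * P\<^sup>T) * P = (P\<^sup>T * P) * D * (P\<^sup>T * P)" if "D \<in> carrier_mat r r" for D
        using that P(1) by (simp add: assoc_mult_mat[of _ r r _ r _ r])
      then show ?thesis unfolding that(2) GP by simp
    qed
    finally show ?thesis unfolding P(2) by simp
  qed
  have X'X': "X'\<^sup>T * X' = diag_fun r ds" unfolding X'_def by (rule gram[OF X]) (simp add: G_def)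
  have Y'Y': "Y'\<^sup>T * Y' = diag_fun r ds" unfolding Y'_def by (rule gram[OF Y GY])
  have MX': "M = X' * Y'\<^sup>T"
  proof -
    have "X' * Y'\<^sup>T = X * (P * P\<^sup>T) * Y\<^sup>T" unfolding X'_def Y'_def using X Y P(1)
      by (simp add: transpose_mult[of _ n2 r _ r] assoc_mult_mat[of _ n1 r _ r _ n2]
          assoc_mult_mat[of _ r r _ r _ n2] assoc_mult_mat[of _ n1 r _ r _ r])
    then show ?thesis unfolding PP using X M by simp
  qed
  have Mc: "M \<in> carrier_mat n1 n2" unfolding M using X Y by auto
  have col: "(\<Sum>l<n1. (X' $$ (l, i))\<^sup>2) = ds i" if i: "i < r" for i
  proof -
    have "(\<Sum>l<n1. (X' $$ (l, i))\<^sup>2) = (X'\<^sup>T * X') $$ (i, i)"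
      using X' i by (subst mult_mat_index_sum[of _ r n1 _ r]) (auto simp: power2_eq_square)
    then show ?thesis unfolding X'X' using i by simp
  qed
  \<comment> \<open>A zero eigenvalue kills a column of the rotated factor X', and M becomes a sum
    of r - 1 outer products, against its rank.\<close>
  have ds_pos: "0 < ds i" if i: "i < r" for i
  proof (rule ccontr)
    assume "\<not> 0 < ds i"
    moreover have "0 \<le> ds i" using col[OF i, symmetric] by (simp add: sum_nonneg)
    ultimately have "(\<Sum>l<n1. (X' $$ (l, i))\<^sup>2) = 0" using col[OF i] by simp
    then have z: "X' $$ (l, i) = 0" if "l < n1" for l
      using sum_nonneg_eq_0_iff[of "{..<n1}" "\<lambda>l. (X' $$ (l, i))\<^sup>2"] that by auto
    have "M = mat n1 n2 (\<lambda>(a, b). \<Sum>k\<in>{..<r} - {i}. X' $$ (a, k) * Y' $$ (b, k))"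
    proof (rule eq_matI)
      fix a b assume "a < dim_row (mat n1 n2 (\<lambda>(a, b). \<Sum>k\<in>{..<r} - {i}. X' $$ (a, k) * Y' $$ (b, k)))"
        "b < dim_col (mat n1 n2 (\<lambda>(a, b). \<Sum>k\<in>{..<r} - {i}. X' $$ (a, k) * Y' $$ (b, k)))"
      then have ab: "a < n1" "b < n2" by auto
      have "M $$ (a, b) = (\<Sum>k<r. X' $$ (a, k) * Y' $$ (b, k))"
        unfolding MX' using X' Y' ab by (subst mult_mat_index_sum[of _ n1 r _ n2]) auto
      also have "\<dots> = (\<Sum>k\<in>{..<r} - {i}. X' $$ (a, k) * Y' $$ (b, k))"
        using i z[OF ab(1)] by (intro sum.mono_neutral_right) auto
      finally show "M $$ (a, b) = mat n1 n2 (\<lambda>(a, b). \<Sum>k\<in>{..<r} - {i}. X' $$ (a, k) * Y' $$ (b, k)) $$ (a, b)"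
        using ab by simp
    qed (use Mc in auto)
    then have "vec_space.rank n1 M \<le> card ({..<r} - {i})"
      using rank_sum_outer_le[of "{..<r} - {i}" n1 n2 "\<lambda>a k. X' $$ (a, k)" "\<lambda>k b. Y' $$ (b, k)"] by simp
    then show False using rank i r by simp
  qed
  define d where "d = Min (ds ` {..<r})"
  have ne: "ds ` {..<r} \<noteq> {}" using r by (auto simp: lessThan_empty_iff)
  have d_le: "d \<le> ds i" if "i < r" for i unfolding d_def using that by (intro Min_le) auto
  have dpos: "0 < d" unfolding d_def using ds_pos ne by (subst Min_gr_iff) auto
  have "sing_val M r = d"
  proof -
    have MM: "M\<^sup>T * M = Y * (G * Y\<^sup>T)" unfolding M G_def using X Y
      by (simp add: transpose_mult[of _ n1 r _ n2] assoc_mult_mat[of _ n2 r _ n1 _ n2]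
          assoc_mult_mat[of _ r n1 _ r _ n2] assoc_mult_mat[of _ r n1 _ n1 _ n2])
    have c: "G * Y\<^sup>T \<in> carrier_mat r n2" using G Y by auto
    have GYY: "G * Y\<^sup>T * Y = G * G" using G Y GY by (simp add: assoc_mult_mat[of _ r r _ n2 _ r])
    have s1: "(Y * (G * Y\<^sup>T))\<^sup>T = Y * (G * Y\<^sup>T)" using G Y Gsym
      by (simp add: transpose_mult[of _ n2 r _ n2] transpose_mult[of _ r r _ n2] assoc_mult_mat[of _ n2 r _ r _ n2])
    have s2: "(G * Y\<^sup>T * Y)\<^sup>T = G * Y\<^sup>T * Y" unfolding GYY using G Gsym by (simp add: transpose_mult[of _ r r _ r])
    have GG: "G * G = P * diag_fun r (\<lambda>i. ds i * ds i) * P\<^sup>T"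
    proof -
      have "P * D * P\<^sup>T * (P * D * P\<^sup>T) = P * (D * (P\<^sup>T * P) * D) * P\<^sup>T" if "D \<in> carrier_mat r r" for D
        using that P(1) by (simp add: assoc_mult_mat[of _ r r _ r _ r])
      from this[OF diag_fun_carrier] show ?thesis unfolding GP P(2) by simp
    qed
    let ?D = "image_mset (\<lambda>i. ds i * ds i) (mset_set {..<r})"
    have D0: "count ?D 0 = 0" using ds_pos by (auto simp: count_eq_zero_iff) (metis less_irrefl)
    have eq: "proots (char_poly (M\<^sup>T * M)) + replicate_mset r 0 = replicate_mset n2 0 + ?D"
      using proots_char_poly_swap[OF Y c s1 s2]
      unfolding MM GYY unfolding GG proots_char_poly_spectral[OF P] .
    \<comment> \<open>Comparing the multiplicity of 0 on both sides: it is at least r on the left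
      and exactly n2 on the right, because all members of the second multiset are positive.\<close>
    have rn2: "r \<le> n2" using arg_cong[OF eq, of "\<lambda>m. count m 0"] D0 by simp
    from rn2 have "replicate_mset n2 (0::real) = replicate_mset (n2 - r) 0 + replicate_mset r 0"
      by (intro multiset_eqI) simp
    with eq have pr: "proots (char_poly (M\<^sup>T * M)) = replicate_mset (n2 - r) 0 + ?D"
      by (simp add: add.assoc add.commute add.left_commute)
    have "Min (set_mset ?D) = d\<^sup>2"
    proof (rule Min_eqI)
      obtain i where "i < r" "ds i = d" using Min_in[OF _ ne] unfolding d_def by auto
      then show "d\<^sup>2 \<in> set_mset ?D" by (auto simp: power2_eq_square)
      show "d\<^sup>2 \<le> y" if "y \<in> set_mset ?D" for y
        using that d_le dpos by (auto simp: power2_eq_square intro!: mult_mono order_trans[OF less_imp_le[OF dpos]])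
    qed simp
    then have "rev (sorted_list_of_multiset (proots (char_poly (M\<^sup>T * M)))) ! (r - 1) = d\<^sup>2"
      unfolding pr using r ds_pos by (subst rev_sorted_mset_nth) auto
    then show ?thesis unfolding sing_val_def using dpos by simp
  qed
  moreover have ZZ: "(X @\<^sub>r Y)\<^sup>T * (X @\<^sub>r Y) = P * diag_fun r (\<lambda>i. 2 * ds i) * P\<^sup>T"
  proof -
    have "(X @\<^sub>r Y)\<^sup>T * (X @\<^sub>r Y) = G + G" unfolding append_rows_gram[OF X Y X Y] GY G_def ..
    moreover have "P * D * P\<^sup>T + P * D * P\<^sup>T = P * (D + D) * P\<^sup>T" if "D \<in> carrier_mat r r" for D
      using that P(1) by (simp add: mult_add_distrib_mat[of _ r r _ r] add_mult_distrib_mat[of _ r r _ _ r])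
    moreover have "diag_fun r ds + diag_fun r ds = diag_fun r (\<lambda>i. 2 * ds i)" by (intro eq_matI) auto
    ultimately show ?thesis unfolding GP by (metis diag_fun_carrier)
  qed
  have "sing_val (X @\<^sub>r Y) r = sqrt (2 * d)"
  proof -
    let ?D = "image_mset (\<lambda>i. 2 * ds i) (mset_set {..<r})"
    have "Min (set_mset ?D) = 2 * d"
    proof (rule Min_eqI)
      obtain i where "i < r" "ds i = d" using Min_in[OF _ ne] unfolding d_def by auto
      then show "2 * d \<in> set_mset ?D" by auto
      show "2 * d \<le> y" if "y \<in> set_mset ?D" for y using that d_le by auto
    qed simp
    moreover have "rev (sorted_list_of_multiset (replicate_mset 0 0 + ?D)) ! (r - 1) = Min (set_mset ?D)"
      by (rule rev_sorted_mset_nth) (use r ds_pos in auto)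
    ultimately have "rev (sorted_list_of_multiset ?D) ! (r - 1) = 2 * d" by simp
    then show ?thesis unfolding sing_val_def ZZ proots_char_poly_spectral[OF P] by simp
  qed
  moreover have "real r * d\<^sup>2 \<le> (frob_norm M)\<^sup>2"
  proof -
    have "(frob_norm M)\<^sup>2 = frob_inner (diag_fun r ds) (diag_fun r ds)"
      unfolding frob_norm_square MX' frob_inner_outer[OF X' Y' X' Y'] X'X' Y'Y' ..
    also have "\<dots> = (\<Sum>i<r. \<Sum>j<r. if j = i then (ds i)\<^sup>2 else 0)"
      unfolding frob_inner_def by (intro sum.cong) (auto simp: power2_eq_square)
    also have "\<dots> = (\<Sum>i<r. (ds i)\<^sup>2)" by simp
    also have "\<dots> \<ge> (\<Sum>i<r. d\<^sup>2)" using d_le dpos by (intro sum_mono power_mono) auto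
    finally show ?thesis by simp
  qed
  moreover have "2 * d * frob_inner B B \<le> frob_inner ((X @\<^sub>r Y) * B) ((X @\<^sub>r Y) * B)"
    if B: "B \<in> carrier_mat r k" for k B
  proof -
    have Z: "X @\<^sub>r Y \<in> carrier_mat (n1 + n2) r" using X Y by auto
    have PB: "P\<^sup>T * B \<in> carrier_mat r k" using P B by auto
    have PT: "P\<^sup>T \<in> carrier_mat r r" "(P\<^sup>T)\<^sup>T * P\<^sup>T = 1\<^sub>m r" using P PP by auto
    have "frob_inner ((X @\<^sub>r Y) * B) ((X @\<^sub>r Y) * B) = frob_inner B ((X @\<^sub>r Y)\<^sup>T * ((X @\<^sub>r Y) * B))"
      using Z B by (intro frob_inner_mult_left[OF Z B]) auto
    also have "(X @\<^sub>r Y)\<^sup>T * ((X @\<^sub>r Y) * B) = (X @\<^sub>r Y)\<^sup>T * (X @\<^sub>r Y) * B"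
      using Z B by (intro assoc_mult_mat[symmetric, of _ r "n1 + n2" _ r]) auto
    also have "\<dots> = P * (diag_fun r (\<lambda>i. 2 * ds i) * (P\<^sup>T * B))"
    proof -
      have "P * D * P\<^sup>T * B = P * (D * (P\<^sup>T * B))" if "D \<in> carrier_mat r r" for D
        using that P(1) B by (simp add: assoc_mult_mat[of _ r r _ r _ k] assoc_mult_mat[of _ r r _ r _ r])
      then show ?thesis unfolding ZZ by simp
    qed
    also have "frob_inner B (P * (diag_fun r (\<lambda>i. 2 * ds i) * (P\<^sup>T * B))) =
        frob_inner (P\<^sup>T * B) (diag_fun r (\<lambda>i. 2 * ds i) * (P\<^sup>T * B))"
    proof -
      have c: "diag_fun r (\<lambda>i. 2 * ds i) * (P\<^sup>T * B) \<in> carrier_mat r k"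
        by (rule mult_carrier_mat[OF diag_fun_carrier PB])
      have "frob_inner B (P * (diag_fun r (\<lambda>i. 2 * ds i) * (P\<^sup>T * B))) =
        frob_inner (P * (diag_fun r (\<lambda>i. 2 * ds i) * (P\<^sup>T * B))) B"
        by (rule frob_inner_commute[OF B mult_carrier_mat[OF P(1) c]])
      also have "\<dots> = frob_inner (diag_fun r (\<lambda>i. 2 * ds i) * (P\<^sup>T * B)) (P\<^sup>T * B)"
        by (rule frob_inner_mult_left[OF P(1) c B])
      finally show ?thesis unfolding frob_inner_commute[OF c PB] .
    qed
    also have "\<dots> = (\<Sum>i<r. 2 * ds i * (\<Sum>j<k. ((P\<^sup>T * B) $$ (i, j))\<^sup>2))" by (rule frob_inner_diag_fun[OF PB])
    also have "\<dots> \<ge> (\<Sum>i<r. 2 * d * (\<Sum>j<k. ((P\<^sup>T * B) $$ (i, j))\<^sup>2))"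
      using d_le by (intro sum_mono mult_right_mono) (auto simp: sum_nonneg)
    also have "(\<Sum>i<r. 2 * d * (\<Sum>j<k. ((P\<^sup>T * B) $$ (i, j))\<^sup>2)) = 2 * d * frob_inner (P\<^sup>T * B) (P\<^sup>T * B)"
      unfolding frob_inner_def carrier_matD[OF PB]
      by (simp add: sum_distrib_left power2_eq_square del: index_mult_mat)
    also have "frob_inner (P\<^sup>T * B) (P\<^sup>T * B) = frob_inner B B" by (rule orthogonal_frob_inner[OF PT B B])
    finally show ?thesis .
  qed
  moreover
  \<comment> \<open>The inverse square root of the diagonalized G. The columns of Y' E form an
    orthonormal basis of the row space of M.\<close>
  define E where "E = diag_fun r (\<lambda>i. 1 / sqrt (ds i))"
  define Q where "Q = Y' * E"
  have E: "E \<in> carrier_mat r r" "E\<^sup>T = E" by (auto simp: E_def)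
  have Q: "Q \<in> carrier_mat n2 r" using Y' E by (auto simp: Q_def)
  have sq: "sqrt (ds i) * sqrt (ds i) = ds i" if "i < r" for i using ds_pos[OF that] by simp
  have ne0: "ds i \<noteq> 0" "0 \<le> ds i" if "i < r" for i using ds_pos[OF that] by auto
  have EDE: "E * diag_fun r ds * E = 1\<^sub>m r"
    unfolding E_def by (simp, intro eq_matI) (use sq ne0 in \<open>auto simp: field_simps\<close>)
  have DEE: "diag_fun r ds * E * E = 1\<^sub>m r"
    unfolding E_def by (simp, intro eq_matI) (use sq ne0 in \<open>auto simp: field_simps\<close>)
  have "Q\<^sup>T * Q = E * (Y'\<^sup>T * Y') * E"
    unfolding Q_def using Y' E by (simp add: transpose_mult[of _ n2 r _ r] assoc_mult_mat[of _ r r _ n2 _ r]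
        assoc_mult_mat[of _ r n2 _ r _ r] assoc_mult_mat[of _ r r _ r _ r])
  then have QQ: "Q\<^sup>T * Q = 1\<^sub>m r" unfolding Y'Y' EDE .
  have "M * Q * Q\<^sup>T = X' * ((Y'\<^sup>T * Y') * E * E) * Y'\<^sup>T"
    unfolding MX' Q_def using X' Y' E
    by (simp add: transpose_mult[of _ n2 r _ r] assoc_mult_mat[of _ n1 r _ n2 _ r]
        assoc_mult_mat[of _ n1 r _ r _ n2] assoc_mult_mat[of _ n1 r _ r _ r] assoc_mult_mat[of _ r n2 _ r _ r]
        assoc_mult_mat[of _ n2 r _ r _ r] assoc_mult_mat[of _ n2 r _ r _ n2]
        assoc_mult_mat[of _ r n2 _ r _ n2] assoc_mult_mat[of _ r r _ r _ n2] assoc_mult_mat[of _ r r _ r _ r])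
  then have "M * Q * Q\<^sup>T = M" unfolding Y'Y' DEE using X' MX' by simp
  ultimately show thesis using that[of d Q] dpos Q QQ by blast
qed

text \<open>With q the Frobenius error, the gap is at most 4 q^2 and the squared distance at most 4
  q^2 / d. The target (1/24)^2 * 2 d equals d / 288, so 1152 q^2 <= d^2 is needed, and 34 is the
  least integer whose square 1156 reaches 1152.\<close>

lemma spectral_factor_dist:
  assumes K: "K \<in> carrier_mat n1 n2" and svd: "is_trunc_svd r K CL Sig CR"
    and X: "X \<in> carrier_mat n1 r" and Y: "Y \<in> carrier_mat n2 r" and XY: "X\<^sup>T * X = Y\<^sup>T * Y"
    and d: "0 < d"
    and lb: "\<And>k B. B \<in> carrier_mat r k \<Longrightarrow>
       2 * d * frob_inner B B \<le> frob_inner ((X @\<^sub>r Y) * B) ((X @\<^sub>r Y) * B)"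
    and close: "34 * frob_norm (CL * Sig * CR\<^sup>T - X * Y\<^sup>T) \<le> d"
  shows "mat_dist ((CL * map_mat sqrt Sig) @\<^sub>r (CR * map_mat sqrt Sig)) (X @\<^sub>r Y) \<le> 1 / 24 * sqrt (2 * d)"
proof (rule trunc_svdE[OF K svd])
  assume CL: "CL \<in> carrier_mat n1 r" and CR: "CR \<in> carrier_mat n2 r" and Sig: "Sig \<in> carrier_mat r r"
    and CL1: "CL\<^sup>T * CL = 1\<^sub>m r" and CR1: "CR\<^sup>T * CR = 1\<^sub>m r"
    and nn: "\<And>i. i < r \<Longrightarrow> 0 \<le> Sig $$ (i, i)"
    and off: "\<And>i j. i < r \<Longrightarrow> j < r \<Longrightarrow> i \<noteq> j \<Longrightarrow> Sig $$ (i, j) = 0"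
  define T where "T = map_mat sqrt Sig"
  have Tdiag: "T = diag_fun r (\<lambda>i. sqrt (Sig $$ (i, i)))"
    unfolding T_def using Sig off by (intro eq_matI) auto
  have T: "T \<in> carrier_mat r r" "T\<^sup>T = T" unfolding Tdiag by auto
  have TT: "T * T = Sig"
    unfolding Tdiag using Sig off nn by (simp, intro eq_matI) auto
  have g: "(C * T)\<^sup>T * (C * T) = Sig" if "C \<in> carrier_mat n r" "C\<^sup>T * C = 1\<^sub>m r" for C n
  proof -
    have "(C * T)\<^sup>T * (C * T) = T * (C\<^sup>T * C) * T"
      using that(1) T by (simp add: transpose_mult[of _ n r _ r] assoc_mult_mat[of _ r r _ n _ r]
          assoc_mult_mat[of _ r n _ r _ r] assoc_mult_mat[of _ r r _ r _ r])
    then show ?thesis unfolding that(2) using T TT by simp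
  qed
  have U: "CL * T \<in> carrier_mat n1 r" and V: "CR * T \<in> carrier_mat n2 r" using CL CR T by auto
  have prod: "CL * T * (CR * T)\<^sup>T = CL * Sig * CR\<^sup>T"
    unfolding TT[symmetric] using CL CR T
    by (simp add: transpose_mult[of _ n2 r _ r] assoc_mult_mat[of _ n1 r _ r _ n2]
        assoc_mult_mat[of _ n1 r _ r _ r] assoc_mult_mat[of _ r r _ r _ n2])
  let ?W = "(CL * T) @\<^sub>r (CR * T)" and ?Z = "X @\<^sub>r Y"
  have W: "?W \<in> carrier_mat (n1 + n2) r" and Z: "?Z \<in> carrier_mat (n1 + n2) r"
    using U V X Y by auto
  define q where "q = frob_norm (CL * Sig * CR\<^sup>T - X * Y\<^sup>T)"
  have q: "0 \<le> q" "34 * q \<le> d" using close by (auto simp: q_def)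
  have gap: "gram_gap ?W ?Z \<le> 4 * q\<^sup>2"
    unfolding q_def prod[symmetric]
    by (rule balanced_gram_gap[OF U V X Y _ XY]) (simp add: g[OF CL CL1] g[OF CR CR1])
  have "(34 * q)\<^sup>2 \<le> d\<^sup>2" using q by (intro power_mono) auto
  then have q2: "1156 * q\<^sup>2 \<le> d\<^sup>2" by (simp add: power_mult_distrib)
  have d2: "0 < d\<^sup>2" using d by simp
  have lt: "gram_gap ?W ?Z < (2 * d)\<^sup>2"
  proof -
    have "gram_gap ?W ?Z < 4 * d\<^sup>2" using gap q2 d2 by linarith
    then show ?thesis by (simp add: power_mult_distrib)
  qed
  have "mat_dist ?W ?Z \<le> sqrt (2 * gram_gap ?W ?Z / (2 * d))"
    using d by (intro mat_dist_gram_gap[OF W Z _ lb lt]) auto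
  also have "\<dots> \<le> sqrt ((1 / 24)\<^sup>2 * (2 * d))"
  proof (rule real_sqrt_le_mono)
    have "gram_gap ?W ?Z \<le> d * (d / 288)" using gap q2 d2 by (simp add: power2_eq_square)
    then show "2 * gram_gap ?W ?Z / (2 * d) \<le> (1 / 24)\<^sup>2 * (2 * d)"
      using d by (simp add: field_simps power2_eq_square)
  qed
  also have "\<dots> = 1 / 24 * sqrt (2 * d)" by (simp add: real_sqrt_mult)
  finally show ?thesis unfolding T_def .
qed

section \<open>Linear forms in Gaussian variables\<close>

definition gauss :: "real measure" where
  "gauss = density lborel std_normal_density"

lemma prob_space_gauss: "prob_space gauss"
  unfolding gauss_def by (rule prob_space_normal_density) simp

lemma sets_gauss [simp, measurable_cong]: "sets gauss = sets borel"
  and space_gauss [simp]: "space gauss = UNIV"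
  by (simp_all add: gauss_def)

lemma product_prob_space_gauss: "product_prob_space (\<lambda>_. gauss)"
  by (simp add: product_prob_space_def product_sigma_finite_def product_prob_space_axioms_def
      prob_space_gauss prob_space_imp_sigma_finite)

lemma prob_space_PiM_gauss: "prob_space (PiM D (\<lambda>_. gauss))"
  by (intro prob_space_PiM prob_space_gauss)

lemma distributed_gauss_component:
  assumes "d \<in> D"
  shows "distributed (PiM D (\<lambda>_. gauss)) lborel (\<lambda>x. x d) std_normal_density"
proof -
  interpret product_prob_space "\<lambda>_. gauss" D by (rule product_prob_space_gauss)
  have "distr (PiM D (\<lambda>_. gauss)) lborel (\<lambda>x. x d) = distr (PiM D (\<lambda>_. gauss)) gauss (\<lambda>x. x d)"
    by (intro distr_cong) auto
  also have "\<dots> = gauss" by (rule PiM_component[OF assms])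
  finally show ?thesis unfolding distributed_def using assms
    by (auto simp: gauss_def intro!: measurable_compose[OF measurable_component_singleton])
qed

lemma indep_vars_gauss_components:
  assumes "D' \<subseteq> D" and ne: "D \<noteq> {}"
  shows "prob_space.indep_vars (PiM D (\<lambda>_. gauss)) (\<lambda>_. borel) (\<lambda>d x. x d) D'"
proof -
  interpret product_prob_space "\<lambda>_. gauss" D by (rule product_prob_space_gauss)
    have "distr (PiM D (\<lambda>_. gauss)) (PiM D (\<lambda>_. borel)) (\<lambda>x. \<lambda>d\<in>D. x d) =
        distr (PiM D (\<lambda>_. gauss)) (PiM D (\<lambda>_. gauss)) (\<lambda>x. x)"
      by (intro distr_cong sets_PiM_cong) (auto simp: space_PiM restrict_PiE_iff PiE_restrict)
    also have "\<dots> = PiM D (\<lambda>_. gauss)" by (rule distr_id)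
    also have "\<dots> = PiM D (\<lambda>d. distr (PiM D (\<lambda>_. gauss)) borel (\<lambda>x. x d))"
    proof (intro PiM_cong refl)
      fix d assume d: "d \<in> D"
      have "gauss = distr (PiM D (\<lambda>_. gauss)) gauss (\<lambda>x. x d)" by (rule PiM_component[OF d, symmetric])
      also have "\<dots> = distr (PiM D (\<lambda>_. gauss)) borel (\<lambda>x. x d)" by (intro distr_cong) auto
      finally show "gauss = distr (PiM D (\<lambda>_. gauss)) borel (\<lambda>x. x d)" .
    qed
    finally have "P.indep_vars (\<lambda>_. borel) (\<lambda>d x. x d) D"
      by (subst P.indep_vars_iff_distr_eq_PiM'[OF ne]) auto
  then show ?thesis by (rule P.indep_vars_subset[OF _ assms(1)])
qed

text \<open>Indices with coefficient 0 are removed before summing, since the rule for sums of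
  independent normals asks for positive deviations; 0 < s keeps the remaining index set
  nonempty.\<close>

lemma distributed_gauss_linear:
  assumes D: "finite D" and s: "0 < s" "(\<Sum>d\<in>D. (a d)\<^sup>2) = s\<^sup>2"
  shows "distributed (PiM D (\<lambda>_. gauss)) lborel (\<lambda>x. \<Sum>d\<in>D. a d * x d) (normal_density 0 s)"
proof -
  interpret prob_space "PiM D (\<lambda>_. gauss)" by (rule prob_space_PiM_gauss)
  define D' where "D' = {d \<in> D. a d \<noteq> 0}"
  have D': "finite D'" "D' \<subseteq> D" using D by (auto simp: D'_def)
  have sq: "(\<Sum>d\<in>D'. (a d)\<^sup>2) = s\<^sup>2"
    unfolding s(2)[symmetric] D'_def using D by (intro sum.mono_neutral_left) auto
  have ne: "D' \<noteq> {}" using sq s(1) by auto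
  have ind: "indep_vars (\<lambda>_. borel) (\<lambda>d x. a d * x d) D'"
    by (rule indep_vars_compose2[OF indep_vars_gauss_components[OF D'(2)]]) (use ne D' in auto)
  have nd: "distributed (PiM D (\<lambda>_. gauss)) lborel (\<lambda>x. a d * x d) (normal_density 0 \<bar>a d\<bar>)"
    if "d \<in> D'" for d
    using normal_density_affine[OF distributed_gauss_component[of d D], where \<alpha> = "a d" and \<beta> = 0] that
    by (simp add: D'_def)
  have "distributed (PiM D (\<lambda>_. gauss)) lborel (\<lambda>x. \<Sum>d\<in>D'. a d * x d)
      (normal_density (\<Sum>d\<in>D'. 0) (sqrt (\<Sum>d\<in>D'. \<bar>a d\<bar>\<^sup>2)))"
    using nd by (intro sum_indep_normal[OF D'(1) ne ind]) (auto simp: D'_def)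
  moreover have "(\<Sum>d\<in>D'. a d * x d) = (\<Sum>d\<in>D. a d * x d)" for x
    unfolding D'_def using D by (intro sum.mono_neutral_left) auto
  ultimately show ?thesis using sq s(1) by simp
qed

text \<open>Both sides are the joint density of two standard normals with correlation p, factored
  through either conditional law.\<close>

lemma normal_density_exchange:
  assumes q: "0 < q" and pq: "p\<^sup>2 + q\<^sup>2 = 1"
  shows "std_normal_density y * normal_density (p * y) q z = std_normal_density z * normal_density (p * z) q y"
proof -
  have p2: "p\<^sup>2 = 1 - q\<^sup>2" using pq by simp
  have "y\<^sup>2 * q\<^sup>2 + (z - p * y)\<^sup>2 = z\<^sup>2 * q\<^sup>2 + (y - p * z)\<^sup>2"
    by (simp add: power2_diff power_mult_distrib p2 algebra_simps)
  then have "- y\<^sup>2 / 2 + - (z - p * y)\<^sup>2 / (2 * q\<^sup>2) = - z\<^sup>2 / 2 + - (y - p * z)\<^sup>2 / (2 * q\<^sup>2)"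
    using q by (simp add: field_simps)
  then have "exp (- y\<^sup>2 / 2) * exp (- (z - p * y)\<^sup>2 / (2 * q\<^sup>2)) = exp (- z\<^sup>2 / 2) * exp (- (y - p * z)\<^sup>2 / (2 * q\<^sup>2))"
    by (simp add: exp_add[symmetric])
  then show ?thesis by (simp add: normal_density_def)
qed

lemma integrable_abs_std_normal: "integrable lborel (\<lambda>y. std_normal_density y * \<bar>y\<bar>)"
  using integrable_std_normal_moment_abs[of 1] by simp

lemma integral_gauss:
  fixes f :: "real \<Rightarrow> real"
  assumes [measurable]: "f \<in> borel_measurable borel"
  shows "(\<integral>x. f x \<partial>gauss) = (\<integral>x. std_normal_density x * f x \<partial>lborel)"
  unfolding gauss_def by (subst integral_density) auto

text \<open>The regression formula E[x_j | g] = a_j g for the unit linear form g, integrated against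
  a bounded function of g. Integrating out the other coordinates leaves g normal with mean p u given
  x_j = u; Fubini and \<open>normal_density_exchange\<close> then swap the roles and the inner
  integral becomes the mean p z of x_j given g = z.\<close>

lemma gauss_correlated_moment:
  fixes \<phi> :: "real \<Rightarrow> real"
  assumes D: "finite D" and j: "j \<in> D" and a: "(\<Sum>d\<in>D. (a d)\<^sup>2) = 1"
    and \<phi>[measurable]: "\<phi> \<in> borel_measurable borel" and bound: "\<And>y. \<bar>\<phi> y\<bar> \<le> C"
  shows "(\<integral>x. \<phi> (\<Sum>d\<in>D. a d * x d) * x j \<partial>PiM D (\<lambda>_. gauss)) =
    a j * (\<integral>y. std_normal_density y * (\<phi> y * y) \<partial>lborel)"
proof -
  interpret product_prob_space "\<lambda>_. gauss" D by (rule product_prob_space_gauss)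
  define J where "J = D - {j}"
  have J: "finite J" "j \<notin> J" "{j} \<inter> J = {}" "D = {j} \<union> J" "insert j J = D" using D j by (auto simp: J_def)
  have C: "0 \<le> C" using bound[of 0] by linarith
  have meas: "(\<lambda>x. \<phi> (\<Sum>d\<in>D. a d * x d) * x j) \<in> borel_measurable (PiM D (\<lambda>_. gauss))"
    using j by measurable
  have ij: "integrable (PiM D (\<lambda>_. gauss)) (\<lambda>x. \<bar>x j\<bar>)"
    using distributed_integrable[OF distributed_gauss_component[OF j], of "\<lambda>y. \<bar>y\<bar>"] integrable_abs_std_normal
    by simp
  have int: "integrable (PiM D (\<lambda>_. gauss)) (\<lambda>x. \<phi> (\<Sum>d\<in>D. a d * x d) * x j)"
  proof (rule Bochner_Integration.integrable_bound)
    show "integrable (PiM D (\<lambda>_. gauss)) (\<lambda>x. C * \<bar>x j\<bar>)" using ij by simp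
    show "AE x in PiM D (\<lambda>_. gauss). norm (\<phi> (\<Sum>d\<in>D. a d * x d) * x j) \<le> norm (C * \<bar>x j\<bar>)"
      using bound C by (intro AE_I2) (auto simp: abs_mult intro: mult_right_mono)
  qed (rule meas)
  define p where "p = a j"
  have pq: "p\<^sup>2 + (\<Sum>d\<in>J. (a d)\<^sup>2) = 1"
    using a sum.insert[OF J(1,2), of "\<lambda>d. (a d)\<^sup>2"] unfolding J(5) p_def by simp
  have fold: "(\<integral>x. \<phi> (\<Sum>d\<in>D. a d * x d) * x j \<partial>PiM D (\<lambda>_. gauss)) =
      (\<integral>u. (\<integral>y. \<phi> (p * u + (\<Sum>d\<in>J. a d * y d)) * u \<partial>PiM J (\<lambda>_. gauss)) \<partial>gauss)"
  proof -
    have "(\<integral>x. \<phi> (\<Sum>d\<in>D. a d * x d) * x j \<partial>PiM D (\<lambda>_. gauss)) =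
      (\<integral>x. (\<integral>y. \<phi> (\<Sum>d\<in>D. a d * merge {j} J (x, y) d) * merge {j} J (x, y) j \<partial>PiM J (\<lambda>_. gauss)) \<partial>PiM {j} (\<lambda>_. gauss))"
      using product_integral_fold[OF J(3) _ J(1), of "\<lambda>x. \<phi> (\<Sum>d\<in>D. a d * x d) * x j"] int
      unfolding J(4)[symmetric] by simp
    also have "\<dots> = (\<integral>x. (\<integral>y. \<phi> (p * x j + (\<Sum>d\<in>J. a d * y d)) * x j \<partial>PiM J (\<lambda>_. gauss)) \<partial>PiM {j} (\<lambda>_. gauss))"
    proof -
      have "(\<Sum>d\<in>D. a d * merge {j} J (x, y) d) = p * x j + (\<Sum>d\<in>J. a d * y d)" for x y
      proof -
        have "(\<Sum>d\<in>J. a d * merge {j} J (x, y) d) = (\<Sum>d\<in>J. a d * y d)"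
          using J(2) by (intro sum.cong) (auto simp: merge_def)
        then show ?thesis unfolding J(5)[symmetric] using J(1,2) by (simp add: p_def merge_def)
      qed
      moreover have "(merge {j} J (x, y) j :: real) = x j" for x y by (simp add: merge_def)
      ultimately show ?thesis by (simp only:)
    qed
    also have "\<dots> = (\<integral>u. (\<integral>y. \<phi> (p * u + (\<Sum>d\<in>J. a d * y d)) * u \<partial>PiM J (\<lambda>_. gauss)) \<partial>gauss)"
    proof -
      interpret PJ: prob_space "PiM J (\<lambda>_. gauss)" by (rule prob_space_PiM_gauss)
      have m: "(\<lambda>u. \<integral>y. \<phi> (p * u + (\<Sum>d\<in>J. a d * y d)) * u \<partial>PiM J (\<lambda>_. gauss)) \<in> borel_measurable gauss"
        by measurable
      show ?thesis using product_integral_singleton[OF m, of j] by simp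
    qed
    finally show ?thesis .
  qed
  show ?thesis
  proof (cases "(\<Sum>d\<in>J. (a d)\<^sup>2) = 0")
    \<comment> \<open>All weight sits on coordinate j. The conditional law of the form is then
      degenerate and has no density, but the form is x_j or -x_j and a reflection settles
      it.\<close>
    case True
    then have "\<forall>d\<in>J. a d = 0" using J(1) by (simp add: sum_nonneg_eq_0_iff)
    then have z: "(\<Sum>d\<in>J. a d * y d) = 0" for y by simp
    interpret PJ: prob_space "PiM J (\<lambda>_. gauss)" by (rule prob_space_PiM_gauss)
    have "(\<integral>x. \<phi> (\<Sum>d\<in>D. a d * x d) * x j \<partial>PiM D (\<lambda>_. gauss)) = (\<integral>u. std_normal_density u * (\<phi> (p * u) * u) \<partial>lborel)"
      unfolding fold z by (simp add: PJ.prob_space integral_gauss)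
    also have "\<dots> = p * (\<integral>y. std_normal_density y * (\<phi> y * y) \<partial>lborel)"
    proof -
      have "p = 1 \<or> p = -1" using pq True by (simp add: power2_eq_1_iff)
      then show ?thesis
      proof
        assume "p = -1"
        then show ?thesis
          using lborel_integral_real_affine[of "-1" "\<lambda>y. std_normal_density y * (\<phi> y * y)" 0]
          by (simp add: std_normal_density_def)
      qed simp
    qed
    finally show ?thesis by (simp add: p_def)
  next
    case False
    define q where "q = sqrt (\<Sum>d\<in>J. (a d)\<^sup>2)"
    have q: "0 < q" "(\<Sum>d\<in>J. (a d)\<^sup>2) = q\<^sup>2"
      using False sum_nonneg[of J "\<lambda>d. (a d)\<^sup>2"] by (auto simp: q_def less_le)
    have pq: "p\<^sup>2 + q\<^sup>2 = 1" using pq q by simp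
    interpret PJ: prob_space "PiM J (\<lambda>_. gauss)" by (rule prob_space_PiM_gauss)
    have inner: "(\<integral>y. \<phi> (p * u + (\<Sum>d\<in>J. a d * y d)) * u \<partial>PiM J (\<lambda>_. gauss)) =
        u * (\<integral>z. normal_density (p * u) q z * \<phi> z \<partial>lborel)" for u
    proof -
      have "distributed (PiM J (\<lambda>_. gauss)) lborel (\<lambda>y. p * u + (\<Sum>d\<in>J. a d * y d)) (normal_density (p * u) q)"
        using PJ.normal_density_affine[OF distributed_gauss_linear[OF J(1) q], of 1 "p * u"] q by simp
      from distributed_integral[OF this, of \<phi>] show ?thesis by (simp add: mult.commute)
    qed
    \<comment> \<open>The bound C for \<open>\<phi>\<close> leaves C |u| times the standard density
      after integrating in z, which is integrable in u.\<close>
    have F: "integrable (lborel \<Otimes>\<^sub>M lborel)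
        (\<lambda>(u, z). std_normal_density u * u * (normal_density (p * u) q z * \<phi> z))"
    proof (rule lborel_pair.Fubini_integrable)
      show "(\<lambda>(u, z). std_normal_density u * u * (normal_density (p * u) q z * \<phi> z))
          \<in> borel_measurable (lborel \<Otimes>\<^sub>M lborel)"
        unfolding normal_density_def by measurable
      have iz: "integrable lborel (\<lambda>z. normal_density (p * u) q z * \<phi> z)" for u
      proof (rule Bochner_Integration.integrable_bound)
        show "integrable lborel (\<lambda>z. normal_density (p * u) q z * C)" using q by simp
      qed (use bound C in \<open>auto simp: abs_mult intro!: mult_left_mono\<close>)
      have iza: "integrable lborel (\<lambda>z. normal_density (p * u) q z * \<bar>\<phi> z\<bar>)" for u
        using integrable_abs[OF iz[of u]] by (simp add: abs_mult)
      show "AE u in lborel. integrable lborel (\<lambda>z. case (u, z) of (u, z) \<Rightarrow>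
          std_normal_density u * u * (normal_density (p * u) q z * \<phi> z))"
        using iz by simp
      have le: "(\<integral>z. norm (std_normal_density u * u * (normal_density (p * u) q z * \<phi> z)) \<partial>lborel)
          \<le> std_normal_density u * \<bar>u\<bar> * C" for u
      proof -
        have "(\<integral>z. norm (std_normal_density u * u * (normal_density (p * u) q z * \<phi> z)) \<partial>lborel) \<le>
            (\<integral>z. std_normal_density u * \<bar>u\<bar> * (normal_density (p * u) q z * C) \<partial>lborel)"
          using iz[of u] iza[of u] q bound by (intro integral_mono) (auto simp: abs_mult intro!: mult_left_mono)
        also have "\<dots> = std_normal_density u * \<bar>u\<bar> * C" using q by simp
        finally show ?thesis .
      qed
      show "integrable lborel (\<lambda>u. \<integral>z. norm (case (u, z) of (u, z) \<Rightarrow>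
          std_normal_density u * u * (normal_density (p * u) q z * \<phi> z)) \<partial>lborel)"
      proof (rule Bochner_Integration.integrable_bound)
        show "integrable lborel (\<lambda>u. std_normal_density u * \<bar>u\<bar> * C)" using integrable_abs_std_normal by simp
        show "(\<lambda>u. \<integral>z. norm (case (u, z) of (u, z) \<Rightarrow>
          std_normal_density u * u * (normal_density (p * u) q z * \<phi> z)) \<partial>lborel) \<in> borel_measurable lborel"
          unfolding normal_density_def by measurable
        show "AE u in lborel. norm (\<integral>z. norm (case (u, z) of (u, z) \<Rightarrow>
          std_normal_density u * u * (normal_density (p * u) q z * \<phi> z)) \<partial>lborel) \<le> norm (std_normal_density u * \<bar>u\<bar> * C)"
          using le C by (intro AE_I2) (auto intro: order_trans simp: abs_mult integral_nonneg_AE)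
      qed
    qed
    have "(\<integral>x. \<phi> (\<Sum>d\<in>D. a d * x d) * x j \<partial>PiM D (\<lambda>_. gauss)) =
        (\<integral>u. std_normal_density u * (u * (\<integral>z. normal_density (p * u) q z * \<phi> z \<partial>lborel)) \<partial>lborel)"
      unfolding fold inner by (rule integral_gauss) (unfold normal_density_def, measurable)
    also have "\<dots> = (\<integral>u. (\<integral>z. std_normal_density u * u * (normal_density (p * u) q z * \<phi> z) \<partial>lborel) \<partial>lborel)"
      by (simp add: mult.assoc)
    also have "\<dots> = (\<integral>z. (\<integral>u. std_normal_density u * u * (normal_density (p * u) q z * \<phi> z) \<partial>lborel) \<partial>lborel)"
      by (rule lborel_pair.Fubini_integral[OF F, symmetric])
    also have "\<dots> = (\<integral>z. (\<integral>u. (std_normal_density z * \<phi> z) * (normal_density (p * z) q u * u) \<partial>lborel) \<partial>lborel)"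
    proof -
      have "std_normal_density u * u * (normal_density (p * u) q z * \<phi> z) =
          (std_normal_density z * \<phi> z) * (normal_density (p * z) q u * u)" for u z
        using arg_cong[OF normal_density_exchange[OF q(1) pq, of u z], of "\<lambda>x. x * u * \<phi> z"]
        by (simp add: mult_ac)
      then show ?thesis by (simp only:)
    qed
    also have "\<dots> = (\<integral>z. (std_normal_density z * \<phi> z) * (p * z) \<partial>lborel)"
      using q by (simp add: integral_normal_moment_nz_1)
    also have "\<dots> = p * (\<integral>y. std_normal_density y * (\<phi> y * y) \<partial>lborel)"
      by (subst integral_mult_right_zero[symmetric]) (simp add: mult_ac)
    finally show ?thesis by (simp add: p_def)
  qed
qed

section \<open>Truncated second moment and small-ball estimates\<close>

definition trunc_moment :: "real \<Rightarrow> real" where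
  "trunc_moment t = (\<integral>y. std_normal_density y * (y\<^sup>2 * of_bool (\<bar>y\<bar> \<le> t)) \<partial>lborel)"

lemma integrable_std_normal_square: "integrable lborel (\<lambda>y. std_normal_density y * y\<^sup>2)"
  using integrable_std_normal_moment[of 2] by simp

lemma integral_std_normal_square: "(\<integral>y. std_normal_density y * y\<^sup>2 \<partial>lborel) = 1"
  using integral_std_normal_moment_even[of 1] by simp

lemma integrable_trunc_moment: "integrable lborel (\<lambda>y. std_normal_density y * (y\<^sup>2 * of_bool (\<bar>y\<bar> \<le> t)))"
  by (rule Bochner_Integration.integrable_bound[OF integrable_std_normal_square]) (auto simp: of_bool_def)

text \<open>Monotonicity turns a lower bound for the random threshold into an upper bound for the
  truncation bias; it also gives measurability for free.\<close>

lemma trunc_moment_mono: "s \<le> t \<Longrightarrow> trunc_moment s \<le> trunc_moment t"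
  unfolding trunc_moment_def
  by (intro integral_mono integrable_trunc_moment) (auto simp: of_bool_def)

lemma trunc_moment_le_1: "trunc_moment t \<le> 1"
proof -
  have "trunc_moment t \<le> (\<integral>y. std_normal_density y * y\<^sup>2 \<partial>lborel)" unfolding trunc_moment_def
    by (intro integral_mono integrable_trunc_moment integrable_std_normal_square) (auto simp: of_bool_def)
  then show ?thesis by (simp add: integral_std_normal_square)
qed

lemma trunc_moment_nonneg: "0 \<le> trunc_moment t"
  unfolding trunc_moment_def by (intro integral_nonneg_AE) auto

lemma borel_measurable_trunc_moment [measurable]: "trunc_moment \<in> borel_measurable borel"
  by (intro borel_measurable_mono monoI trunc_moment_mono)

text \<open>The boundary term at infinity in the integration behind the tail estimate.\<close>

lemma std_normal_density_tendsto: "((\<lambda>y. - y * std_normal_density y) \<longlongrightarrow> 0) at_top"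
proof (rule tendsto_sandwich[of "\<lambda>y. - (2 / y)" _ _ "\<lambda>_. 0"])
  have "\<forall>\<^sub>F y in at_top. (1::real) \<le> y" by (rule eventually_ge_at_top)
  then show "\<forall>\<^sub>F y in at_top. - (2 / y) \<le> - y * std_normal_density y"
  proof eventually_elim
    case (elim y)
    have "y\<^sup>2 / 2 \<le> exp (y\<^sup>2 / 2)" using exp_ge_add_one_self[of "y\<^sup>2 / 2"] by linarith
    then have e: "y * exp (- (y\<^sup>2 / 2)) \<le> 2 / y"
      using elim by (simp add: exp_minus field_simps power2_eq_square)
    have "1 / sqrt (2 * pi) \<le> 1" using pi_gt3 by (simp add: real_le_rsqrt)
    then have "1 / sqrt (2 * pi) * (y * exp (- (y\<^sup>2 / 2))) \<le> 1 * (2 / y)"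
      using e elim by (intro mult_mono) auto
    then show ?case by (simp add: std_normal_density_def)
  qed
  show "\<forall>\<^sub>F y in at_top. - y * std_normal_density y \<le> 0"
    using eventually_ge_at_top[of 0] by eventually_elim simp
  have "((\<lambda>y::real. inverse y) \<longlongrightarrow> 0) at_top" by (rule tendsto_inverse_0_at_top[OF filterlim_ident])
  from tendsto_minus[OF tendsto_mult_right[OF this, of 2]]
  show "((\<lambda>y::real. - (2 / y)) \<longlongrightarrow> 0) at_top" by (simp add: divide_inverse mult.commute)
qed simp

text \<open>The function -y times the density has derivative (y^2 - 1) times the density, so that
  integral over a tail is explicit. For y >= 3 the missing part costs a factor 9/8, as y^2 <= 9/8
  (y^2 - 1), and the two tails double it to 9/4.\<close>

lemma trunc_moment_tail:
  assumes t: "3 \<le> t"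
  shows "1 - trunc_moment t \<le> 9 / 4 * t * std_normal_density t"
proof -
  let ?n = std_normal_density
  have deriv: "((\<lambda>y. - y * ?n y) has_real_derivative (y\<^sup>2 - 1) * ?n y) (at y)" for y
  proof -
    have "((\<lambda>y. - y * (c * exp (- y\<^sup>2 / 2))) has_real_derivative (y\<^sup>2 - 1) * (c * exp (- y\<^sup>2 / 2))) (at y)" for c
      by (auto intro!: derivative_eq_intros simp: power2_eq_square algebra_simps)
    then show ?thesis unfolding std_normal_density_def .
  qed
  have F: "(\<integral>\<^sup>+y. ennreal ((y\<^sup>2 - 1) * ?n y) * indicator {t..} y \<partial>lborel) = 0 - (- t * ?n t)"
  proof (rule nn_integral_FTC_atLeast)
    show "((\<lambda>y. - y * ?n y) has_real_derivative (y\<^sup>2 - 1) * ?n y) (at y)" for y by (rule deriv)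
    show "0 \<le> (y\<^sup>2 - 1) * ?n y" if "t \<le> y" for y
    proof -
      have "1 \<le> y\<^sup>2" using that t one_le_power[of y 2] by simp
      then show ?thesis by simp
    qed
    show "((\<lambda>y. - y * ?n y) \<longlongrightarrow> 0) at_top" by (rule std_normal_density_tendsto)
  qed simp
  have half: "(\<integral>\<^sup>+y. ennreal (?n y * y\<^sup>2) * indicator {t..} y \<partial>lborel) \<le> ennreal (9 / 8 * (t * ?n t))"
  proof -
    have "(\<integral>\<^sup>+y. ennreal (?n y * y\<^sup>2) * indicator {t..} y \<partial>lborel) \<le>
        (\<integral>\<^sup>+y. ennreal (9 / 8) * (ennreal ((y\<^sup>2 - 1) * ?n y) * indicator {t..} y) \<partial>lborel)"
    proof (intro nn_integral_mono)
      fix y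
      show "ennreal (?n y * y\<^sup>2) * indicator {t..} y \<le>
          ennreal (9 / 8) * (ennreal ((y\<^sup>2 - 1) * ?n y) * indicator {t..} y)"
      proof (cases "t \<le> y")
        case True
        have "3\<^sup>2 \<le> y\<^sup>2" using True t by (intro power_mono) auto
        then have y: "y\<^sup>2 \<le> 9 / 8 * (y\<^sup>2 - 1)" "0 \<le> y\<^sup>2 - 1" by auto
        then have "?n y * y\<^sup>2 \<le> ?n y * (9 / 8 * (y\<^sup>2 - 1))" by (intro mult_left_mono) auto
        then show ?thesis using True y
          by (simp add: ennreal_mult[symmetric] ennreal_leI mult_ac)
      qed simp
    qed
    also have "\<dots> = ennreal (9 / 8) * ennreal (t * ?n t)"
      using F by (subst nn_integral_cmult) auto
    finally show ?thesis using t by (simp add: ennreal_mult[symmetric])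
  qed
  have neg: "(\<integral>\<^sup>+y. ennreal (?n y * y\<^sup>2) * indicator {..-t} y \<partial>lborel) =
      (\<integral>\<^sup>+y. ennreal (?n y * y\<^sup>2) * indicator {t..} y \<partial>lborel)"
    by (subst nn_integral_real_affine[of _ "-1" 0])
      (auto intro!: nn_integral_cong simp: indicator_def std_normal_density_def)
  have "ennreal (1 - trunc_moment t) = ennreal (\<integral>y. ?n y * y\<^sup>2 - ?n y * (y\<^sup>2 * of_bool (\<bar>y\<bar> \<le> t)) \<partial>lborel)"
    unfolding trunc_moment_def
    by (simp add: integrable_std_normal_square integrable_trunc_moment integral_std_normal_square)
  also have "\<dots> = (\<integral>\<^sup>+y. ennreal (?n y * y\<^sup>2 - ?n y * (y\<^sup>2 * of_bool (\<bar>y\<bar> \<le> t))) \<partial>lborel)"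
    using integrable_std_normal_square integrable_trunc_moment
    by (intro nn_integral_eq_integral[symmetric]) (auto simp: of_bool_def)
  also have "\<dots> \<le> (\<integral>\<^sup>+y. ennreal (?n y * y\<^sup>2) * indicator {t..} y + ennreal (?n y * y\<^sup>2) * indicator {..-t} y \<partial>lborel)"
    by (intro nn_integral_mono) (auto simp: indicator_def of_bool_def)
  also have "\<dots> = 2 * (\<integral>\<^sup>+y. ennreal (?n y * y\<^sup>2) * indicator {t..} y \<partial>lborel)"
    by (subst nn_integral_add) (auto simp: neg mult_2)
  also have "\<dots> \<le> 2 * ennreal (9 / 8 * (t * ?n t))" by (intro mult_left_mono half) auto
  also have "\<dots> = ennreal (9 / 4 * t * ?n t)"
    using t by (simp add: ennreal_mult[symmetric] flip: ennreal_numeral)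
  finally show ?thesis using t by (simp add: ennreal_le_iff)
qed

text \<open>The margin below 1/2 has to pay for a sampling error of 0.003 and an outlier fraction of
  1/400 in the median bound. The density is bounded by a quartic polynomial with an explicit
  primitive.\<close>

lemma gauss_small_ball: "measure gauss {y. \<bar>y\<bar> \<le> 66 / 100} \<le> 494 / 1000"
proof -
  let ?a = "66 / 100 :: real"
  have "emeasure gauss {y. \<bar>y\<bar> \<le> ?a} = (\<integral>\<^sup>+y. ennreal (std_normal_density y) * indicator {-?a..?a} y \<partial>lborel)"
    unfolding gauss_def by (subst emeasure_density) (auto intro!: nn_integral_cong simp: indicator_def abs_le_iff)
  also have "\<dots> \<le> (\<integral>\<^sup>+y. ennreal (1 / sqrt (2 * pi) * (1 - y\<^sup>2 / 2 + y^4 / 4)) * indicator {-?a..?a} y \<partial>lborel)"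
  proof (intro nn_integral_mono mult_right_mono ennreal_leI)
    fix y :: real
    have "exp (- y\<^sup>2 / 2) \<le> 1 + (- y\<^sup>2 / 2) + (- y\<^sup>2 / 2)\<^sup>2" by (rule exp_le_quadratic_neg) simp
    also have "\<dots> = 1 - y\<^sup>2 / 2 + y^4 / 4" by (simp add: power2_eq_square power4_eq_xxxx)
    finally show "std_normal_density y \<le> 1 / sqrt (2 * pi) * (1 - y\<^sup>2 / 2 + y^4 / 4)"
      unfolding std_normal_density_def by (intro mult_left_mono) auto
  qed simp
  also have "\<dots> = ennreal (1 / sqrt (2 * pi) * (?a - ?a^3 / 6 + ?a^5 / 20) - 1 / sqrt (2 * pi) * (- ?a - (- ?a)^3 / 6 + (- ?a)^5 / 20))"
  proof (rule nn_integral_FTC_Icc)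
    fix y :: real
    show "((\<lambda>y. 1 / sqrt (2 * pi) * (y - y^3 / 6 + y^5 / 20)) has_real_derivative
        1 / sqrt (2 * pi) * (1 - y\<^sup>2 / 2 + y^4 / 4)) (at y)"
    proof -
      have "((\<lambda>y. c * (y - y^3 / 6 + y^5 / 20)) has_real_derivative c * (1 - y\<^sup>2 / 2 + y^4 / 4))
          (at y)" for c
        by (auto intro!: derivative_eq_intros simp: field_simps)
      then show ?thesis .
    qed
    have "0 \<le> (y\<^sup>2 / 2 - 1 / 2)\<^sup>2 + 3 / 4" by simp
    also have "\<dots> = 1 - y\<^sup>2 / 2 + y^4 / 4" by (simp add: power2_eq_square power4_eq_xxxx field_simps)
    finally show "0 \<le> 1 / sqrt (2 * pi) * (1 - y\<^sup>2 / 2 + y^4 / 4)" by simp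
  qed auto
  also have "\<dots> \<le> ennreal (494 / 1000)"
  proof (rule ennreal_leI)
    have "3.14 < pi" using pi_approx by simp
    then have "(2.505 :: real)\<^sup>2 \<le> 2 * pi" by (simp add: power2_eq_square)
    then have s: "2.505 \<le> sqrt (2 * pi)" by (rule real_le_rsqrt)
    have "1 / sqrt (2 * pi) * (?a - ?a^3 / 6 + ?a^5 / 20) - 1 / sqrt (2 * pi) * (- ?a - (- ?a)^3 / 6 + (- ?a)^5 / 20)
       = 2 * (?a - ?a^3 / 6 + ?a^5 / 20) / sqrt (2 * pi)" by (simp add: field_simps)
    also have "\<dots> \<le> 2 * (?a - ?a^3 / 6 + ?a^5 / 20) / 2.505"
      using s by (intro divide_left_mono) (auto simp: power_divide)
    also have "\<dots> \<le> 494 / 1000" by (simp add: power_divide)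
    finally show "1 / sqrt (2 * pi) * (?a - ?a^3 / 6 + ?a^5 / 20) - 1 / sqrt (2 * pi) * (- ?a - (- ?a)^3 / 6 + (- ?a)^5 / 20) \<le> 494 / 1000" .
  qed
  finally show ?thesis
    by (simp add: finite_measure.emeasure_eq_measure[OF prob_space.finite_measure[OF prob_space_gauss]])
qed

text \<open>Chebyshev suffices here, since the upper bound for the threshold influences only the
  sample size and not the final error.\<close>

lemma gauss_two_ball: "3 / 4 \<le> measure gauss {y. \<bar>y\<bar> \<le> 2}"
proof -
  interpret prob_space gauss by (rule prob_space_gauss)
  have i2: "integrable gauss (\<lambda>y. y\<^sup>2)" unfolding gauss_def
    using integrable_std_normal_square by (subst integrable_density) auto
  have e2: "expectation (\<lambda>y. y\<^sup>2) = 1" by (simp add: integral_gauss integral_std_normal_square)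
  have "measure gauss (UNIV - {y. \<bar>y\<bar> \<le> 2}) = expectation (indicator (UNIV - {y. \<bar>y\<bar> \<le> 2}))" by simp
  also have "\<dots> \<le> expectation (\<lambda>y. y\<^sup>2 / 4)"
  proof (intro integral_mono)
    fix y :: real
    have "2\<^sup>2 \<le> y\<^sup>2" if "\<not> \<bar>y\<bar> \<le> 2" using that power_mono[of 2 "\<bar>y\<bar>" 2] by simp
    then show "indicator (UNIV - {y. \<bar>y\<bar> \<le> 2}) y \<le> y\<^sup>2 / 4" by (auto simp: indicator_def)
  qed (use i2 in \<open>auto simp: emeasure_eq_measure\<close>)
  also have "\<dots> = 1 / 4" using e2 by simp
  finally show ?thesis using prob_compl[of "{y. \<bar>y\<bar> \<le> 2}"] by simp
qed

section \<open>Concentration of truncated products\<close>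

text \<open>The deviation \<open>s\<close> is allowed to be smaller than \<sigma>, so that one
  exponent serves every pair of grid vectors. The condition on T keeps the chosen exponential
  parameter in the range where the moment bound holds.\<close>

lemma dominated_gaussian_concentration:
  assumes Q: "prob_space Q" and I: "finite I"
    and h: "distributed Q lborel h (normal_density 0 s)" and s: "0 < s" "s \<le> \<sigma>"
    and X[measurable]: "\<And>i. i \<in> I \<Longrightarrow> X i \<in> borel_measurable Q"
    and dom: "\<And>i a. i \<in> I \<Longrightarrow> a \<in> space Q \<Longrightarrow> \<bar>X i a\<bar> \<le> \<tau> * \<bar>h a\<bar>" and \<tau>: "0 < \<tau>"
    and T: "0 < T" "T \<le> 4 * \<tau> * \<sigma>"
  shows "emeasure (PiM I (\<lambda>_. Q)) {x \<in> space (PiM I (\<lambda>_. Q)).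
      real (card I) * T \<le> \<bar>(\<Sum>i\<in>I. X i (x i)) - (\<Sum>i\<in>I. \<integral>a. X i a \<partial>Q)\<bar>}
    \<le> ennreal (2 * exp (- real (card I) * T\<^sup>2 / (24 * \<tau>\<^sup>2 * \<sigma>\<^sup>2)))"
proof -
  interpret Q: prob_space Q by (rule Q)
  interpret product_sigma_finite "\<lambda>_. Q"
    by (simp add: product_sigma_finite_def prob_space_imp_sigma_finite Q)
  let ?P = "PiM I (\<lambda>_. Q)"
  \<comment> \<open>The minimizer of 6 l^2 \<tau>^2 \<sigma>^2 - l T, with minimum -T^2 / (24
    \<tau>^2 \<sigma>^2). For T <= 4 \<tau> \<sigma> the moment condition reads 16/18 <= 1 at
    worst.\<close>
  define l where "l = T / (12 * \<tau>\<^sup>2 * \<sigma>\<^sup>2)"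
  have \<sigma>: "0 < \<sigma>" using s by simp
  have l: "0 < l" using T \<tau> \<sigma> by (simp add: l_def)
  have lt: "12 * l * \<tau>\<^sup>2 * \<sigma>\<^sup>2 = T" using \<tau> \<sigma> by (simp add: l_def)
  have s2: "s\<^sup>2 \<le> \<sigma>\<^sup>2" using s by (intro power_mono) auto
  have T2: "T\<^sup>2 \<le> 16 * \<tau>\<^sup>2 * \<sigma>\<^sup>2" using power_mono[OF T(2), of 2] T(1) by (simp add: power_mult_distrib)
  have "8 * l\<^sup>2 * \<tau>\<^sup>2 * \<sigma>\<^sup>2 \<le> 1"
  proof -
    have "8 * l\<^sup>2 * \<tau>\<^sup>2 * \<sigma>\<^sup>2 = T\<^sup>2 / (18 * (\<tau>\<^sup>2 * \<sigma>\<^sup>2))"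
      unfolding l_def using \<tau> \<sigma> by (simp add: power_divide power_mult_distrib field_simps)
    also have "\<dots> \<le> 1"
    proof -
      have "0 < \<tau>\<^sup>2 * \<sigma>\<^sup>2" using \<tau> \<sigma> by simp
      moreover have "T\<^sup>2 \<le> 16 * (\<tau>\<^sup>2 * \<sigma>\<^sup>2)" using T2 by (simp add: mult.assoc)
      ultimately have "T\<^sup>2 \<le> 18 * (\<tau>\<^sup>2 * \<sigma>\<^sup>2)" by linarith
      then show ?thesis using \<open>0 < \<tau>\<^sup>2 * \<sigma>\<^sup>2\<close> by (simp add: divide_le_eq_1_pos)
    qed
    finally show ?thesis .
  qed
  moreover have "8 * l\<^sup>2 * \<tau>\<^sup>2 * s\<^sup>2 \<le> 8 * l\<^sup>2 * \<tau>\<^sup>2 * \<sigma>\<^sup>2" using s2 by (intro mult_left_mono) auto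
  ultimately have cond: "8 * l\<^sup>2 * \<tau>\<^sup>2 * s\<^sup>2 \<le> 1" by linarith
  define b where "b = 6 * l\<^sup>2 * \<tau>\<^sup>2 * \<sigma>\<^sup>2"
  have bl: "b - l * T = - (T\<^sup>2 / (24 * \<tau>\<^sup>2 * \<sigma>\<^sup>2))"
    unfolding b_def l_def using \<tau> \<sigma> by (simp add: field_simps power2_eq_square)
  have expo: "real (card I) * b - l * (real (card I) * T) = - real (card I) * T\<^sup>2 / (24 * \<tau>\<^sup>2 * \<sigma>\<^sup>2)"
    using arg_cong[OF bl, of "\<lambda>z. real (card I) * z"] by (simp add: algebra_simps)
  define f where "f = (\<lambda>i a. X i a - (\<integral>a. X i a \<partial>Q))"
  have meas: "f i \<in> borel_measurable Q" if "i \<in> I" for i using that by (simp add: f_def)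
  have up: "(\<integral>\<^sup>+a. ennreal (exp (l * (c * f i a))) \<partial>Q) \<le> ennreal (exp b)"
    if i: "i \<in> I" and c: "c = 1 \<or> c = -1" for i c
  proof -
    have "(\<integral>\<^sup>+a. ennreal (exp ((c * l) * (X i a - Q.expectation (X i)))) \<partial>Q)
        \<le> ennreal (exp (6 * (c * l)\<^sup>2 * \<tau>\<^sup>2 * s\<^sup>2))"
      using cond c by (intro Q.dominated_gaussian_mgf[OF h s(1) X[OF i] dom[OF i]]) (use \<tau> in auto)
    also have "6 * (c * l)\<^sup>2 * \<tau>\<^sup>2 * s\<^sup>2 \<le> b"
      unfolding b_def using s2 c by (intro mult_mono) auto
    finally show ?thesis by (simp add: f_def mult_ac ennreal_leI)
  qed
  have one: "emeasure ?P {x \<in> space ?P. real (card I) * T \<le> (\<Sum>i\<in>I. c * f i (x i))}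
      \<le> ennreal (exp (- real (card I) * T\<^sup>2 / (24 * \<tau>\<^sup>2 * \<sigma>\<^sup>2)))" if "c = 1 \<or> c = -1" for c
    unfolding expo[symmetric] using meas up[OF _ that] by (intro chernoff_PiM[OF I _ l]) auto
  have m1: "{x \<in> space ?P. real (card I) * T \<le> (\<Sum>i\<in>I. c * f i (x i))} \<in> sets ?P" for c
  proof -
    have "(\<lambda>x. \<Sum>i\<in>I. c * f i (x i)) \<in> borel_measurable ?P"
    proof (intro borel_measurable_sum)
      fix i assume i: "i \<in> I"
      note [measurable] = meas[OF i]
      show "(\<lambda>x. c * f i (x i)) \<in> borel_measurable ?P" using i by measurable
    qed
    then show ?thesis by simp
  qed
  have "emeasure ?P {x \<in> space ?P. real (card I) * T \<le> \<bar>(\<Sum>i\<in>I. X i (x i)) - (\<Sum>i\<in>I. \<integral>a. X i a \<partial>Q)\<bar>}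
      \<le> emeasure ?P ({x \<in> space ?P. real (card I) * T \<le> (\<Sum>i\<in>I. 1 * f i (x i))}
        \<union> {x \<in> space ?P. real (card I) * T \<le> (\<Sum>i\<in>I. -1 * f i (x i))})"
    using m1 by (intro emeasure_mono) (auto simp: f_def sum_subtractf sum_negf abs_if split: if_splits)
  also have "\<dots> \<le> emeasure ?P {x \<in> space ?P. real (card I) * T \<le> (\<Sum>i\<in>I. 1 * f i (x i))}
      + emeasure ?P {x \<in> space ?P. real (card I) * T \<le> (\<Sum>i\<in>I. -1 * f i (x i))}"
    by (intro emeasure_subadditive m1)
  also have "\<dots> \<le> ennreal (exp (- real (card I) * T\<^sup>2 / (24 * \<tau>\<^sup>2 * \<sigma>\<^sup>2)))
      + ennreal (exp (- real (card I) * T\<^sup>2 / (24 * \<tau>\<^sup>2 * \<sigma>\<^sup>2)))"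
    by (intro add_mono one) auto
  finally show ?thesis by (simp flip: ennreal_plus)
qed

text \<open>Chernoff's bound with l = T / 2, the minimizer of l^2 - l T.\<close>

lemma indicator_concentration:
  assumes Q: "prob_space Q" and I: "finite I" and A: "A \<in> sets Q" and T: "0 < T"
  shows "emeasure (PiM I (\<lambda>_. Q)) {x \<in> space (PiM I (\<lambda>_. Q)).
      real (card I) * (measure Q A + T) \<le> (\<Sum>i\<in>I. of_bool (x i \<in> A))}
    \<le> ennreal (exp (- real (card I) * T\<^sup>2 / 4))"
proof -
  interpret Q: prob_space Q by (rule Q)
  interpret product_sigma_finite "\<lambda>_. Q"
    by (simp add: product_sigma_finite_def prob_space_imp_sigma_finite Q)
  let ?P = "PiM I (\<lambda>_. Q)"
  define X :: "'a \<Rightarrow> real" where "X = indicator A"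
  have X[measurable]: "X \<in> borel_measurable Q" using A by (simp add: X_def)
  have EX: "Q.expectation X = measure Q A" using A by (simp add: X_def)
  have mgf: "(\<integral>\<^sup>+a. ennreal (exp (T / 2 * (X a - measure Q A))) \<partial>Q) \<le> ennreal (exp ((T / 2)\<^sup>2))"
    unfolding EX[symmetric] by (intro Q.bounded_mgf X) (auto simp: X_def indicator_def)
  have sum: "(\<Sum>i\<in>I. X (x i) - measure Q A) = (\<Sum>i\<in>I. of_bool (x i \<in> A)) - real (card I) * measure Q A" for x
    by (simp add: X_def indicator_def sum_subtractf of_bool_def)
  have "emeasure ?P {x \<in> space ?P. real (card I) * (measure Q A + T) \<le> (\<Sum>i\<in>I. of_bool (x i \<in> A))} =
      emeasure ?P {x \<in> space ?P. real (card I) * T \<le> (\<Sum>i\<in>I. X (x i) - measure Q A)}"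
    unfolding sum by (intro arg_cong[where f = "emeasure ?P"]) (auto simp: algebra_simps)
  also have "\<dots> \<le> ennreal (exp (real (card I) * (T / 2)\<^sup>2 - T / 2 * (real (card I) * T)))"
    using T mgf by (intro chernoff_PiM[OF I, where f = "\<lambda>_ a. X a - measure Q A"]) auto
  also have "real (card I) * (T / 2)\<^sup>2 - T / 2 * (real (card I) * T) = - real (card I) * T\<^sup>2 / 4"
    by (simp add: power2_eq_square field_simps)
  finally show ?thesis .
qed

text \<open>Conditioning on the coordinates in \<open>J\<close> without conditional expectations:
  those in \<open>I\<close> are integrated out for each frozen \<open>y\<close>, so a bound uniform
  in \<open>y\<close> passes to the whole product.\<close>

lemma emeasure_PiM_slice_le:
  assumes Q: "prob_space Q" and IJ: "I \<inter> J = {}" "finite I" "finite J"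
    and B: "B \<in> sets (PiM (I \<union> J) (\<lambda>_. Q))"
    and slice: "\<And>y. y \<in> space (PiM J (\<lambda>_. Q)) \<Longrightarrow>
      emeasure (PiM I (\<lambda>_. Q)) {x \<in> space (PiM I (\<lambda>_. Q)). merge J I (y, x) \<in> B} \<le> c"
  shows "emeasure (PiM (I \<union> J) (\<lambda>_. Q)) B \<le> c"
proof -
  interpret product_sigma_finite "\<lambda>_. Q"
    by (simp add: product_sigma_finite_def prob_space_imp_sigma_finite Q)
  interpret J: prob_space "PiM J (\<lambda>_. Q)" by (intro prob_space_PiM Q)
  have "emeasure (PiM (J \<union> I) (\<lambda>_. Q)) B =
      (\<integral>\<^sup>+y. emeasure (PiM I (\<lambda>_. Q)) ((\<lambda>x. merge J I (y, x)) -` B \<inter> space (PiM I (\<lambda>_. Q))) \<partial>PiM J (\<lambda>_. Q))"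
    using IJ B by (intro emeasure_fold_integral) (auto simp: Un_commute)
  also have "\<dots> \<le> (\<integral>\<^sup>+y. c \<partial>PiM J (\<lambda>_. Q))"
  proof (rule nn_integral_mono)
    fix y assume "y \<in> space (PiM J (\<lambda>_. Q))"
    from slice[OF this]
    show "emeasure (PiM I (\<lambda>_. Q)) ((\<lambda>x. merge J I (y, x)) -` B \<inter> space (PiM I (\<lambda>_. Q))) \<le> c"
      by (simp add: vimage_def Int_def conj_commute)
  qed
  finally show ?thesis by (simp add: J.emeasure_space_1 Un_commute)
qed

lemma emeasure_PiM_subproduct:
  assumes Q: "prob_space Q" and I: "finite I" "J \<subseteq> I" and B: "B \<in> sets (PiM J (\<lambda>_. Q))"
  shows "emeasure (PiM I (\<lambda>_. Q)) {x \<in> space (PiM I (\<lambda>_. Q)). restrict x J \<in> B} = emeasure (PiM J (\<lambda>_. Q)) B"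
proof -
  interpret product_prob_space "\<lambda>_. Q" I
    by (simp add: product_prob_space_def product_sigma_finite_def product_prob_space_axioms_def
        prob_space_imp_sigma_finite Q)
  have r: "(\<lambda>x. restrict x J) \<in> measurable (PiM I (\<lambda>_. Q)) (PiM J (\<lambda>_. Q))"
    using I by (intro measurable_restrict_subset)
  have "PiM J (\<lambda>_. Q) = distr (PiM I (\<lambda>_. Q)) (PiM J (\<lambda>_. Q)) (\<lambda>x. restrict x J)"
    using I finite_subset[OF I(2,1)] by (intro distr_PiM_restrict_finite[symmetric]) auto
  then have "emeasure (PiM J (\<lambda>_. Q)) B = emeasure (distr (PiM I (\<lambda>_. Q)) (PiM J (\<lambda>_. Q)) (\<lambda>x. restrict x J)) B"
    by simp
  also have "\<dots> = emeasure (PiM I (\<lambda>_. Q)) ((\<lambda>x. restrict x J) -` B \<inter> space (PiM I (\<lambda>_. Q)))"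
    by (rule emeasure_distr[OF r B])
  finally show ?thesis by (simp add: vimage_def Int_def conj_commute)
qed

text \<open>The ensemble is one product over all single entries, whereas the argument treats whole
  matrices as independent samples. The pushforward is computed for uncurrying, where a box pulls
  back to a box of boxes; currying is its inverse on these spaces, so the claim follows by
  composing.\<close>

lemma distr_PiM_curry:
  assumes I: "finite I" and D: "finite D" and N: "prob_space N"
  shows "(\<lambda>\<omega>. \<lambda>i\<in>I. \<lambda>d\<in>D. \<omega> (i, d)) \<in> measurable (PiM (I \<times> D) (\<lambda>_. N)) (PiM I (\<lambda>_. PiM D (\<lambda>_. N)))"
    and "distr (PiM (I \<times> D) (\<lambda>_. N)) (PiM I (\<lambda>_. PiM D (\<lambda>_. N))) (\<lambda>\<omega>. \<lambda>i\<in>I. \<lambda>d\<in>D. \<omega> (i, d))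
      = PiM I (\<lambda>_. PiM D (\<lambda>_. N))"
proof -
  let ?\<Omega> = "PiM (I \<times> D) (\<lambda>_. N)" and ?Q = "PiM D (\<lambda>_. N)"
  let ?P = "PiM I (\<lambda>_. ?Q)"
  let ?c = "\<lambda>\<omega>. \<lambda>i\<in>I. \<lambda>d\<in>D. \<omega> (i, d)"
  let ?u = "\<lambda>x. \<lambda>p\<in>I \<times> D. x (fst p) (snd p)"
  interpret N: prob_space N by (rule N)
  have Q: "prob_space ?Q" by (intro prob_space_PiM N)
  interpret pN: product_sigma_finite "\<lambda>_. N"
    by (simp add: product_sigma_finite_def prob_space_imp_sigma_finite N)
  interpret pQ: product_sigma_finite "\<lambda>_. ?Q"
    by (simp add: product_sigma_finite_def prob_space_imp_sigma_finite Q)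
  show c: "?c \<in> measurable ?\<Omega> ?P"
    by (intro measurable_restrict measurable_component_singleton) auto
  have u: "?u \<in> measurable ?P ?\<Omega>"
  proof (intro measurable_restrict)
    fix p assume p: "p \<in> I \<times> D"
    then have "fst p \<in> I" "snd p \<in> D" by auto
    then show "(\<lambda>x. x (fst p) (snd p)) \<in> measurable ?P N"
      by (intro measurable_compose[OF measurable_component_singleton[of "fst p"] measurable_component_singleton[of "snd p"]])
  qed
  have du: "distr ?P ?\<Omega> ?u = ?\<Omega>"
  proof (rule pN.PiM_eqI)
    fix A assume A: "\<And>p. p \<in> I \<times> D \<Longrightarrow> A p \<in> sets N"
    have eq: "?u -` Pi\<^sub>E (I \<times> D) A \<inter> space ?P = Pi\<^sub>E I (\<lambda>i. Pi\<^sub>E D (\<lambda>d. A (i, d)))"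
      using A[THEN sets.sets_into_space]
      by (fastforce simp: space_PiM PiE_iff extensional_def)
    have "emeasure (distr ?P ?\<Omega> ?u) (Pi\<^sub>E (I \<times> D) A) = emeasure ?P (Pi\<^sub>E I (\<lambda>i. Pi\<^sub>E D (\<lambda>d. A (i, d))))"
      using A I D unfolding eq[symmetric] by (intro emeasure_distr[OF u] sets_PiM_I_finite) auto
    also have "\<dots> = (\<Prod>i\<in>I. emeasure ?Q (Pi\<^sub>E D (\<lambda>d. A (i, d))))"
      using A I D by (intro pQ.emeasure_PiM sets_PiM_I_finite) auto
    also have "\<dots> = (\<Prod>i\<in>I. \<Prod>d\<in>D. emeasure N (A (i, d)))"
      using A D by (intro prod.cong refl pN.emeasure_PiM) auto
    also have "\<dots> = (\<Prod>p\<in>I \<times> D. emeasure N (A p))" by (simp add: prod.cartesian_product split_def)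
    finally show "emeasure (distr ?P ?\<Omega> ?u) (Pi\<^sub>E (I \<times> D) A) = (\<Prod>p\<in>I \<times> D. emeasure N (A p))" .
  qed (use I D in auto)
  have "distr ?\<Omega> ?P ?c = distr (distr ?P ?\<Omega> ?u) ?P ?c" by (simp only: du)
  also have "\<dots> = distr ?P ?P (?c \<circ> ?u)" by (rule distr_distr[OF c u])
  also have "\<dots> = distr ?P ?P (\<lambda>x. x)"
  proof (rule distr_cong[OF refl refl])
    fix x assume "x \<in> space ?P"
    then show "(?c \<circ> ?u) x = x"
      by (auto simp: space_PiM PiE_iff extensional_def fun_eq_iff)
  qed
  finally show "distr ?\<Omega> ?P ?c = ?P" by simp
qed

section \<open>Sample medians\<close>

lemma med_vec_eq: "med (Matrix.vec n f) = Inf {x. real n / 2 \<le> real (card {j. j < n \<and> f j \<le> x})}" if "0 < n"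
proof -
  have "{i. i < dim_vec (Matrix.vec n f) \<and> Matrix.vec n f $ i \<le> x} = {j. j < n \<and> f j \<le> x}" for x
    by auto
  then show ?thesis unfolding med_def empirical_cdf_def using that
    by (simp add: field_simps)
qed

lemma card_below_mono: "x \<le> y \<Longrightarrow> card {j. j < n \<and> f j \<le> x} \<le> card {j. j < (n::nat) \<and> f j \<le> (y::real)}"
  by (intro card_mono) auto

lemma med_set_nonempty:
  fixes f :: "nat \<Rightarrow> real"
  shows "\<exists>x. real n / 2 \<le> real (card {j. j < n \<and> f j \<le> x})"
proof -
  define b where "b = (\<Sum>j<n. \<bar>f j\<bar>)"
  have "f j \<le> b" if "j < n" for j
    using member_le_sum[of j "{..<n}" "\<lambda>j. \<bar>f j\<bar>"] that by (auto simp: b_def intro: order_trans[OF abs_ge_self])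
  then have "{j. j < n \<and> f j \<le> b} = {..<n}" by auto
  then show ?thesis by (intro exI[of _ b]) simp
qed

lemma med_set_lower:
  assumes "real (card {j. j < n \<and> f j \<le> a}) < real n / 2"
    and "real n / 2 \<le> real (card {j. j < n \<and> f j \<le> x})"
  shows "(a :: real) \<le> x"
  using card_below_mono[of x a n f] assms by (cases "a \<le> x") auto

lemma med_set_bdd_below:
  fixes f :: "nat \<Rightarrow> real"
  assumes "0 < n"
  shows "bdd_below {x. real n / 2 \<le> real (card {j. j < n \<and> f j \<le> x})}"
proof (rule bdd_belowI)
  define b where "b = - (\<Sum>j<n. \<bar>f j\<bar>) - 1"
  have "b < f j" if "j < n" for j
    using member_le_sum[of j "{..<n}" "\<lambda>j. \<bar>f j\<bar>"] that unfolding b_def by auto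
  then have "{j. j < n \<and> f j \<le> b} = {}" by (auto simp: not_le)
  then have "card {j. j < n \<and> f j \<le> b} = 0" by (simp only: card.empty)
  then have lt: "real (card {j. j < n \<and> f j \<le> b}) < real n / 2" using assms by linarith
  fix x assume "x \<in> {x. real n / 2 \<le> real (card {j. j < n \<and> f j \<le> x})}"
  then show "b \<le> x" using med_set_lower[OF lt] by simp
qed

lemma le_med:
  assumes "0 < n" "real (card {j. j < n \<and> f j \<le> a}) < real n / 2"
  shows "a \<le> med (Matrix.vec n f)"
  unfolding med_vec_eq[OF assms(1)]
  using med_set_nonempty[of n f] med_set_lower[OF assms(2)] by (intro cInf_greatest) auto

lemma med_le:
  assumes "0 < n" "real n / 2 \<le> real (card {j. j < n \<and> f j \<le> a})"
  shows "med (Matrix.vec n f) \<le> a"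
  unfolding med_vec_eq[OF assms(1)]
  using med_set_bdd_below[OF assms(1)] assms(2) by (intro cInf_lower) auto

text \<open>The median is below c exactly if some rational q < c has at least half of the entries
  below or equal to it, a countable union of measurable events.\<close>

lemma borel_measurable_med:
  assumes n: "0 < n" and f[measurable]: "\<And>j. j < n \<Longrightarrow> (\<lambda>x. f x j) \<in> borel_measurable N"
  shows "(\<lambda>x. med (Matrix.vec n (f x))) \<in> borel_measurable N"
proof (rule borel_measurable_iff_less[THEN iffD2], rule allI)
  fix c :: real
  have lt: "med (Matrix.vec n (f x)) < c \<longleftrightarrow>
      (\<exists>q::rat. real_of_rat q < c \<and> real n / 2 \<le> (\<Sum>j<n. of_bool (f x j \<le> real_of_rat q)))" for x
  proof -
    have cs: "(\<Sum>j<n. of_bool (f x j \<le> y)) = real (card {j. j < n \<and> f x j \<le> y})" for y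
    proof -
      have "{..<n} \<inter> {j. f x j \<le> y} = {j. j < n \<and> f x j \<le> y}" by auto
      then show ?thesis by (simp add: of_bool_def sum.If_cases)
    qed
    have "med (Matrix.vec n (f x)) < c \<longleftrightarrow> (\<exists>y<c. real n / 2 \<le> real (card {j. j < n \<and> f x j \<le> y}))"
      unfolding med_vec_eq[OF n]
      using med_set_nonempty[of n "f x"] med_set_bdd_below[OF n, of "f x"] by (subst cInf_less_iff) auto
    also have "\<dots> \<longleftrightarrow> (\<exists>q::rat. real_of_rat q < c \<and> real n / 2 \<le> real (card {j. j < n \<and> f x j \<le> real_of_rat q}))"
    proof
      assume "\<exists>y<c. real n / 2 \<le> real (card {j. j < n \<and> f x j \<le> y})"
      then obtain y where y: "y < c" "real n / 2 \<le> real (card {j. j < n \<and> f x j \<le> y})" by blast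
      obtain q where q: "y < real_of_rat q" "real_of_rat q < c" using of_rat_dense[OF y(1)] by blast
      have "card {j. j < n \<and> f x j \<le> y} \<le> card {j. j < n \<and> f x j \<le> real_of_rat q}"
        using q by (intro card_below_mono) simp
      with y q show "\<exists>q::rat. real_of_rat q < c \<and> real n / 2 \<le> real (card {j. j < n \<and> f x j \<le> real_of_rat q})"
        by (intro exI[of _ q]) linarith
    qed auto
    finally show ?thesis unfolding cs .
  qed
  have m: "(\<lambda>x. (\<Sum>j<n. of_bool (f x j \<le> y)) :: real) \<in> borel_measurable N" for y :: real
  proof (intro borel_measurable_sum)
    fix j assume "j \<in> {..<n}"
    then have [measurable]: "(\<lambda>x. f x j) \<in> borel_measurable N" by simp
    show "(\<lambda>x. of_bool (f x j \<le> y) :: real) \<in> borel_measurable N" unfolding of_bool_def by measurable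
  qed
  show "{x \<in> space N. med (Matrix.vec n (f x)) < c} \<in> sets N"
    unfolding lt by (intro sets.sets_Collect_countable_Ex sets.sets_Collect_conj) (use m in measurable)
qed

section \<open>The truncation bias\<close>

lemma exp_one_bounds: "27182 / 10000 < exp (1 :: real)" "exp (1 :: real) < 27183 / 10000"
proof -
  have "inverse (2 ^ 32) \<le> (1 / 1000000 :: real)" by simp
  with e_approx_32 have "\<bar>exp 1 - 5837465777 / 2147483648 :: real\<bar> \<le> 1 / 1000000" by linarith
  then show "27182 / 10000 < exp (1 :: real)" "exp (1 :: real) < 27183 / 10000" by linarith+
qed

lemma shifted_square_le: "0 \<le> z \<Longrightarrow> z\<^sup>2 \<le> 5 / 1000000 * (z + 20) ^ 5" for z :: real
proof -
  assume z: "0 \<le> z"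
  \<comment> \<open>Multiplying the difference of the two sides by 200000 gives a quintic whose only
    negative term is -120000 z^2. That coefficient is split as 35760 + 84240 to complete a square in
    z^2 with the quartic term and one in z with the cubic term.\<close>
  have "0 \<le> 100 * (z\<^sup>2 - 1788 / 10)\<^sup>2 + 4000 * z * ((z - 1053 / 100)\<^sup>2 + 89) + z ^ 5"
    using z by simp
  then show ?thesis using z
    by (simp add: power2_eq_square eval_nat_numeral algebra_simps)
qed

text \<open>Applied with x^2 = sqrt r * kappa_0, which bounds |M| / sigma_r(M), this is the
  truncation bias in units of sigma_r(M). The factor 1.32 is 2 * 0.66, from the truncation level and
  the median bound. With y = x + 20 and L = ln y the tail is of order L / y^6 while x^2 is bounded
  by a multiple of y^5, so L / y remains; its bound is largest at y = 21, where the estimate is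
  about 0.0267.\<close>

lemma bias_bound:
  assumes x: "1 \<le> x"
  shows "x\<^sup>2 * (1 - trunc_moment (132 / 100 * ln (x + 20))) \<le> 27 / 1000"
proof -
  define y where "y = x + 20"
  define L where "L = ln y"
  define t where "t = 132 / 100 * L"
  have y: "21 \<le> y" using x by (simp add: y_def)
  have expL: "exp L = y" using y by (simp add: L_def)
  have e3: "20 \<le> exp (3::real)"
  proof -
    have "20 \<le> (27182 / 10000 :: real) ^ 3" by (simp add: power_divide)
    also have "\<dots> \<le> exp 1 ^ 3" using exp_one_bounds by (intro power_mono) auto
    finally show ?thesis by (simp add: exp_of_nat_mult[symmetric])
  qed
  \<comment> \<open>Convexity of exp at 3: y = exp 3 * exp (L - 3) >= 20 (L - 2).\<close>
  have Lle: "L \<le> 2 + y / 20"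
  proof -
    have "20 * (1 + (L - 3)) \<le> exp 3 * exp (L - 3)"
    proof (cases "0 \<le> 1 + (L - 3)")
      case True
      then show ?thesis using e3 by (intro mult_mono exp_ge_add_one_self) auto
    next
      case False
      then have "20 * (1 + (L - 3)) \<le> 0" by simp
      also have "0 \<le> exp 3 * exp (L - 3)" by simp
      finally show ?thesis .
    qed
    also have "\<dots> = y" by (simp add: exp_add[symmetric] expL)
    finally show ?thesis by simp
  qed
  have Lge: "5 / 2 \<le> L"
  proof -
    have "exp (5 / 2 :: real) \<le> exp 3" by simp
    also have "exp (3::real) \<le> 21"
    proof -
      have "exp 1 ^ 3 \<le> (27183 / 10000 :: real) ^ 3" using exp_one_bounds by (intro power_mono) auto
      also have "\<dots> \<le> 21" by (simp add: power_divide)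
      finally show ?thesis by (simp add: exp_of_nat_mult[symmetric])
    qed
    also have "21 \<le> exp L" using y expL by simp
    finally show ?thesis by simp
  qed
  have t: "3 \<le> t" using Lge by (simp add: t_def)
  have ex: "exp (- t\<^sup>2 / 2) \<le> 31000 / y ^ 6"
  proof -
    \<comment> \<open>\<open>t\<^sup>2 / 2 = c L\<^sup>2\<close> is bounded below by its tangent of slope 6.\<close>
    define c :: real where "c = 8712 / 10000"
    have "0 \<le> (c * L - 3)\<^sup>2" by simp
    then have "0 \<le> c * (c * L\<^sup>2 - 6 * L + 9 / c)"
      by (simp add: c_def power2_eq_square algebra_simps)
    then have "0 \<le> c * L\<^sup>2 - 6 * L + 9 / c" by (simp add: c_def zero_le_mult_iff)
    moreover have "9 / c \<le> 10 + 1 / 3" by (simp add: c_def)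
    ultimately have "- (c * L\<^sup>2) \<le> (10 + 1 / 3) - 6 * L" by linarith
    moreover have "- t\<^sup>2 / 2 = - (c * L\<^sup>2)" by (simp add: t_def c_def power_mult_distrib power_divide)
    ultimately have "exp (- t\<^sup>2 / 2) \<le> exp ((10 + 1 / 3) - 6 * L)" by simp
    also have "\<dots> = exp (31 / 3) / y ^ 6"
      unfolding exp_diff by (simp add: expL[symmetric] exp_of_nat_mult[symmetric])
    also have "exp (31 / 3 :: real) \<le> 31000"
    proof -
      have "exp (31 / 3 :: real) ^ 3 = exp 1 ^ 31" by (simp add: exp_of_nat_mult[symmetric])
      also have "\<dots> \<le> (27183 / 10000) ^ 31" using exp_one_bounds by (intro power_mono) auto
      also have "\<dots> \<le> (31000::real) ^ 3" by (simp add: power_divide)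
      finally show ?thesis by (rule power_le_imp_le_base[of _ 2, simplified]) simp
    qed
    finally show ?thesis using y by (simp add: divide_right_mono)
  qed
  have "3.14 < pi" using pi_approx by simp
  then have "(2.5 :: real)\<^sup>2 \<le> 2 * pi" by (simp add: power2_eq_square)
  then have s: "2.5 \<le> sqrt (2 * pi)" by (rule real_le_rsqrt)
  then have c: "1 / sqrt (2 * pi) \<le> 4 / 10" by (simp add: field_simps)
  have "std_normal_density t \<le> 4 / 10 * (31000 / y ^ 6)"
    unfolding std_normal_density_def using c ex by (intro mult_mono) auto
  then have "9 / 4 * t * std_normal_density t \<le> 9 / 4 * t * (4 / 10 * (31000 / y ^ 6))"
    using t by (intro mult_left_mono) auto
  then have tail: "1 - trunc_moment t \<le> 36828 * L / y ^ 6"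
    using trunc_moment_tail[OF t] by (simp add: t_def)
  have x2: "x\<^sup>2 \<le> 5 / 1000000 * y ^ 5" using shifted_square_le[of x] x by (simp add: y_def)
  have "x\<^sup>2 * (1 - trunc_moment t) \<le> (5 / 1000000 * y ^ 5) * (36828 * L / y ^ 6)"
    using tail x2 trunc_moment_le_1[of t] y by (intro mult_mono) auto
  also have "\<dots> = 18414 / 100000 * (L / y)"
    using y by (simp add: eval_nat_numeral field_simps)
  also have "\<dots> \<le> 18414 / 100000 * ((2 + y / 20) / y)"
    using Lle y by (intro mult_left_mono divide_right_mono) auto
  also have "\<dots> \<le> 27 / 1000" using y by (simp add: field_simps)
  finally show ?thesis by (simp add: t_def L_def y_def)
qed

section \<open>A grid net for bilinear forms\<close>

text \<open>The points have coordinates in multiples of 1 / (8 N) within [-1, 1] and are extensional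
  functions, which makes the set finite. The radius 9/8 leaves room for rounding a unit vector. The
  mesh depends on N, so the number of points has a logarithm of order n log N: this is the origin of
  the factor log n.\<close>

definition grid :: "nat \<Rightarrow> nat \<Rightarrow> (nat \<Rightarrow> real) set" where
  "grid n N = {u \<in> {..<n} \<rightarrow>\<^sub>E (\<lambda>k. real_of_int k / (8 * real N)) ` {- int (8 * N)..int (8 * N)}.
     L2_set u {..<n} \<le> 9 / 8}"

lemma finite_grid: "finite (grid n N)"
proof -
  have "finite ({..<n} \<rightarrow>\<^sub>E (\<lambda>k. real_of_int k / (8 * real N)) ` {- int (8 * N)..int (8 * N)})"
    by (intro finite_PiE) auto
  then show ?thesis unfolding grid_def by simp
qed

lemma card_grid_le: "card (grid n N) \<le> (16 * N + 1) ^ n"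
proof -
  let ?A = "(\<lambda>k. real_of_int k / (8 * real N)) ` {- int (8 * N)..int (8 * N)}"
  have "card (grid n N) \<le> card ({..<n} \<rightarrow>\<^sub>E ?A)"
    unfolding grid_def by (intro card_mono finite_PiE) auto
  also have "\<dots> = card ?A ^ n" by (simp add: card_PiE)
  also have "\<dots> \<le> card {- int (8 * N)..int (8 * N)} ^ n" by (intro power_mono card_image_le) auto
  also have "card {- int (8 * N)..int (8 * N)} = 16 * N + 1" by simp
  finally show ?thesis .
qed

text \<open>Coordinates are rounded down. Each error is at most 1 / (8 N), and the sum of n <= N of
  them already bounds the Euclidean norm.\<close>

lemma grid_approx:
  assumes n: "n \<le> N" "1 \<le> N" and u: "L2_set u {..<n} \<le> 1"
  shows "\<exists>u'\<in>grid n N. L2_set (\<lambda>i. u i - u' i) {..<n} \<le> 1 / 8"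
proof -
  define k where "k = (\<lambda>i. \<lfloor>8 * real N * u i\<rfloor>)"
  define u' where "u' = (\<lambda>i\<in>{..<n}. real_of_int (k i) / (8 * real N))"
  have N: "0 < real N" using n by simp
  have ui: "\<bar>u i\<bar> \<le> 1" if "i < n" for i
  proof -
    have "\<bar>u i\<bar> \<le> L2_set (\<lambda>i. \<bar>u i\<bar>) {..<n}"
      using member_le_L2_set[of "{..<n}" i "\<lambda>i. \<bar>u i\<bar>"] that by simp
    also have "\<dots> = L2_set u {..<n}" by (simp add: L2_set_def)
    finally show ?thesis using u by simp
  qed
  have kr: "k i \<in> {- int (8 * N)..int (8 * N)}" if "i < n" for i
  proof -
    have "8 * real N * u i \<le> 8 * real N" "- (8 * real N) \<le> 8 * real N * u i"
      using ui[OF that] N by (auto simp: abs_le_iff mult_le_cancel_left1 intro: mult_left_mono[of "-1" "u i" "8 * real N", simplified])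
    then show ?thesis unfolding k_def by (auto simp: le_floor_iff floor_le_iff)
  qed
  have d: "\<bar>u i - u' i\<bar> \<le> 1 / (8 * real N)" if "i < n" for i
  proof -
    have "u i - u' i = (8 * real N * u i - real_of_int (k i)) / (8 * real N)"
      using that N by (simp add: u'_def field_simps)
    moreover have "0 \<le> 8 * real N * u i - real_of_int (k i)" "8 * real N * u i - real_of_int (k i) \<le> 1"
      unfolding k_def by linarith+
    ultimately show ?thesis using N by (simp add: abs_of_nonneg divide_right_mono)
  qed
  have dist: "L2_set (\<lambda>i. u i - u' i) {..<n} \<le> 1 / 8"
  proof -
    have "L2_set (\<lambda>i. u i - u' i) {..<n} = L2_set (\<lambda>i. \<bar>u i - u' i\<bar>) {..<n}" by (simp add: L2_set_def)
    also have "\<dots> \<le> (\<Sum>i<n. \<bar>u i - u' i\<bar>)" by (rule L2_set_le_sum) simp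
    also have "\<dots> \<le> (\<Sum>i<n. 1 / (8 * real N))" using d by (intro sum_mono) auto
    also have "\<dots> = real n / (8 * real N)" by simp
    also have "\<dots> \<le> 1 / 8" using n N by (simp add: field_simps)
    finally show ?thesis .
  qed
  have "L2_set u' {..<n} = L2_set (\<lambda>i. u i + - (u i - u' i)) {..<n}" by (simp add: L2_set_def)
  also have "\<dots> \<le> L2_set u {..<n} + L2_set (\<lambda>i. - (u i - u' i)) {..<n}" by (rule L2_set_triangle_ineq)
  also have "L2_set (\<lambda>i. - (u i - u' i)) {..<n} = L2_set (\<lambda>i. u i - u' i) {..<n}"
    by (simp add: L2_set_def power2_commute)
  finally have "L2_set u' {..<n} \<le> 9 / 8" using u dist by linarith
  then have "u' \<in> grid n N" unfolding grid_def using kr by (auto simp: u'_def)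
  with dist show ?thesis by blast
qed

definition bilin :: "real mat \<Rightarrow> (nat \<Rightarrow> real) \<Rightarrow> (nat \<Rightarrow> real) \<Rightarrow> real" where
  "bilin E u v = (\<Sum>i<dim_row E. \<Sum>j<dim_col E. u i * E $$ (i, j) * v j)"

lemma bilin_bound_mono:
  assumes E: "bilin_bound E a" and ab: "a \<le> b"
  shows "bilin_bound E b"
  unfolding bilin_bound_def
proof (intro conjI allI)
  show "0 \<le> b" using E ab by (simp add: bilin_bound_def)
  fix u v
  have "\<bar>\<Sum>i<dim_row E. \<Sum>j<dim_col E. u i * E $$ (i, j) * v j\<bar>
      \<le> a * L2_set u {..<dim_row E} * L2_set v {..<dim_col E}"
    using E unfolding bilin_bound_def by blast
  also have "\<dots> \<le> b * L2_set u {..<dim_row E} * L2_set v {..<dim_col E}"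
    using ab by (intro mult_right_mono L2_set_nonneg)
  finally show "\<bar>\<Sum>i<dim_row E. \<Sum>j<dim_col E. u i * E $$ (i, j) * v j\<bar>
      \<le> b * L2_set u {..<dim_row E} * L2_set v {..<dim_col E}" .
qed

lemma bilin_bound_from_unit:
  assumes b: "0 \<le> b" and unit: "\<And>u v. L2_set u {..<dim_row E} \<le> 1 \<Longrightarrow> L2_set v {..<dim_col E} \<le> 1 \<Longrightarrow> \<bar>bilin E u v\<bar> \<le> b"
  shows "bilin_bound E b"
  unfolding bilin_bound_def
proof (intro conjI allI b)
  fix u v
  let ?u = "L2_set u {..<dim_row E}" and ?v = "L2_set v {..<dim_col E}"
  show "\<bar>\<Sum>i<dim_row E. \<Sum>j<dim_col E. u i * E $$ (i, j) * v j\<bar> \<le> b * ?u * ?v"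
  proof (cases "?u = 0 \<or> ?v = 0")
    case True
    then have "(\<forall>i<dim_row E. u i = 0) \<or> (\<forall>j<dim_col E. v j = 0)" by (auto simp: L2_set_eq_0_iff)
    then have "(\<Sum>i<dim_row E. \<Sum>j<dim_col E. u i * E $$ (i, j) * v j) = 0" by (auto intro!: sum.neutral)
    then show ?thesis using b by simp
  next
    case False
    then have pos: "0 < ?u" "0 < ?v" using L2_set_nonneg[of u "{..<dim_row E}"] L2_set_nonneg[of v "{..<dim_col E}"]
      by linarith+
    have sc: "L2_set (\<lambda>i. w i / L2_set w A) A = 1" if "0 < L2_set w A" for w :: "nat \<Rightarrow> real" and A
      using L2_set_left_distrib[of "1 / L2_set w A" w A] that by simp
    have "\<bar>bilin E (\<lambda>i. u i / ?u) (\<lambda>j. v j / ?v)\<bar> \<le> b"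
      using sc[OF pos(1)] sc[OF pos(2)] by (intro unit) auto
    moreover have "bilin E (\<lambda>i. u i / ?u) (\<lambda>j. v j / ?v) = bilin E u v / (?u * ?v)"
      unfolding bilin_def by (simp add: sum_divide_distrib)
    ultimately have "\<bar>bilin E u v\<bar> \<le> b * (?u * ?v)" using pos by (simp add: abs_mult divide_le_eq)
    then show ?thesis by (simp add: bilin_def mult.assoc)
  qed
qed

text \<open>Let \<open>\<beta>\<close> be the supremum of the form over unit balls, finite by a
  crude entry bound. Replacing u and then v by grid points costs \<open>\<beta>\<close> / 8 and 9/64
  \<open>\<beta>\<close>, hence \<open>\<beta>\<close> <= T + 17/64 \<open>\<beta>\<close>, which is
  better than the factor 2 claimed.\<close>

lemma bilin_bound_from_grid:
  assumes E: "E \<in> carrier_mat n1 n2" and N: "N = n1 + n2" "1 \<le> N"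
    and g: "\<And>u v. u \<in> grid n1 N \<Longrightarrow> v \<in> grid n2 N \<Longrightarrow> \<bar>bilin E u v\<bar> \<le> T"
  shows "bilin_bound E (2 * T)"
proof -
  have dims: "dim_row E = n1" "dim_col E = n2" using E by auto
  let ?S = "{\<bar>bilin E u v\<bar> | u v. L2_set u {..<n1} \<le> 1 \<and> L2_set v {..<n2} \<le> 1}"
  define \<beta> where "\<beta> = Sup ?S"
  have mem0: "0 \<in> ?S"
    by (intro CollectI exI[of _ "\<lambda>_. 0"]) (simp add: bilin_def L2_set_def)
  have bdd: "bdd_above ?S"
  proof (rule bdd_aboveI, safe)
    fix u v assume uv: "L2_set u {..<n1} \<le> 1" "L2_set v {..<n2} \<le> 1"
    have le: "\<bar>w i\<bar> \<le> 1" if "L2_set w {..<n} \<le> 1" "i < n" for w :: "nat \<Rightarrow> real" and i n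
    proof -
      have "\<bar>w i\<bar> \<le> L2_set (\<lambda>i. \<bar>w i\<bar>) {..<n}"
        using member_le_L2_set[of "{..<n}" i "\<lambda>i. \<bar>w i\<bar>"] that by simp
      also have "\<dots> = L2_set w {..<n}" by (simp add: L2_set_def)
      finally show ?thesis using that by simp
    qed
    have "\<bar>bilin E u v\<bar> \<le> (\<Sum>i<n1. \<bar>\<Sum>j<n2. u i * E $$ (i, j) * v j\<bar>)"
      unfolding bilin_def dims by (rule sum_abs)
    also have "\<dots> \<le> (\<Sum>i<n1. \<Sum>j<n2. \<bar>u i * E $$ (i, j) * v j\<bar>)" by (intro sum_mono sum_abs)
    also have "\<dots> \<le> (\<Sum>i<n1. \<Sum>j<n2. \<bar>E $$ (i, j)\<bar>)"
    proof (intro sum_mono)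
      fix i j assume "i \<in> {..<n1}" "j \<in> {..<n2}"
      then have "\<bar>u i\<bar> * \<bar>E $$ (i, j)\<bar> * \<bar>v j\<bar> \<le> 1 * \<bar>E $$ (i, j)\<bar> * 1"
        using le[OF uv(1)] le[OF uv(2)] by (intro mult_mono) auto
      then show "\<bar>u i * E $$ (i, j) * v j\<bar> \<le> \<bar>E $$ (i, j)\<bar>" by (simp add: abs_mult)
    qed
    finally show "\<bar>bilin E u v\<bar> \<le> (\<Sum>i<n1. \<Sum>j<n2. \<bar>E $$ (i, j)\<bar>)" .
  qed
  have \<beta>0: "0 \<le> \<beta>" unfolding \<beta>_def by (rule cSup_upper[OF mem0 bdd])
  have bb: "bilin_bound E \<beta>"
  proof (rule bilin_bound_from_unit[OF \<beta>0])
    fix u v assume "L2_set u {..<dim_row E} \<le> 1" "L2_set v {..<dim_col E} \<le> 1"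
    then show "\<bar>bilin E u v\<bar> \<le> \<beta>" unfolding \<beta>_def dims by (intro cSup_upper[OF _ bdd]) auto
  qed
  then have bb': "\<bar>bilin E u v\<bar> \<le> \<beta> * L2_set u {..<n1} * L2_set v {..<n2}" for u v
    unfolding bilin_bound_def bilin_def dims by blast
  have step: "\<bar>bilin E u v\<bar> \<le> T + 17 / 64 * \<beta>" if uv: "L2_set u {..<n1} \<le> 1" "L2_set v {..<n2} \<le> 1" for u v
  proof -
    obtain u' where u': "u' \<in> grid n1 N" "L2_set (\<lambda>i. u i - u' i) {..<n1} \<le> 1 / 8"
      using grid_approx[OF _ N(2) uv(1)] N by auto
    obtain v' where v': "v' \<in> grid n2 N" "L2_set (\<lambda>i. v i - v' i) {..<n2} \<le> 1 / 8"
      using grid_approx[OF _ N(2) uv(2)] N by auto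
    have u98: "L2_set u' {..<n1} \<le> 9 / 8" using u' by (simp add: grid_def)
    have "bilin E u v = bilin E u' v' + bilin E (\<lambda>i. u i - u' i) v + bilin E u' (\<lambda>j. v j - v' j)"
      unfolding bilin_def sum.distrib[symmetric] by (intro sum.cong refl) (simp add: algebra_simps)
    moreover have "\<bar>bilin E u' v'\<bar> \<le> T" by (rule g[OF u'(1) v'(1)])
    moreover have "\<bar>bilin E (\<lambda>i. u i - u' i) v\<bar> \<le> \<beta> * (1 / 8) * 1"
      using u' uv \<beta>0 by (intro order_trans[OF bb'] mult_mono) auto
    moreover have "\<bar>bilin E u' (\<lambda>j. v j - v' j)\<bar> \<le> \<beta> * (9 / 8) * (1 / 8)"
      using v' u98 \<beta>0 by (intro order_trans[OF bb'] mult_mono) auto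
    ultimately show ?thesis by linarith
  qed
  have "\<beta> \<le> T + 17 / 64 * \<beta>" unfolding \<beta>_def
    by (rule cSup_least) (use mem0 step in \<open>auto simp: \<beta>_def\<close>)
  then have "\<beta> \<le> 2 * T" using \<beta>0 by linarith
  then show ?thesis by (rule bilin_bound_mono[OF bb])
qed

section \<open>The truncated product and its mean\<close>

text \<open>The first form is scaled to unit variance, so that
  \<open>gauss_correlated_moment\<close> applies with a truncated identity bounded by t; the second
  form is expanded by coordinates.\<close>

lemma trunc_product_moment:
  fixes M w :: "'d \<Rightarrow> real"
  assumes D: "finite D" and F: "0 < F" "(\<Sum>d\<in>D. (M d)\<^sup>2) = F\<^sup>2" and t: "0 \<le> t"
  shows "(\<integral>a. (\<Sum>d\<in>D. M d * a d) * of_bool (\<bar>\<Sum>d\<in>D. M d * a d\<bar> \<le> t) * (\<Sum>d\<in>D. w d * a d) \<partial>PiM D (\<lambda>_. gauss))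
    = trunc_moment (t / F) * (\<Sum>d\<in>D. M d * w d)"
proof -
  let ?Q = "PiM D (\<lambda>_. gauss)"
  interpret Q: prob_space ?Q by (rule prob_space_PiM_gauss)
  define \<phi> where "\<phi> = (\<lambda>y :: real. F * y * of_bool (\<bar>F * y\<bar> \<le> t))"
  have \<phi>m[measurable]: "\<phi> \<in> borel_measurable borel" unfolding \<phi>_def of_bool_def by measurable
  have \<phi>b: "\<bar>\<phi> y\<bar> \<le> t" for y using t by (simp add: \<phi>_def)
  have lin: "(\<Sum>d\<in>D. M d * a d) = F * (\<Sum>d\<in>D. M d / F * a d)" for a
    using F by (simp add: sum_distrib_left)
  have norm1: "(\<Sum>d\<in>D. (M d / F)\<^sup>2) = 1"
    using F by (simp add: power_divide sum_divide_distrib[symmetric])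
  have "(\<integral>y. std_normal_density y * (\<phi> y * y) \<partial>lborel) = (\<integral>y. F * (std_normal_density y * (y\<^sup>2 * of_bool (\<bar>y\<bar> \<le> t / F))) \<partial>lborel)"
    unfolding \<phi>_def using F
    by (intro Bochner_Integration.integral_cong refl) (auto simp: abs_mult power2_eq_square field_simps of_bool_def)
  then have mom: "(\<integral>y. std_normal_density y * (\<phi> y * y) \<partial>lborel) = F * trunc_moment (t / F)"
    by (simp add: trunc_moment_def)
  have each: "(\<integral>a. \<phi> (\<Sum>d\<in>D. M d / F * a d) * a j \<partial>?Q) = M j * trunc_moment (t / F)" if j: "j \<in> D" for j
    using gauss_correlated_moment[OF D j norm1 \<phi>m \<phi>b] F by (simp add: mom)
  have int: "integrable ?Q (\<lambda>a. w j * (\<phi> (\<Sum>d\<in>D. M d / F * a d) * a j))" if j: "j \<in> D" for j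
  proof -
    have m: "(\<lambda>a. \<phi> (\<Sum>d\<in>D. M d / F * a d) * a j) \<in> borel_measurable ?Q" using j by measurable
    have dom: "\<bar>\<phi> (\<Sum>d\<in>D. M d / F * a d) * a j\<bar> \<le> t * \<bar>a j\<bar>" for a
      using \<phi>b by (simp add: abs_mult mult_right_mono)
    have "integrable ?Q (\<lambda>a. \<phi> (\<Sum>d\<in>D. M d / F * a d) * a j)"
    proof (rule Q.dominated_gaussian_integrable(1)[where h = "\<lambda>a. a j" and s = 1 and \<tau> = t])
      show "distributed ?Q lborel (\<lambda>a. a j) std_normal_density" by (rule distributed_gauss_component[OF j])
    qed (use m dom t in auto)
    then show ?thesis by simp
  qed
  have "(\<integral>a. (\<Sum>d\<in>D. M d * a d) * of_bool (\<bar>\<Sum>d\<in>D. M d * a d\<bar> \<le> t) * (\<Sum>d\<in>D. w d * a d) \<partial>?Q)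
      = (\<integral>a. (\<Sum>j\<in>D. w j * (\<phi> (\<Sum>d\<in>D. M d / F * a d) * a j)) \<partial>?Q)"
  proof (intro Bochner_Integration.integral_cong refl)
    fix a :: "'d \<Rightarrow> real"
    define g where "g = (\<Sum>d\<in>D. M d / F * a d)"
    show "(\<Sum>d\<in>D. M d * a d) * of_bool (\<bar>\<Sum>d\<in>D. M d * a d\<bar> \<le> t) * (\<Sum>d\<in>D. w d * a d)
        = (\<Sum>j\<in>D. w j * (\<phi> (\<Sum>d\<in>D. M d / F * a d) * a j))"
      unfolding lin g_def[symmetric] by (simp add: \<phi>_def sum_distrib_left mult_ac)
  qed
  also have "\<dots> = (\<Sum>j\<in>D. \<integral>a. w j * (\<phi> (\<Sum>d\<in>D. M d / F * a d) * a j) \<partial>?Q)"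
    by (rule Bochner_Integration.integral_sum) (rule int)
  also have "\<dots> = (\<Sum>j\<in>D. w j * (M j * trunc_moment (t / F)))"
    by (intro sum.cong refl) (simp only: integral_mult_right_zero each)
  finally show ?thesis by (simp add: sum_distrib_left mult_ac)
qed

text \<open>An outlier contributes a constant, zero or of size at most t, times a centred Gaussian:
  its mean is 0 and it is dominated like the other terms. Hence only indices outside
  \<open>S\<close> enter the mean, while all of \<open>I\<close> shares one deviation bound.\<close>

lemma truncated_sum_concentration:
  fixes M w :: "'d \<Rightarrow> real" and I S :: "'i set" and \<eta> :: "'i \<Rightarrow> real"
  assumes D: "finite D" and F: "0 < F" "(\<Sum>d\<in>D. (M d)\<^sup>2) = F\<^sup>2"
    and w: "(\<Sum>d\<in>D. (w d)\<^sup>2) \<le> \<sigma>\<^sup>2" "0 < \<sigma>" and I: "finite I" "I \<noteq> {}"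
    and t: "0 \<le> t" "t \<le> \<tau>" and \<tau>: "0 < \<tau>" and T: "0 < T" "T \<le> 4 * \<tau> * \<sigma>"
  defines "Q \<equiv> PiM D (\<lambda>_. gauss)" and "lin \<equiv> \<lambda>a. \<Sum>d\<in>D. M d * a d"
  defines "y \<equiv> \<lambda>x i. if i \<in> S then \<eta> i else lin (x i)"
  shows "emeasure (PiM I (\<lambda>_. Q)) {x \<in> space (PiM I (\<lambda>_. Q)). real (card I) * T \<le>
      \<bar>(\<Sum>i\<in>I. y x i * of_bool (\<bar>y x i\<bar> \<le> t) * (\<Sum>d\<in>D. w d * x i d))
        - real (card (I - S)) * trunc_moment (t / F) * (\<Sum>d\<in>D. M d * w d)\<bar>}
    \<le> ennreal (2 * exp (- real (card I) * T\<^sup>2 / (24 * \<tau>\<^sup>2 * \<sigma>\<^sup>2)))"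
proof -
  let ?P = "PiM I (\<lambda>_. Q)"
  define h where "h = (\<lambda>a. \<Sum>d\<in>D. w d * a d :: real)"
  have Q: "prob_space Q" unfolding Q_def by (rule prob_space_PiM_gauss)
  interpret Q: prob_space Q by (rule Q)
  define z where "z = (\<lambda>i a. if i \<in> S then \<eta> i else lin a)"
  define X where "X = (\<lambda>i a. z i a * of_bool (\<bar>z i a\<bar> \<le> t) * h a)"
  have [measurable]: "lin \<in> borel_measurable Q" "h \<in> borel_measurable Q"
    unfolding lin_def h_def Q_def by measurable
  have Xm: "X i \<in> borel_measurable Q" for i
    unfolding X_def z_def of_bool_def by (cases "i \<in> S") simp_all
  have dom: "\<bar>X i a\<bar> \<le> \<tau> * \<bar>h a\<bar>" for i a
    unfolding X_def using t by (auto simp: abs_mult intro!: mult_right_mono)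
  have sum_eq: "(\<Sum>i\<in>I. y x i * of_bool (\<bar>y x i\<bar> \<le> t) * (\<Sum>d\<in>D. w d * x i d)) = (\<Sum>i\<in>I. X i (x i))" for x
    by (simp add: X_def y_def z_def h_def)
  show ?thesis
  proof (cases "(\<Sum>d\<in>D. (w d)\<^sup>2) = 0")
    \<comment> \<open>There is no normal density of deviation 0, but here all forms vanish and the
      event is empty because T > 0 and \<open>I\<close> is nonempty.\<close>
    case True
    then have w0: "w d = 0" if "d \<in> D" for d using D that by (simp add: sum_nonneg_eq_0_iff)
    have "real (card I) * T > 0" using I T by (simp add: card_gt_0_iff)
    then have "{x \<in> space ?P. real (card I) * T \<le>
      \<bar>(\<Sum>i\<in>I. y x i * of_bool (\<bar>y x i\<bar> \<le> t) * (\<Sum>d\<in>D. w d * x i d))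
        - real (card (I - S)) * trunc_moment (t / F) * (\<Sum>d\<in>D. M d * w d)\<bar>} = {}"
      by (auto simp: w0 not_le)
    then show ?thesis by (simp only: emeasure_empty) simp
  next
    case False
    define s where "s = sqrt (\<Sum>d\<in>D. (w d)\<^sup>2)"
    have s: "0 < s" "(\<Sum>d\<in>D. (w d)\<^sup>2) = s\<^sup>2"
      using False sum_nonneg[of D "\<lambda>d. (w d)\<^sup>2"] by (auto simp: s_def less_le)
    have s\<sigma>: "s \<le> \<sigma>" using w s by (intro power2_le_imp_le[of s \<sigma>]) auto
    have hd: "distributed Q lborel h (normal_density 0 s)"
      unfolding Q_def h_def by (rule distributed_gauss_linear[OF D s])
    have Eh: "Q.expectation h = 0"
      using distributed_integral[OF hd, of "\<lambda>x. x"] integral_normal_moment_nz_1[OF s(1), of 0]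
      by simp
    have EX: "(\<integral>a. X i a \<partial>Q) = (if i \<in> S then 0 else trunc_moment (t / F) * (\<Sum>d\<in>D. M d * w d))" for i
      using trunc_product_moment[OF D F t(1), of w] Eh
      unfolding X_def z_def lin_def h_def Q_def by simp
    have "(\<Sum>i\<in>I. \<integral>a. X i a \<partial>Q) = (\<Sum>i\<in>I - S. trunc_moment (t / F) * (\<Sum>d\<in>D. M d * w d))"
      unfolding EX using I by (simp add: sum.If_cases Diff_eq)
    then have mean: "(\<Sum>i\<in>I. \<integral>a. X i a \<partial>Q) = real (card (I - S)) * trunc_moment (t / F) * (\<Sum>d\<in>D. M d * w d)"
      by simp
    show ?thesis unfolding sum_eq mean[symmetric]
      by (rule dominated_gaussian_concentration[OF Q I(1) hd s(1) s\<sigma> Xm dom \<tau> T])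
  qed
qed

section \<open>The good event of the initialization\<close>

text \<open>
  A sample point \<open>x\<close> maps the index of a sensing matrix to its entries. The threshold \<open>tau x\<close> depends
  on the blocks in \<open>J\<close> only, so it is frozen when one integrates over the blocks in \<open>I\<close>.
\<close>
locale trunc_init =
  fixes n1 n2 m1 m2 :: nat and M :: "real mat" and S :: "nat set" and \<eta> :: "nat \<Rightarrow> real" and \<alpha> F :: real
  assumes M: "M \<in> carrier_mat n1 n2" and F: "F = frob_norm M" "0 < F"
    and m: "0 < m1" "0 < m2" and \<alpha>: "0 < \<alpha>"
begin

definition D :: "(nat \<times> nat) set" where "D = {..<n1} \<times> {..<n2}"
definition Q :: "(nat \<times> nat \<Rightarrow> real) measure" where "Q = PiM D (\<lambda>_. gauss)"
definition I :: "nat set" where "I = {1..m1}"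
definition J :: "nat set" where "J = {m1 + 1..m1 + m2}"
definition P :: "(nat \<Rightarrow> nat \<times> nat \<Rightarrow> real) measure" where "P = PiM {1..m1 + m2} (\<lambda>_. Q)"
definition lin :: "(nat \<times> nat \<Rightarrow> real) \<Rightarrow> real" where "lin a = (\<Sum>d\<in>D. M $$ d * a d)"
definition obs :: "(nat \<Rightarrow> nat \<times> nat \<Rightarrow> real) \<Rightarrow> nat \<Rightarrow> real" where
  "obs x i = (if i \<in> S then \<eta> i else lin (x i))"
definition tau :: "(nat \<Rightarrow> nat \<times> nat \<Rightarrow> real) \<Rightarrow> real" where
  "tau x = \<alpha> * med (Matrix.vec m2 (\<lambda>j. \<bar>obs x (m1 + 1 + j)\<bar>))"
text \<open>This is m1 times the form of K - c M at u and v, see \<open>bilin_deviation\<close>. The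
  subtracted term contains \<open>tau x\<close> and is the mean over the first half for a frozen
  second half.\<close>

definition dev :: "(nat \<Rightarrow> real) \<Rightarrow> (nat \<Rightarrow> real) \<Rightarrow> (nat \<Rightarrow> nat \<times> nat \<Rightarrow> real) \<Rightarrow> real" where
  "dev u v x = (\<Sum>i\<in>I. obs x i * of_bool (\<bar>obs x i\<bar> \<le> tau x) * (\<Sum>d\<in>D. u (fst d) * v (snd d) * x i d))
     - real (card (I - S)) * trunc_moment (tau x / F) * (\<Sum>d\<in>D. M $$ d * (u (fst d) * v (snd d)))"
text \<open>Together with \<open>large\<close>, the blocks whose clean observation would pull the
  sample median out of the interval from 0.66 F to 2 F.\<close>

definition small :: "(nat \<times> nat \<Rightarrow> real) set" where "small = {a \<in> space Q. \<bar>lin a\<bar> \<le> 66 / 100 * F}"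
definition large :: "(nat \<times> nat \<Rightarrow> real) set" where "large = {a \<in> space Q. 2 * F < \<bar>lin a\<bar>}"

lemma finite_D [simp]: "finite D" by (simp add: D_def)
lemma IJ: "I \<inter> J = {}" "finite I" "finite J" "I \<union> J = {1..m1 + m2}" "card I = m1" "card J = m2"
  using m by (auto simp: I_def J_def)
lemma prob_space_Q: "prob_space Q" unfolding Q_def by (rule prob_space_PiM_gauss)
lemma prob_space_P: "prob_space P" unfolding P_def by (intro prob_space_PiM prob_space_Q)

lemma lin_norm: "(\<Sum>d\<in>D. (M $$ d)\<^sup>2) = F\<^sup>2"
  unfolding F frob_norm_square frob_inner_def D_def using M
  by (simp add: sum.cartesian_product power2_eq_square split_def)

lemma measurable_linear [measurable]: "(\<lambda>a. \<Sum>d\<in>D. c d * a d) \<in> borel_measurable Q"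
  unfolding Q_def by measurable

lemma measurable_lin [measurable]: "lin \<in> borel_measurable Q"
  unfolding lin_def by measurable

lemma measurable_block: "i \<in> {1..m1 + m2} \<Longrightarrow> (\<lambda>x. x i) \<in> measurable P Q"
  unfolding P_def by (rule measurable_component_singleton)

lemma measurable_obs: "i \<in> {1..m1 + m2} \<Longrightarrow> (\<lambda>x. obs x i) \<in> borel_measurable P"
  unfolding obs_def by (cases "i \<in> S") (auto intro: measurable_compose[OF measurable_block measurable_lin])

lemma measurable_tau [measurable]: "tau \<in> borel_measurable P"
proof -
  have "(\<lambda>x. \<bar>obs x (m1 + 1 + j)\<bar>) \<in> borel_measurable P" if "j < m2" for j
  proof -
    have j: "m1 + 1 + j \<in> {1..m1 + m2}" using that by auto
    note [measurable] = measurable_obs[OF j]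
    show ?thesis by measurable
  qed
  then have "(\<lambda>x. med (Matrix.vec m2 (\<lambda>j. \<bar>obs x (m1 + 1 + j)\<bar>))) \<in> borel_measurable P"
    using m by (intro borel_measurable_med) auto
  then show ?thesis unfolding tau_def[abs_def] by simp
qed

lemma measurable_dev: "dev u v \<in> borel_measurable P"
proof -
  have "(\<lambda>x. obs x i * of_bool (\<bar>obs x i\<bar> \<le> tau x) * (\<Sum>d\<in>D. u (fst d) * v (snd d) * x i d)) \<in> borel_measurable P"
    if "i \<in> I" for i
  proof -
    have i: "i \<in> {1..m1 + m2}" using that IJ by auto
    note [measurable] = measurable_obs[OF i]
      measurable_compose[OF measurable_block[OF i] measurable_linear[of "\<lambda>d. u (fst d) * v (snd d)"]]
    show ?thesis unfolding of_bool_def by measurable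
  qed
  then have [measurable]: "(\<lambda>x. \<Sum>i\<in>I. obs x i * of_bool (\<bar>obs x i\<bar> \<le> tau x) *
      (\<Sum>d\<in>D. u (fst d) * v (snd d) * x i d)) \<in> borel_measurable P" by (rule borel_measurable_sum)
  show ?thesis unfolding dev_def[abs_def] by measurable
qed

text \<open>The bounds on the threshold are part of the event, so that a slice with a bad threshold
  is empty and the others obey one uniform bound with truncation level 2 \<alpha> F. The product
  weights have norm at most (9/8)^2 <= 3/2, whence 12 = 4 * 2 * 3/2 and 216 = 24 * 2^2 *
  (3/2)^2.\<close>

lemma dev_prob:
  assumes uv: "L2_set u {..<n1} \<le> 9 / 8" "L2_set v {..<n2} \<le> 9 / 8"
    and T: "0 < T" "T \<le> 12 * \<alpha> * F"
  shows "{x \<in> space P. 0 \<le> tau x \<and> tau x \<le> 2 * \<alpha> * F \<and> real m1 * T \<le> \<bar>dev u v x\<bar>} \<in> sets P" (is "?B \<in> _")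
    and "emeasure P {x \<in> space P. 0 \<le> tau x \<and> tau x \<le> 2 * \<alpha> * F \<and> real m1 * T \<le> \<bar>dev u v x\<bar>}
      \<le> ennreal (2 * exp (- real m1 * T\<^sup>2 / (216 * \<alpha>\<^sup>2 * F\<^sup>2)))"
proof -
  note [measurable] = measurable_dev[of u v]
  show B: "?B \<in> sets P" by measurable
  define w where "w = (\<lambda>d :: nat \<times> nat. u (fst d) * v (snd d))"
  have "(\<Sum>d\<in>D. (w d)\<^sup>2) = (\<Sum>i<n1. (u i)\<^sup>2) * (\<Sum>j<n2. (v j)\<^sup>2)"
    unfolding w_def D_def sum_product by (simp add: sum.cartesian_product split_def power_mult_distrib)
  also have "\<dots> = (L2_set u {..<n1})\<^sup>2 * (L2_set v {..<n2})\<^sup>2" by (simp add: L2_set_def sum_nonneg)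
  also have "\<dots> \<le> (9 / 8)\<^sup>2 * (9 / 8)\<^sup>2" using uv by (intro mult_mono power_mono) auto
  also have "\<dots> \<le> (3 / 2)\<^sup>2" by (simp add: power2_eq_square)
  finally have w: "(\<Sum>d\<in>D. (w d)\<^sup>2) \<le> (3 / 2)\<^sup>2" .
  have T4: "T \<le> 4 * (2 * \<alpha> * F) * (3 / 2)" using T(2) by (simp add: mult_ac)
  have pos: "0 < 2 * \<alpha> * F" using \<alpha> F by simp
  have "emeasure (PiM (I \<union> J) (\<lambda>_. Q)) ?B \<le> ennreal (2 * exp (- real m1 * T\<^sup>2 / (216 * \<alpha>\<^sup>2 * F\<^sup>2)))"
  proof (rule emeasure_PiM_slice_le[OF prob_space_Q IJ(1-3)])
    show "?B \<in> sets (PiM (I \<union> J) (\<lambda>_. Q))" using B unfolding IJ(4) P_def .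
    fix y assume y: "y \<in> space (PiM J (\<lambda>_. Q))"
    let ?m = "\<lambda>x. merge J I (y, x)"
    have mI: "?m x i = x i" if "i \<in> I" for x i using that IJ(1) by (auto simp: merge_def)
    have mJ: "?m x j = y j" if "j \<in> J" for x j using that by (simp add: merge_def)
    \<comment> \<open>The threshold reads only blocks in \<open>J\<close>, which the merge takes
      from \<open>y\<close>; on a slice it is a constant.\<close>
    have tauy: "tau (?m x) = tau y" for x
    proof -
      have "Matrix.vec m2 (\<lambda>j. \<bar>obs (?m x) (m1 + 1 + j)\<bar>) = Matrix.vec m2 (\<lambda>j. \<bar>obs y (m1 + 1 + j)\<bar>)"
      proof (rule eq_vecI)
        fix j assume "j < dim_vec (Matrix.vec m2 (\<lambda>j. \<bar>obs y (m1 + 1 + j)\<bar>))"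
        then have j: "j < m2" by simp
        then have "m1 + 1 + j \<in> J" by (simp add: J_def)
        then have "obs (?m x) (m1 + 1 + j) = obs y (m1 + 1 + j)" unfolding obs_def by (simp only: mJ)
        then show "Matrix.vec m2 (\<lambda>j. \<bar>obs (?m x) (m1 + 1 + j)\<bar>) $ j =
            Matrix.vec m2 (\<lambda>j. \<bar>obs y (m1 + 1 + j)\<bar>) $ j" using j by simp
      qed simp
      then show ?thesis by (simp add: tau_def)
    qed
    show "emeasure (PiM I (\<lambda>_. Q)) {x \<in> space (PiM I (\<lambda>_. Q)). ?m x \<in> ?B}
        \<le> ennreal (2 * exp (- real m1 * T\<^sup>2 / (216 * \<alpha>\<^sup>2 * F\<^sup>2)))"
    proof (cases "0 \<le> tau y \<and> tau y \<le> 2 * \<alpha> * F")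
      case False
      then have "{x \<in> space (PiM I (\<lambda>_. Q)). ?m x \<in> ?B} = {}" by (auto simp: tauy)
      then show ?thesis by (simp only: emeasure_empty) simp
    next
      case True
      let ?C = "{x \<in> space (PiM I (\<lambda>_. Q)). real (card I) * T \<le>
        \<bar>(\<Sum>i\<in>I. (if i \<in> S then \<eta> i else \<Sum>d\<in>D. M $$ d * x i d) *
            of_bool (\<bar>if i \<in> S then \<eta> i else \<Sum>d\<in>D. M $$ d * x i d\<bar> \<le> tau y) * (\<Sum>d\<in>D. w d * x i d))
          - real (card (I - S)) * trunc_moment (tau y / F) * (\<Sum>d\<in>D. M $$ d * w d)\<bar>}"
      have C: "emeasure (PiM I (\<lambda>_. PiM D (\<lambda>_. gauss))) ?C
          \<le> ennreal (2 * exp (- real (card I) * T\<^sup>2 / (24 * (2 * \<alpha> * F)\<^sup>2 * (3 / 2)\<^sup>2)))"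
        unfolding Q_def
        by (rule truncated_sum_concentration[OF finite_D F(2) lin_norm w _ IJ(2)])
          (use True pos T(1) T4 IJ m in auto)
      have "{x \<in> space (PiM I (\<lambda>_. Q)). ?m x \<in> ?B} \<subseteq> ?C"
      proof (safe)
        fix x assume x: "x \<in> space (PiM I (\<lambda>_. Q))" and le: "real m1 * T \<le> \<bar>dev u v (?m x)\<bar>"
        have "(\<Sum>i\<in>I. obs (?m x) i * of_bool (\<bar>obs (?m x) i\<bar> \<le> tau (?m x)) * (\<Sum>d\<in>D. u (fst d) * v (snd d) * ?m x i d))
          = (\<Sum>i\<in>I. (if i \<in> S then \<eta> i else \<Sum>d\<in>D. M $$ d * x i d) *
            of_bool (\<bar>if i \<in> S then \<eta> i else \<Sum>d\<in>D. M $$ d * x i d\<bar> \<le> tau y) * (\<Sum>d\<in>D. w d * x i d))"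
          by (intro sum.cong refl) (simp add: obs_def lin_def mI tauy w_def)
        then show "real (card I) * T \<le>
        \<bar>(\<Sum>i\<in>I. (if i \<in> S then \<eta> i else \<Sum>d\<in>D. M $$ d * x i d) *
            of_bool (\<bar>if i \<in> S then \<eta> i else \<Sum>d\<in>D. M $$ d * x i d\<bar> \<le> tau y) * (\<Sum>d\<in>D. w d * x i d))
          - real (card (I - S)) * trunc_moment (tau y / F) * (\<Sum>d\<in>D. M $$ d * w d)\<bar>"
          using le unfolding dev_def tauy IJ(5) by (simp add: w_def)
      qed
      moreover have "?C \<in> sets (PiM I (\<lambda>_. Q))"
      proof -
        have "(\<lambda>x. (if i \<in> S then \<eta> i else \<Sum>d\<in>D. M $$ d * x i d) *
            of_bool (\<bar>if i \<in> S then \<eta> i else \<Sum>d\<in>D. M $$ d * x i d\<bar> \<le> tau y) * (\<Sum>d\<in>D. w d * x i d))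
            \<in> borel_measurable (PiM I (\<lambda>_. Q))" if i: "i \<in> I" for i
        proof -
          have [measurable]: "(\<lambda>x. \<Sum>d\<in>D. c d * x i d) \<in> borel_measurable (PiM I (\<lambda>_. Q))" for c
            by (rule measurable_compose[OF measurable_component_singleton[OF i] measurable_linear])
          show ?thesis unfolding of_bool_def by (cases "i \<in> S") simp_all
        qed
        then have [measurable]: "(\<lambda>x. \<Sum>i\<in>I. (if i \<in> S then \<eta> i else \<Sum>d\<in>D. M $$ d * x i d) *
            of_bool (\<bar>if i \<in> S then \<eta> i else \<Sum>d\<in>D. M $$ d * x i d\<bar> \<le> tau y) * (\<Sum>d\<in>D. w d * x i d))
            \<in> borel_measurable (PiM I (\<lambda>_. Q))" by (rule borel_measurable_sum)
        show ?thesis by measurable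
      qed
      ultimately have "emeasure (PiM I (\<lambda>_. Q)) {x \<in> space (PiM I (\<lambda>_. Q)). ?m x \<in> ?B} \<le> emeasure (PiM I (\<lambda>_. Q)) ?C"
        by (rule emeasure_mono)
      also have "\<dots> \<le> ennreal (2 * exp (- real (card I) * T\<^sup>2 / (24 * (2 * \<alpha> * F)\<^sup>2 * (3 / 2)\<^sup>2)))"
        using C unfolding Q_def .
      also have "24 * (2 * \<alpha> * F)\<^sup>2 * (3 / 2)\<^sup>2 = 216 * \<alpha>\<^sup>2 * F\<^sup>2"
        by (simp add: power_mult_distrib power_divide)
      finally show ?thesis unfolding IJ(5) .
    qed
  qed
  then show "emeasure P ?B \<le> ennreal (2 * exp (- real m1 * T\<^sup>2 / (216 * \<alpha>\<^sup>2 * F\<^sup>2)))"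
    unfolding IJ(4) P_def .
qed

lemma distr_lin: "distr Q borel (\<lambda>a. lin a / F) = gauss"
proof -
  have "(\<Sum>d\<in>D. (M $$ d / F)\<^sup>2) = 1\<^sup>2"
    using lin_norm F(2) by (simp add: power_divide sum_divide_distrib[symmetric])
  from distributed_gauss_linear[where s = 1, OF finite_D _ this]
  have "distributed Q lborel (\<lambda>a. lin a / F) std_normal_density"
    unfolding lin_def Q_def by (simp add: sum_divide_distrib)
  then have "distr Q lborel (\<lambda>a. lin a / F) = gauss"
    unfolding gauss_def by (rule distributed_distr_eq_density)
  moreover have "distr Q borel (\<lambda>a. lin a / F) = distr Q lborel (\<lambda>a. lin a / F)"
    by (rule distr_cong) auto
  ultimately show ?thesis by simp
qed

lemma small_sets [measurable]: "small \<in> sets Q" and large_sets [measurable]: "large \<in> sets Q"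
  unfolding small_def large_def by measurable

lemma measure_small: "measure Q small \<le> 494 / 1000"
proof -
  have "measure gauss {y. \<bar>y\<bar> \<le> 66 / 100} = measure Q ((\<lambda>a. lin a / F) -` {y. \<bar>y\<bar> \<le> 66 / 100} \<inter> space Q)"
    unfolding distr_lin[symmetric] by (rule measure_distr) auto
  also have "(\<lambda>a. lin a / F) -` {y. \<bar>y\<bar> \<le> 66 / 100} \<inter> space Q = small"
    unfolding small_def using F(2) by (auto simp: field_simps)
  finally show ?thesis using gauss_small_ball by simp
qed

lemma measure_large: "measure Q large \<le> 1 / 4"
proof -
  interpret Q: prob_space Q by (rule prob_space_Q)
  have "measure gauss {y. \<bar>y\<bar> \<le> 2} = measure Q ((\<lambda>a. lin a / F) -` {y. \<bar>y\<bar> \<le> 2} \<inter> space Q)"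
    unfolding distr_lin[symmetric] by (rule measure_distr) auto
  also have "(\<lambda>a. lin a / F) -` {y. \<bar>y\<bar> \<le> 2} \<inter> space Q = space Q - large"
    unfolding large_def using F(2) by (auto simp: field_simps)
  also have "measure Q (space Q - large) = 1 - measure Q large" by (rule Q.prob_compl[OF large_sets])
  finally show ?thesis using gauss_two_ball by simp
qed

lemma count_prob:
  assumes A: "A \<in> sets Q" and T: "0 < T" and p: "measure Q A + T \<le> p"
  shows "{x \<in> space P. real m2 * p \<le> (\<Sum>i\<in>J. of_bool (x i \<in> A))} \<in> sets P" (is "?B \<in> _")
    and "emeasure P {x \<in> space P. real m2 * p \<le> (\<Sum>i\<in>J. of_bool (x i \<in> A))}
      \<le> ennreal (exp (- real m2 * T\<^sup>2 / 4))"
proof -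
  let ?PJ = "PiM J (\<lambda>_. Q)"
  let ?C = "{x \<in> space ?PJ. real (card J) * (measure Q A + T) \<le> (\<Sum>i\<in>J. of_bool (x i \<in> A))}"
  have mJ: "(\<lambda>x. of_bool (x i \<in> A) :: real) \<in> borel_measurable ?PJ" if i: "i \<in> J" for i
  proof -
    note [measurable] = A measurable_component_singleton[OF i, of "\<lambda>_. Q"]
    show ?thesis unfolding of_bool_def by measurable
  qed
  have mP: "(\<lambda>x. of_bool (x i \<in> A) :: real) \<in> borel_measurable P" if i: "i \<in> J" for i
  proof -
    have "i \<in> {1..m1 + m2}" using i IJ by auto
    note [measurable] = A measurable_block[OF this]
    show ?thesis unfolding of_bool_def by measurable
  qed
  note [measurable] = borel_measurable_sum[OF mJ] borel_measurable_sum[OF mP]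
  show B: "?B \<in> sets P" by measurable
  have C: "?C \<in> sets ?PJ" by measurable
  have B': "{x \<in> space P. restrict x J \<in> ?C} \<in> sets P"
  proof -
    have "(\<lambda>x. restrict x J) \<in> measurable P ?PJ"
      unfolding P_def using IJ by (intro measurable_restrict_subset) auto
    from measurable_sets[OF this C] show ?thesis by (simp add: vimage_def Int_def conj_commute)
  qed
  have "emeasure P ?B \<le> emeasure P {x \<in> space P. restrict x J \<in> ?C}"
  proof (rule emeasure_mono[OF _ B'], safe)
    fix x assume x: "x \<in> space P" and le: "real m2 * p \<le> (\<Sum>i\<in>J. of_bool (x i \<in> A))"
    have "restrict x J \<in> space ?PJ"
      using x IJ unfolding P_def by (auto simp: space_PiM PiE_iff)
    then show "restrict x J \<in> space ?PJ" .
    have "real m2 * (measure Q A + T) \<le> real m2 * p" using p by (intro mult_left_mono) auto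
    then show "real (card J) * (measure Q A + T) \<le> (\<Sum>i\<in>J. of_bool (restrict x J i \<in> A))"
      using le IJ by simp
  qed
  also have "\<dots> = emeasure ?PJ ?C"
    unfolding P_def using IJ C by (intro emeasure_PiM_subproduct prob_space_Q) auto
  also have "\<dots> \<le> ennreal (exp (- real (card J) * T\<^sup>2 / 4))"
    by (rule indicator_concentration[OF prob_space_Q IJ(3) A T])
  finally show "emeasure P ?B \<le> ennreal (exp (- real m2 * T\<^sup>2 / 4))" using IJ by simp
qed

text \<open>Arbitrary outliers change each empirical count by at most card S, a fraction 1/400 of
  m2. The counts then stay below one half: 0.497 + 0.0025 for observations that are too small, 0.3 +
  0.0025 for those that are too large.\<close>

lemma tau_bounds:
  assumes S: "finite S" "400 * real (card S) \<le> real m2"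
    and sm: "(\<Sum>i\<in>J. of_bool (x i \<in> small)) < real m2 * (497 / 1000)"
    and lg: "(\<Sum>i\<in>J. of_bool (x i \<in> large)) < real m2 * (3 / 10)"
    and x: "x \<in> space P"
  shows "66 / 100 * \<alpha> * F \<le> tau x" "tau x \<le> 2 * \<alpha> * F"
proof -
  define f where "f = (\<lambda>j. \<bar>obs x (m1 + 1 + j)\<bar>)"
  let ?g = "\<lambda>j. m1 + 1 + j"
  have Jim: "J = ?g ` {..<m2}"
  proof -
    have "{m1 + 1..m1 + m2} = (\<lambda>j. j + (m1 + 1)) ` {0..<m2}"
      unfolding image_add_atLeastLessThan' using m by auto
    then show ?thesis unfolding J_def by (simp add: add.commute atLeast0LessThan)
  qed
  have cnt: "(\<Sum>i\<in>J. of_bool (x i \<in> A)) = real (card {j. j < m2 \<and> x (?g j) \<in> A})" for A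
  proof -
    have "(\<Sum>i\<in>J. of_bool (x i \<in> A)) = (\<Sum>j<m2. of_bool (x (?g j) \<in> A) :: real)"
      unfolding Jim by (subst sum.reindex) (auto simp: inj_on_def)
    also have "{..<m2} \<inter> {j. x (?g j) \<in> A} = {j. j < m2 \<and> x (?g j) \<in> A}" by auto
    then have "(\<Sum>j<m2. of_bool (x (?g j) \<in> A) :: real) = real (card {j. j < m2 \<and> x (?g j) \<in> A})"
      by (simp add: of_bool_def sum.If_cases)
    finally show ?thesis .
  qed
  have xs: "x (?g j) \<in> space Q" if "j < m2" for j
    using x that m unfolding P_def by (auto simp: space_PiM PiE_iff)
  have cS: "card {j. j < m2 \<and> ?g j \<in> S} \<le> card S"
    using S by (intro card_inj_on_le[of ?g]) (auto simp: inj_on_def)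
  have add: "real (card B) \<le> real (card {j. j < m2 \<and> x (?g j) \<in> A}) + real (card S)"
    if "B \<subseteq> {j. j < m2 \<and> x (?g j) \<in> A} \<union> {j. j < m2 \<and> ?g j \<in> S}" for A B
  proof -
    have "card B \<le> card ({j. j < m2 \<and> x (?g j) \<in> A} \<union> {j. j < m2 \<and> ?g j \<in> S})"
      using that by (intro card_mono) auto
    also have "\<dots> \<le> card {j. j < m2 \<and> x (?g j) \<in> A} + card {j. j < m2 \<and> ?g j \<in> S}" by (rule card_Un_le)
    finally show ?thesis using cS by linarith
  qed
  have "real (card {j. j < m2 \<and> f j \<le> 66 / 100 * F}) \<le>
      real (card {j. j < m2 \<and> x (?g j) \<in> small}) + real (card S)"
    by (rule add) (auto simp: f_def obs_def small_def split: if_splits intro: xs[simplified])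
  then have "real (card {j. j < m2 \<and> f j \<le> 66 / 100 * F}) < real m2 / 2"
    using sm[unfolded cnt] S(2) m(2) by linarith
  from le_med[OF m(2) this] have "66 / 100 * F \<le> med (Matrix.vec m2 f)" .
  then have "\<alpha> * (66 / 100 * F) \<le> \<alpha> * med (Matrix.vec m2 f)" using \<alpha> by (intro mult_left_mono) auto
  then show "66 / 100 * \<alpha> * F \<le> tau x" unfolding tau_def f_def by (simp add: mult_ac)
  have "real (card {j. j < m2 \<and> 2 * F < f j}) \<le>
      real (card {j. j < m2 \<and> x (?g j) \<in> large}) + real (card S)"
    by (rule add) (auto simp: f_def obs_def large_def split: if_splits intro: xs[simplified])
  moreover have "m2 = card {j. j < m2 \<and> f j \<le> 2 * F} + card {j. j < m2 \<and> 2 * F < f j}"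
  proof -
    have "{..<m2} = {j. j < m2 \<and> f j \<le> 2 * F} \<union> {j. j < m2 \<and> 2 * F < f j}" by auto
    then have "card {..<m2} = card ({j. j < m2 \<and> f j \<le> 2 * F} \<union> {j. j < m2 \<and> 2 * F < f j})" by simp
    also have "\<dots> = card {j. j < m2 \<and> f j \<le> 2 * F} + card {j. j < m2 \<and> 2 * F < f j}"
      by (rule card_Un_disjoint) auto
    finally show ?thesis by simp
  qed
  ultimately have "real m2 / 2 \<le> real (card {j. j < m2 \<and> f j \<le> 2 * F})"
    using lg[unfolded cnt] S(2) by linarith
  from med_le[OF m(2) this] have "\<alpha> * med (Matrix.vec m2 f) \<le> \<alpha> * (2 * F)" using \<alpha> by (intro mult_left_mono) auto
  then show "tau x \<le> 2 * \<alpha> * F" unfolding tau_def f_def by (simp add: mult_ac)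
qed

text \<open>Outside the two median events the threshold satisfies the bounds built into the
  deviation events, so excluding those too leaves small deviations at all grid pairs. The rate 9 /
  4000000 is (3/1000)^2 / 4 from the lower median bound; the upper one has a better rate and is
  relaxed to it.\<close>

lemma good_event:
  assumes T: "0 < T" "T \<le> 12 * \<alpha> * F" and S: "finite S" "400 * real (card S) \<le> real m2"
    and N: "N = n1 + n2"
  shows "\<exists>G \<in> sets P. emeasure P (space P - G) \<le>
      ennreal (2 * exp (- real m2 * (9 / 4000000)) + real ((16 * N + 1) ^ N) * (2 * exp (- real m1 * T\<^sup>2 / (216 * \<alpha>\<^sup>2 * F\<^sup>2))))
    \<and> (\<forall>x \<in> G. 66 / 100 * \<alpha> * F \<le> tau x \<and> (\<forall>u \<in> grid n1 N. \<forall>v \<in> grid n2 N. \<bar>dev u v x\<bar> \<le> real m1 * T))"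
proof -
  interpret P: prob_space P by (rule prob_space_P)
  define B1 where "B1 = {x \<in> space P. real m2 * (497 / 1000) \<le> (\<Sum>i\<in>J. of_bool (x i \<in> small))}"
  define B2 where "B2 = {x \<in> space P. real m2 * (3 / 10) \<le> (\<Sum>i\<in>J. of_bool (x i \<in> large))}"
  define B where "B = (\<lambda>(u, v). {x \<in> space P. 0 \<le> tau x \<and> tau x \<le> 2 * \<alpha> * F \<and> real m1 * T \<le> \<bar>dev u v x\<bar>})"
  define UV where "UV = grid n1 N \<times> grid n2 N"
  let ?e = "2 * exp (- real m1 * T\<^sup>2 / (216 * \<alpha>\<^sup>2 * F\<^sup>2))"
  have B1: "B1 \<in> sets P" "emeasure P B1 \<le> ennreal (exp (- real m2 * (3 / 1000)\<^sup>2 / 4))"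
    unfolding B1_def using measure_small by (intro count_prob[where T = "3 / 1000"] small_sets; simp)+
  have B2: "B2 \<in> sets P" "emeasure P B2 \<le> ennreal (exp (- real m2 * (5 / 100)\<^sup>2 / 4))"
    unfolding B2_def using measure_large by (intro count_prob[where T = "5 / 100"] large_sets; simp)+
  have Bs: "B p \<in> sets P" "emeasure P (B p) \<le> ennreal ?e" if "p \<in> UV" for p
  proof -
    obtain u v where p: "p = (u, v)" by (cases p)
    have "L2_set u {..<n1} \<le> 9 / 8" "L2_set v {..<n2} \<le> 9 / 8"
      using that unfolding p UV_def grid_def by simp_all
    from dev_prob[OF this T] show "B p \<in> sets P" "emeasure P (B p) \<le> ennreal ?e"
      unfolding B_def p prod.case .
  qed
  have fin: "finite UV" unfolding UV_def by (simp add: finite_grid)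
  have card: "card UV \<le> (16 * N + 1) ^ N"
  proof -
    have "card UV \<le> (16 * N + 1) ^ n1 * (16 * N + 1) ^ n2"
      unfolding UV_def card_cartesian_product by (intro mult_mono card_grid_le) auto
    then show ?thesis unfolding N by (simp add: power_add)
  qed
  define Bad where "Bad = B1 \<union> B2 \<union> (\<Union>p\<in>UV. B p)"
  have Un: "(\<Union>p\<in>UV. B p) \<in> sets P" using fin Bs by (intro sets.finite_UN) auto
  have Bad: "Bad \<in> sets P" unfolding Bad_def using B1 B2 Un by auto
  have "emeasure P (\<Union>p\<in>UV. B p) \<le> (\<Sum>p\<in>UV. emeasure P (B p))"
    using fin Bs by (intro emeasure_subadditive_finite) auto
  also have "\<dots> \<le> (\<Sum>p\<in>UV. ennreal ?e)" using Bs by (intro sum_mono) auto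
  also have "\<dots> = ennreal (real (card UV) * ?e)" by (simp add: ennreal_mult ennreal_of_nat_eq_real_of_nat)
  also have "\<dots> \<le> ennreal (real ((16 * N + 1) ^ N) * ?e)"
    by (intro ennreal_leI mult_right_mono of_nat_mono card) simp
  finally have U: "emeasure P (\<Union>p\<in>UV. B p) \<le> ennreal (real ((16 * N + 1) ^ N) * ?e)" .
  have b1: "emeasure P B1 \<le> ennreal (exp (- real m2 * (9 / 4000000)))"
    using B1(2) by (simp add: power2_eq_square)
  have b2: "emeasure P B2 \<le> ennreal (exp (- real m2 * (9 / 4000000)))"
    by (rule order_trans[OF B2(2)]) (auto intro!: ennreal_leI simp: power2_eq_square mult_left_mono)
  have "emeasure P Bad \<le> emeasure P B1 + emeasure P B2 + emeasure P (\<Union>p\<in>UV. B p)"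
    unfolding Bad_def using B1 B2 Un
    by (intro order_trans[OF emeasure_subadditive] add_mono emeasure_subadditive) auto
  also have "\<dots> \<le> ennreal (exp (- real m2 * (9 / 4000000))) + ennreal (exp (- real m2 * (9 / 4000000)))
      + ennreal (real ((16 * N + 1) ^ N) * ?e)"
    by (intro add_mono b1 b2 U)
  also have "\<dots> = ennreal (2 * exp (- real m2 * (9 / 4000000)) + real ((16 * N + 1) ^ N) * ?e)"
    by (simp flip: ennreal_plus)
  finally have prob: "emeasure P Bad \<le> ennreal (2 * exp (- real m2 * (9 / 4000000)) + real ((16 * N + 1) ^ N) * ?e)" .
  have "space P - (space P - Bad) = Bad" using sets.sets_into_space[OF Bad] by auto
  moreover have "66 / 100 * \<alpha> * F \<le> tau x \<and> (\<forall>u \<in> grid n1 N. \<forall>v \<in> grid n2 N. \<bar>dev u v x\<bar> \<le> real m1 * T)"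
    if x: "x \<in> space P - Bad" for x
  proof -
    have xP: "x \<in> space P" and n: "x \<notin> B1" "x \<notin> B2" using x by (auto simp: Bad_def)
    have "(\<Sum>i\<in>J. of_bool (x i \<in> small)) < real m2 * (497 / 1000)"
      using n(1) xP unfolding B1_def by (simp add: not_le)
    moreover have "(\<Sum>i\<in>J. of_bool (x i \<in> large)) < real m2 * (3 / 10)"
      using n(2) xP unfolding B2_def by (simp add: not_le)
    ultimately have tb: "66 / 100 * \<alpha> * F \<le> tau x" "tau x \<le> 2 * \<alpha> * F"
      using tau_bounds[OF S _ _ xP] by blast+
    moreover have "0 \<le> 66 / 100 * \<alpha> * F" using \<alpha> F by simp
    ultimately show ?thesis using x by (fastforce simp: Bad_def B_def UV_def)
  qed
  ultimately show ?thesis using Bad prob by (intro bexI[of _ "space P - Bad"]) auto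
qed

lemma bilin_deviation:
  assumes K: "K = mat n1 n2 (\<lambda>(j, k). 1 / real m1 * (\<Sum>i = 1..m1. obs x i * x i (j, k) * of_bool (\<bar>obs x i\<bar> \<le> tau x)))"
    and c: "c = real (card (I - S)) / real m1 * trunc_moment (tau x / F)"
  shows "bilin (K - c \<cdot>\<^sub>m M) u v = dev u v x / real m1"
proof -
  define z where "z = (\<lambda>i. obs x i * of_bool (\<bar>obs x i\<bar> \<le> tau x))"
  have dims: "dim_row (K - c \<cdot>\<^sub>m M) = n1" "dim_col (K - c \<cdot>\<^sub>m M) = n2" using M by auto
  have ent: "(K - c \<cdot>\<^sub>m M) $$ d = 1 / real m1 * (\<Sum>i\<in>I. z i * x i d) - c * M $$ d" if "d \<in> D" for d
    using that M unfolding K D_def I_def z_def by (auto simp: mult_ac)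
  have "bilin (K - c \<cdot>\<^sub>m M) u v = (\<Sum>d\<in>D. u (fst d) * (K - c \<cdot>\<^sub>m M) $$ d * v (snd d))"
    unfolding bilin_def dims D_def by (simp add: sum.cartesian_product split_def)
  also have "\<dots> = (\<Sum>d\<in>D. (\<Sum>i\<in>I. z i * (u (fst d) * v (snd d) * x i d)) / real m1 - c * (M $$ d * (u (fst d) * v (snd d))))"
    by (intro sum.cong refl) (simp add: ent algebra_simps sum_distrib_left sum_distrib_right sum_divide_distrib)
  also have "\<dots> = (\<Sum>d\<in>D. \<Sum>i\<in>I. z i * (u (fst d) * v (snd d) * x i d)) / real m1
      - c * (\<Sum>d\<in>D. M $$ d * (u (fst d) * v (snd d)))"
    by (simp add: sum_subtractf sum_divide_distrib[symmetric] sum_distrib_left)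
  also have "(\<Sum>d\<in>D. \<Sum>i\<in>I. z i * (u (fst d) * v (snd d) * x i d)) = (\<Sum>i\<in>I. z i * (\<Sum>d\<in>D. u (fst d) * v (snd d) * x i d))"
    by (subst sum.swap) (simp add: sum_distrib_left)
  finally show ?thesis unfolding dev_def c z_def using m by (simp add: field_simps)
qed

end

section \<open>Assembly: failure probability, passage to the sample space, error budget and final
  constants\<close>

lemma probability_budget:
  fixes n a b :: real
  assumes n: "3 / 2 \<le> n" "n = real N / 2" and a: "300 * (n * ln n) \<le> a" and b: "300 * (n * ln n) \<le> b"
  shows "2 * exp (- a) + real ((16 * N + 1) ^ N) * (2 * exp (- b)) \<le> n powr - 2"
proof -
  have n0: "0 < n" using n by simp
  have ln: "1 / 3 \<le> ln n"
  proof -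
    have "exp (1 / 3 :: real) ^ 3 = exp 1" by (simp add: exp_of_nat_mult[symmetric])
    also have "\<dots> \<le> (3 / 2) ^ 3" using exp_one_bounds by (simp add: power_divide)
    finally have "exp (1 / 3 :: real) \<le> 3 / 2" by (rule power_le_imp_le_base[of _ 2, simplified]) simp
    also have "\<dots> \<le> exp (ln n)" using n by simp
    finally show ?thesis by simp
  qed
  \<comment> \<open>Here 16 N + 1 = 32 n + 1. The power 10 is due to n possibly being as small as
    3/2, where (3/2)^9 exceeds 33. With N = 2 n the grid pairs number at most exp (20 n ln n), a
    small part of the available exponent 300 n ln n.\<close>
  have "32 * n + 1 \<le> n ^ 10"
  proof -
    have "(3 / 2) ^ 9 \<le> n ^ 9" using n(1) by (intro power_mono) auto
    then have "33 * n \<le> n ^ 9 * n" using n(1) by (intro mult_right_mono) (auto simp: power_divide)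
    moreover have "n ^ 10 = n ^ 9 * n" using power_Suc2[of n 9] by simp
    ultimately show ?thesis using n(1) by linarith
  qed
  then have "(32 * n + 1) ^ N \<le> (n ^ 10) ^ N" using n(1) by (intro power_mono) auto
  also have "(n ^ 10) ^ N = exp (20 * (n * ln n))"
  proof -
    have "(n ^ 10) ^ N = exp (ln n) ^ (10 * N)" using n0 by (simp add: power_mult)
    also have "\<dots> = exp (real (10 * N) * ln n)" by (rule exp_of_nat_mult[symmetric])
    also have "real (10 * N) * ln n = 20 * (n * ln n)" using n(2) by simp
    finally show ?thesis .
  qed
  finally have "(32 * n + 1) ^ N \<le> exp (20 * (n * ln n))" .
  moreover have "real N = 2 * n" using n(2) by simp
  then have "real ((16 * N + 1) ^ N) = (32 * n + 1) ^ N" by (simp add: add.commute)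
  ultimately have g: "real ((16 * N + 1) ^ N) \<le> exp (20 * (n * ln n))" by simp
  have nl: "1 / 2 \<le> n * ln n" using mult_mono[OF n(1) ln] n0 by simp
  have "2 * exp (- a) \<le> 2 * exp (- (280 * (n * ln n)))" using a nl by simp
  moreover have "real ((16 * N + 1) ^ N) * (2 * exp (- b)) \<le> exp (20 * (n * ln n)) * (2 * exp (- (300 * (n * ln n))))"
    using g b by (intro mult_mono) auto
  moreover have "exp (20 * (n * ln n)) * (2 * exp (- (300 * (n * ln n)))) = 2 * exp (- (280 * (n * ln n)))"
    by (simp add: exp_add[symmetric] mult.left_commute[of _ 2])
  ultimately have "2 * exp (- a) + real ((16 * N + 1) ^ N) * (2 * exp (- b)) \<le> 4 * exp (- (280 * (n * ln n)))"
    by linarith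
  also have "\<dots> \<le> exp 3 * exp (- (280 * (n * ln n)))"
  proof -
    have "4 \<le> exp (3 :: real)" using exp_ge_add_one_self[of 3] by simp
    then show ?thesis by (intro mult_right_mono) auto
  qed
  also have "\<dots> = exp (3 - 280 * (n * ln n))" by (simp add: exp_add[symmetric])
  also have "\<dots> \<le> exp (- 2 * ln n)"
  proof -
    have "2 * ln n \<le> 2 * (n * ln n)" using n ln by simp
    then show ?thesis using nl by simp
  qed
  also have "\<dots> = n powr - 2" using n0 by (simp add: powr_def)
  finally show ?thesis .
qed

lemma sensing_block:
  fixes \<omega> :: "nat \<times> nat \<times> nat \<Rightarrow> real"
  assumes M: "M \<in> carrier_mat n1 n2" and i: "i \<in> {1..m}"
  defines "x \<equiv> (\<lambda>i\<in>{1..m}. \<lambda>d\<in>{..<n1} \<times> {..<n2}. \<omega> (i, d))"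
  shows "mat_inner (sensing n1 n2 \<omega> i) M = (\<Sum>d\<in>{..<n1} \<times> {..<n2}. M $$ d * x i d)"
    and "j < n1 \<Longrightarrow> k < n2 \<Longrightarrow> sensing n1 n2 \<omega> i $$ (j, k) = x i (j, k)"
proof -
  have s: "sensing n1 n2 \<omega> i \<in> carrier_mat n1 n2" by (simp add: sensing_def)
  have idx: "sensing n1 n2 \<omega> i $$ (j, k) = x i (j, k)" if "j < n1" "k < n2" for j k
    using that i by (simp add: sensing_def x_def)
  show "j < n1 \<Longrightarrow> k < n2 \<Longrightarrow> sensing n1 n2 \<omega> i $$ (j, k) = x i (j, k)" by (rule idx)
  have "mat_inner (sensing n1 n2 \<omega> i) M = (\<Sum>j<n1. \<Sum>k<n2. M $$ (j, k) * x i (j, k))"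
    unfolding mat_inner_eq_sum[OF s M] by (intro sum.cong refl) (simp add: idx)
  then show "mat_inner (sensing n1 n2 \<omega> i) M = (\<Sum>d\<in>{..<n1} \<times> {..<n2}. M $$ d * x i d)"
    by (simp add: sum.cartesian_product split_def)
qed

text \<open>Translates the initialization from the flat sample point to the curried one, on which
  the good event is defined. The assumption on \<open>m1\<close> identifies the two halves of the
  sample.\<close>

lemma (in trunc_init) init_matrix_eq:
  assumes m1: "m1 = nat \<lceil>real (m1 + m2) / 2\<rceil>"
  defines "x \<equiv> \<lambda>\<omega>. \<lambda>i\<in>{1..m1 + m2}. \<lambda>d\<in>D. \<omega> (i, d)"
  shows "init_matrix n1 n2 (m1 + m2) \<alpha> (sensing n1 n2 \<omega>) (observation S \<eta> M (sensing n1 n2 \<omega>)) =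
    mat n1 n2 (\<lambda>(j, k). 1 / real m1 *
      (\<Sum>i = 1..m1. obs (x \<omega>) i * x \<omega> i (j, k) * of_bool (\<bar>obs (x \<omega>) i\<bar> \<le> tau (x \<omega>))))"
proof -
  let ?A = "sensing n1 n2 \<omega>"
  have xw: "x \<omega> = (\<lambda>i\<in>{1..m1 + m2}. \<lambda>d\<in>D. \<omega> (i, d))" by (simp add: x_def)
  note sb = sensing_block[OF M, where m = "m1 + m2" and \<omega> = \<omega>, folded D_def, folded xw]
  have ob: "observation S \<eta> M ?A i = obs (x \<omega>) i" if "i \<in> {1..m1 + m2}" for i
    using sb(1)[OF that] by (simp add: observation_def obs_def lin_def)
  have thr: "\<alpha> * med (map_vec abs (Matrix.vec (m1 + m2 - m1) (\<lambda>j. observation S \<eta> M ?A (m1 + 1 + j)))) = tau (x \<omega>)"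
  proof -
    have "map_vec abs (Matrix.vec (m1 + m2 - m1) (\<lambda>j. observation S \<eta> M ?A (m1 + 1 + j))) =
        Matrix.vec m2 (\<lambda>j. \<bar>obs (x \<omega>) (m1 + 1 + j)\<bar>)"
    proof (rule eq_vecI)
      fix j assume "j < dim_vec (Matrix.vec m2 (\<lambda>j. \<bar>obs (x \<omega>) (m1 + 1 + j)\<bar>))"
      then have j: "j < m2" by simp
      then have "m1 + 1 + j \<in> {1..m1 + m2}" by simp
      from ob[OF this] j show "map_vec abs (Matrix.vec (m1 + m2 - m1) (\<lambda>j. observation S \<eta> M ?A (m1 + 1 + j))) $ j =
        Matrix.vec m2 (\<lambda>j. \<bar>obs (x \<omega>) (m1 + 1 + j)\<bar>) $ j" by simp
    qed simp
    then show ?thesis by (simp add: tau_def)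
  qed
  show ?thesis
    unfolding init_matrix_def Let_def m1[symmetric] thr
  proof (rule eq_matI)
    fix j k
    assume "j < dim_row (mat n1 n2 (\<lambda>(j, k). 1 / real m1 *
      (\<Sum>i = 1..m1. obs (x \<omega>) i * x \<omega> i (j, k) * of_bool (\<bar>obs (x \<omega>) i\<bar> \<le> tau (x \<omega>)))))"
      "k < dim_col (mat n1 n2 (\<lambda>(j, k). 1 / real m1 *
      (\<Sum>i = 1..m1. obs (x \<omega>) i * x \<omega> i (j, k) * of_bool (\<bar>obs (x \<omega>) i\<bar> \<le> tau (x \<omega>)))))"
    then have jk: "j < n1" "k < n2" by auto
    have "(\<Sum>i = 1..m1. observation S \<eta> M ?A i * ?A i $$ (j, k) * of_bool (\<bar>observation S \<eta> M ?A i\<bar> \<le> tau (x \<omega>)))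
      = (\<Sum>i = 1..m1. obs (x \<omega>) i * x \<omega> i (j, k) * of_bool (\<bar>obs (x \<omega>) i\<bar> \<le> tau (x \<omega>)))"
    proof (intro sum.cong refl)
      fix i assume "i \<in> {1..m1}"
      then have i: "i \<in> {1..m1 + m2}" by auto
      show "observation S \<eta> M ?A i * ?A i $$ (j, k) * of_bool (\<bar>observation S \<eta> M ?A i\<bar> \<le> tau (x \<omega>))
        = obs (x \<omega>) i * x \<omega> i (j, k) * of_bool (\<bar>obs (x \<omega>) i\<bar> \<le> tau (x \<omega>))"
        by (simp only: ob[OF i] sb(2)[OF i jk])
    qed
    then show "mat n1 n2 (\<lambda>(j, k). 1 / real m1 * (\<Sum>i = 1..m1. observation S \<eta> M ?A i * ?A i $$ (j, k) *
        of_bool (\<bar>observation S \<eta> M ?A i\<bar> \<le> tau (x \<omega>)))) $$ (j, k) =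
      mat n1 n2 (\<lambda>(j, k). 1 / real m1 *
      (\<Sum>i = 1..m1. obs (x \<omega>) i * x \<omega> i (j, k) * of_bool (\<bar>obs (x \<omega>) i\<bar> \<le> tau (x \<omega>)))) $$ (j, k)"
      using jk by simp
  qed auto
qed

text \<open>Currying preserves the measure, so the preimage of a good event has the same
  probability.\<close>

lemma (in trunc_init) event_transfer:
  assumes G: "G \<in> sets P" and p: "emeasure P (space P - G) \<le> ennreal p" "0 \<le> p"
  defines "x \<equiv> \<lambda>\<omega>. \<lambda>i\<in>{1..m1 + m2}. \<lambda>d\<in>D. \<omega> (i, d)" and "\<Omega> \<equiv> gaussian_ensemble n1 n2 (m1 + m2)"
  shows "x -` G \<inter> space \<Omega> \<in> sets \<Omega>" "1 - p \<le> measure \<Omega> (x -` G \<inter> space \<Omega>)"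
proof -
  interpret P: prob_space P by (rule prob_space_P)
  have \<Omega>: "\<Omega> = PiM ({1..m1 + m2} \<times> D) (\<lambda>_. gauss)"
    unfolding \<Omega>_def gaussian_ensemble_def gauss_def D_def ..
  note c = distr_PiM_curry[OF finite_atLeastAtMost finite_D prob_space_gauss, of 1 "m1 + m2",
      folded Q_def, folded P_def, folded \<Omega>, folded x_def]
  show "x -` G \<inter> space \<Omega> \<in> sets \<Omega>" by (rule measurable_sets[OF c(1) G])
  have "measure P (space P - G) \<le> p" using p by (simp add: P.emeasure_eq_measure)
  then have "1 - p \<le> measure P G" using P.prob_compl[OF G] by simp
  also have "measure P G = measure (distr \<Omega> P x) G" unfolding c(2) ..
  also have "\<dots> = measure \<Omega> (x -` G \<inter> space \<Omega>)" by (rule measure_distr[OF c(1) G])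
  finally show "1 - p \<le> measure \<Omega> (x -` G \<inter> space \<Omega>)" .
qed

text \<open>The error budget. The grid bound doubles d / (8000 sqrt r) and the perturbation bound
  multiplies by 4 sqrt r, which makes d / 1000. The remaining error is (1 - c) |M| with c = (1 - s)
  f for the outlier fraction s and the truncated moment f, so 1 - c <= (1 - f) + s, at a cost of
  0.027 d and d / 2000. The total 0.0285 d is below d / 34.\<close>

lemma (in trunc_init) spectral_init_close:
  assumes r: "1 \<le> r" and X: "X \<in> carrier_mat n1 r" and Y: "Y \<in> carrier_mat n2 r"
    and MXY: "M = X * Y\<^sup>T" and XY: "X\<^sup>T * X = Y\<^sup>T * Y"
    and d: "0 < d"
    and lb: "\<And>k B. B \<in> carrier_mat r k \<Longrightarrow>
       2 * d * frob_inner B B \<le> frob_inner ((X @\<^sub>r Y) * B) ((X @\<^sub>r Y) * B)"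
    and R: "R \<in> carrier_mat n2 r" "R\<^sup>T * R = 1\<^sub>m r" "M * R * R\<^sup>T = M"
    and N: "N = n1 + n2" "1 \<le> N"
    and K: "K = mat n1 n2 (\<lambda>(j, k). 1 / real m1 * (\<Sum>i = 1..m1. obs x i * x i (j, k) * of_bool (\<bar>obs x i\<bar> \<le> tau x)))"
    and dev: "\<And>u v. u \<in> grid n1 N \<Longrightarrow> v \<in> grid n2 N \<Longrightarrow> \<bar>dev u v x\<bar> \<le> real m1 * (d / (8000 * sqrt (real r)))"
    and bias: "(1 - trunc_moment (tau x / F)) * F \<le> 27 / 1000 * d"
    and frac: "real (card (I \<inter> S)) / real m1 * F \<le> d / 2000"
    and svd: "is_trunc_svd r K CL Sig CR"
  shows "mat_dist ((CL * map_mat sqrt Sig) @\<^sub>r (CR * map_mat sqrt Sig)) (X @\<^sub>r Y) \<le> 1 / 24 * sqrt (2 * d)"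
proof -
  have Kc: "K \<in> carrier_mat n1 n2" by (simp add: K)
  define T where "T = d / (8000 * sqrt (real r))"
  have r0: "0 < sqrt (real r)" using r by simp
  define c where "c = real (card (I - S)) / real m1 * trunc_moment (tau x / F)"
  have cM: "c \<cdot>\<^sub>m M \<in> carrier_mat n1 n2" using M by simp
  have Ec: "K - c \<cdot>\<^sub>m M \<in> carrier_mat n1 n2" using cM by (simp add: minus_carrier_mat)
  have bb: "bilin_bound (K - c \<cdot>\<^sub>m M) (2 * T)"
  proof (rule bilin_bound_from_grid[OF Ec N])
    fix u v assume "u \<in> grid n1 N" "v \<in> grid n2 N"
    from dev[OF this] show "\<bar>bilin (K - c \<cdot>\<^sub>m M) u v\<bar> \<le> T"
      unfolding bilin_deviation[OF K c_def] T_def using m by (simp add: abs_divide divide_le_eq mult.commute)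
  qed
  have BR: "c \<cdot>\<^sub>m M * R * R\<^sup>T = c \<cdot>\<^sub>m M"
  proof -
    have "c \<cdot>\<^sub>m M * R = c \<cdot>\<^sub>m (M * R)" using M R by (intro mult_smult_assoc_mat) auto
    moreover have "c \<cdot>\<^sub>m (M * R) * R\<^sup>T = c \<cdot>\<^sub>m (M * R * R\<^sup>T)"
      using M R by (intro mult_smult_assoc_mat[of _ n1 r]) auto
    ultimately show ?thesis using R(3) by simp
  qed
  let ?Kr = "CL * Sig * CR\<^sup>T"
  have Krc: "?Kr \<in> carrier_mat n1 n2"
    by (rule trunc_svdE[OF Kc svd]) auto
  have "frob_norm (?Kr - c \<cdot>\<^sub>m M) \<le> 4 * sqrt (real r) * (2 * T)"
    by (rule trunc_svd_perturbation[OF Kc svd cM R(1,2) BR bb])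
  also have "\<dots> = d / 1000" using r0 by (simp add: T_def)
  finally have e1: "frob_norm (?Kr - c \<cdot>\<^sub>m M) \<le> d / 1000" .
  define f where "f = trunc_moment (tau x / F)"
  have f: "0 \<le> f" "f \<le> 1" by (simp_all add: f_def trunc_moment_nonneg trunc_moment_le_1)
  define s where "s = real (card (I \<inter> S)) / real m1"
  have "card I = card (I - S) + card (I \<inter> S)"
    using IJ(2) by (metis Int_Diff_Un Int_Diff_disjoint card_Un_disjoint finite_Diff finite_Int add.commute)
  then have "real m1 = real (card (I - S)) + real (card (I \<inter> S))" using IJ(5) by simp
  then have cs: "real (card (I - S)) / real m1 = 1 - s" using m(1) by (simp add: s_def field_simps)
  have s01: "0 \<le> s" "s \<le> 1"
  proof -
    show "0 \<le> s" by (simp add: s_def)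
    have "0 \<le> real (card (I - S)) / real m1" by simp
    then show "s \<le> 1" unfolding cs by simp
  qed
  have "c = (1 - s) * f" by (simp add: c_def cs f_def)
  then have c1: "0 \<le> 1 - c" "1 - c \<le> (1 - f) + s"
    using f s01 mult_left_le[of f s] mult_le_one[of "1 - s" f] by (auto simp: algebra_simps)
  have e2: "(1 - c) * F \<le> 27 / 1000 * d + d / 2000"
  proof -
    have "(1 - c) * F \<le> ((1 - f) + s) * F" using c1 F(2) by (intro mult_right_mono) auto
    also have "\<dots> = (1 - f) * F + s * F" by (simp add: algebra_simps)
    finally show ?thesis using bias frac unfolding f_def s_def by linarith
  qed
  have split: "?Kr - M = (?Kr - c \<cdot>\<^sub>m M) + (c - 1) \<cdot>\<^sub>m M"
  proof -
    have "A - M = (A - c \<cdot>\<^sub>m M) + (c - 1) \<cdot>\<^sub>m M" if "A \<in> carrier_mat n1 n2" for A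
      using that M by (intro eq_matI) (auto simp: algebra_simps)
    from this[OF Krc] show ?thesis .
  qed
  have "frob_norm (?Kr - M) \<le> frob_norm (?Kr - c \<cdot>\<^sub>m M) + frob_norm ((c - 1) \<cdot>\<^sub>m M)"
    unfolding split using cM M by (intro frob_norm_triangle[of _ n1 n2]) (auto simp: minus_carrier_mat)
  also have "frob_norm ((c - 1) \<cdot>\<^sub>m M) = (1 - c) * F" using c1 by (simp add: frob_norm_smult F(1))
  finally have "34 * frob_norm (?Kr - M) \<le> d" using e1 e2 d by linarith
  then have close: "34 * frob_norm (?Kr - X * Y\<^sup>T) \<le> d" by (simp only: MXY)
  show ?thesis by (rule spectral_factor_dist[OF Kc svd X Y XY d _ close]) (rule lb)
qed

text \<open>The witness s1 = 1/4000 makes the outlier error d / 2000 and keeps the outliers below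
  1/400 of the second half. The witness c4 = 10^13 covers 2 * 300 * 216 * 8000^2, about 8.3 * 10^12,
  where 300 n ln n is the exponent needed by \<open>probability_budget\<close> and the factor 2
  comes from using half of the sample.\<close>

theorem theorem2:
  shows "\<exists>s1 c2 c3 c4 :: real. 0 < s1 \<and> s1 < 1 \<and> 1 < c2 \<and> 1 < c3 \<and> 1 < c4 \<and>
    (\<forall>(n1 :: nat) (n2 :: nat) (r :: nat) (m :: nat) (M :: real mat) (X :: real mat) (Y :: real mat)
       (\<kappa>0 :: real) (S :: nat set) (\<eta> :: nat \<Rightarrow> real) (s :: real).
      1 \<le> r \<longrightarrow>
      X \<in> carrier_mat n1 r \<longrightarrow>
      Y \<in> carrier_mat n2 r \<longrightarrow>
      M = X * transpose_mat Y \<longrightarrow>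
      vec_space.rank n1 M = r \<longrightarrow>
      transpose_mat X * X = transpose_mat Y * Y \<longrightarrow>
      kappa_bar M r \<le> \<kappa>0 \<longrightarrow>
      S \<subseteq> {1..m} \<longrightarrow>
      real (card S) = s * real m \<longrightarrow>
      (let Z = X @\<^sub>r Y;
           n = (real n1 + real n2) / 2;
           \<kappa> = kappa_bar M r;
           \<alpha> = 2 * ln (real r powr (1 / 4) * \<kappa>0 powr (1 / 2) + 20);
           \<Omega> = gaussian_ensemble n1 n2 m
       in s \<le> s1 / (sqrt (real r) * \<kappa>) \<longrightarrow>
          real m \<ge> c4 * \<alpha>\<^sup>2 * \<kappa>\<^sup>2 * n * (real r)\<^sup>2 * ln n \<longrightarrow>
          (\<exists>E \<in> sets \<Omega>.
             measure \<Omega> E \<ge> 1 - n powr (- c2) - exp (- c3 * real m) \<and>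
             (\<forall>\<omega> \<in> E. \<forall>W0.
                let A = sensing n1 n2 \<omega>
                in is_trunc_spectral_init n1 n2 r m \<alpha> A (observation S \<eta> M A) W0 \<longrightarrow>
                   mat_dist W0 Z \<le> 1 / 24 * sing_val Z r))))"
proof (rule exI[of _ "1 / 4000"], rule exI[of _ 2], rule exI[of _ 2], rule exI[of _ "10 ^ 13"],
    intro conjI allI impI)
  fix n1 n2 r m :: nat and M X Y :: "real mat" and \<kappa>0 s :: real and S :: "nat set" and \<eta> :: "nat \<Rightarrow> real"
  assume r: "1 \<le> r" and X: "X \<in> carrier_mat n1 r" and Y: "Y \<in> carrier_mat n2 r" and MXY: "M = X * Y\<^sup>T"
    and rank: "vec_space.rank n1 M = r" and XY: "X\<^sup>T * X = Y\<^sup>T * Y" and \<kappa>0: "kappa_bar M r \<le> \<kappa>0"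
    and S: "S \<subseteq> {1..m}" and cS: "real (card S) = s * real m"
  define n where "n = (real n1 + real n2) / 2"
  define \<kappa> where "\<kappa> = kappa_bar M r"
  define x where "x = real r powr (1 / 4) * \<kappa>0 powr (1 / 2)"
  define \<alpha> where "\<alpha> = 2 * ln (x + 20)"
  define \<Omega> where "\<Omega> = gaussian_ensemble n1 n2 m"
  have Mc: "M \<in> carrier_mat n1 n2" using X Y by (auto simp: MXY)
  have main: "\<exists>E \<in> sets \<Omega>. measure \<Omega> E \<ge> 1 - n powr (- 2) - exp (- 2 * real m) \<and>
      (\<forall>\<omega> \<in> E. \<forall>W0. is_trunc_spectral_init n1 n2 r m \<alpha> (sensing n1 n2 \<omega>)
         (observation S \<eta> M (sensing n1 n2 \<omega>)) W0 \<longrightarrow>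
         mat_dist W0 (X @\<^sub>r Y) \<le> 1 / 24 * sing_val (X @\<^sub>r Y) r)"
    if s: "s \<le> 1 / 4000 / (sqrt (real r) * \<kappa>)"
      and m: "real m \<ge> 10 ^ 13 * \<alpha>\<^sup>2 * \<kappa>\<^sup>2 * n * (real r)\<^sup>2 * ln n"
  proof (cases "3 / 2 \<le> n")
    \<comment> \<open>Then n1 + n2 is an integer below 3, so n <= 1 and n to the power -2 is at
      least 1. The claimed probability is at most 0 and the empty event will do.\<close>
    case False
    have "r \<le> n2" using vec_space.rank_le_nc[OF Mc] rank by simp
    moreover have "n1 + n2 < 3"
    proof -
      have "real (n1 + n2) < real 3" using False by (simp add: n_def)
      then show ?thesis by (simp only: of_nat_less_iff)
    qed
    ultimately have n: "0 < n" "n \<le> 1" using r by (auto simp: n_def)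
    have "n\<^sup>2 \<le> 1" using n by (intro power_le_one) auto
    then have "1 \<le> n powr - 2" using n by (simp add: powr_minus one_le_inverse)
    then have "1 - n powr - 2 - exp (- 2 * real m) \<le> 0" using exp_ge_zero[of "- 2 * real m"] by linarith
    then show ?thesis by (intro bexI[of _ "{}"]) auto
  next
    case n: True
    obtain d R where d: "0 < d" and sM: "sing_val M r = d" and sZ: "sing_val (X @\<^sub>r Y) r = sqrt (2 * d)"
      and rd: "real r * d\<^sup>2 \<le> (frob_norm M)\<^sup>2"
      and lb: "\<And>k B. B \<in> carrier_mat r k \<Longrightarrow>
         2 * d * frob_inner B B \<le> frob_inner ((X @\<^sub>r Y) * B) ((X @\<^sub>r Y) * B)"
      and R: "R \<in> carrier_mat n2 r" "R\<^sup>T * R = 1\<^sub>m r" "M * R * R\<^sup>T = M"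
      by (rule balanced_factor_spectrum[OF r X Y MXY rank XY]) (rule that; blast)
    define F where "F = frob_norm M"
    define q where "q = sqrt (real r)"
    have q: "1 \<le> q" "q\<^sup>2 = real r" using r by (auto simp: q_def)
    have "(q * d)\<^sup>2 \<le> F\<^sup>2" using rd q by (simp add: power_mult_distrib F_def)
    then have qdF: "q * d \<le> F" by (rule power2_le_imp_le) (simp add: F_def)
    have qd: "0 < q * d" using q d by simp
    have Fpos: "0 < F" using qdF qd by linarith
    have dF: "d \<le> F"
    proof -
      have "1 * d \<le> q * d" using q d by (intro mult_right_mono) auto
      then show ?thesis using qdF by simp
    qed
    have \<kappa>: "\<kappa> = F / (q * d)" by (simp add: \<kappa>_def kappa_bar_def F_def q_def sM)
    have \<kappa>1: "1 \<le> \<kappa>" unfolding \<kappa> using qdF qd by simp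
    have F\<kappa>: "F = q * \<kappa> * d" unfolding \<kappa> using q(1) d by simp
    have \<kappa>01: "1 \<le> \<kappa>0" "\<kappa> \<le> \<kappa>0" using \<kappa>0 \<kappa>1 by (auto simp: \<kappa>_def)
    have x1: "1 \<le> x"
    proof -
      have "1 * 1 \<le> x" unfolding x_def using r \<kappa>01 by (intro mult_mono ge_one_powr_ge_zero) auto
      then show ?thesis by simp
    qed
    \<comment> \<open>This explains the exponents 1/4 and 1/2 in the truncation level: x^2 is sqrt r
      * \<open>\<kappa>0\<close>, which bounds the ratio F / d by which the bias gets
      multiplied.\<close>
    have x2: "x\<^sup>2 = q * \<kappa>0"
      unfolding x_def q_def using \<kappa>01 r
      by (simp add: power_mult_distrib powr_power powr_half_sqrt)
    have \<alpha>4: "4 \<le> \<alpha>"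
    proof -
      have "exp (2 :: real) = exp 1 ^ 2" by (simp add: exp_of_nat_mult[symmetric])
      also have "\<dots> \<le> 3 ^ 2" using exp_one_bounds by (intro power_mono) auto
      also have "\<dots> \<le> x + 20" using x1 by simp
      finally have "2 \<le> ln (x + 20)" using x1 by (simp add: ln_ge_iff)
      then show ?thesis by (simp add: \<alpha>_def)
    qed
    define y where "y = n * ln n"
    have y: "1 / 2 \<le> y"
    proof -
      have "exp (1 / 3 :: real) ^ 3 = exp 1" by (simp add: exp_of_nat_mult[symmetric])
      also have "\<dots> \<le> (3 / 2) ^ 3" using exp_one_bounds by (simp add: power_divide)
      finally have "exp (1 / 3 :: real) \<le> 3 / 2" by (rule power_le_imp_le_base[of _ 2, simplified]) simp
      also have "\<dots> \<le> n" by (rule n)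
      finally have "1 / 3 \<le> ln n" using n ln_ge_iff[of n "1 / 3"] by linarith
      from mult_mono[OF n this] n show ?thesis by (simp add: y_def)
    qed
    define w where "w = \<alpha>\<^sup>2 * \<kappa>\<^sup>2 * (real r)\<^sup>2"
    have w16: "16 \<le> w"
    proof -
      have "4\<^sup>2 * 1\<^sup>2 * 1\<^sup>2 \<le> w" unfolding w_def using \<alpha>4 \<kappa>1 r by (intro mult_mono power_mono) auto
      then show ?thesis by simp
    qed
    have mw: "10 ^ 13 * (w * y) \<le> real m" using m by (simp add: w_def y_def mult_ac)
    have "16 * y \<le> w * y" using w16 y by (intro mult_right_mono) auto
    then have my: "16 * 10 ^ 13 * y \<le> real m" using mw by simp
    define m1 where "m1 = nat \<lceil>real m / 2\<rceil>"
    define m2 where "m2 = m - m1"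
    have m1r: "real m / 2 \<le> real m1" "real m1 \<le> real m / 2 + 1"
      unfolding m1_def by linarith+
    have m3: "3 \<le> real m" using my y by simp
    have m12: "m1 \<le> m" using m1r m3 by linarith
    then have mm: "m = m1 + m2" by (simp add: m2_def)
    have m2r: "real m / 6 \<le> real m2"
    proof -
      have "real m2 = real m - real m1" using mm by simp
      moreover have "16 \<le> real m" using my y by simp
      ultimately show ?thesis using m1r by linarith
    qed
    have mpos: "0 < m1" "0 < m2" using m1r m2r m3 by (auto intro: Nat.gr0I)
    interpret trunc_init n1 n2 m1 m2 M S \<eta> \<alpha> F
      by unfold_locales (use Mc Fpos mpos \<alpha>4 in \<open>auto simp: F_def\<close>)
    define T where "T = d / (8000 * sqrt (real r))"
    have T: "0 < T" "T \<le> 12 * \<alpha> * F"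
    proof -
      show "0 < T" unfolding T_def using d r by simp
      have "T \<le> d" unfolding T_def q_def[symmetric] using d q by (simp add: divide_le_eq mult_le_cancel_left1)
      also have "d \<le> 1 * F" using dF by simp
      also have "\<dots> \<le> 12 * \<alpha> * F" using \<alpha>4 Fpos by (intro mult_right_mono) auto
      finally show "T \<le> 12 * \<alpha> * F" .
    qed
    have finS: "finite S" using S finite_subset by blast
    have q\<kappa>: "1 \<le> q * \<kappa>" using mult_mono[OF q(1) \<kappa>1] q by simp
    have sle: "s * (q * \<kappa>) \<le> 1 / 4000" using s q\<kappa> by (simp add: q_def field_simps)
    have "s \<le> 1 / 4000"
    proof (cases "0 \<le> s")
      case True
      then have "s * 1 \<le> s * (q * \<kappa>)" using q\<kappa> by (intro mult_left_mono) auto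
      then show ?thesis using sle by simp
    qed simp
    then have "real (card S) \<le> 1 / 4000 * real m" unfolding cS by (intro mult_right_mono) auto
    then have Sm2: "400 * real (card S) \<le> real m2" using m2r by simp
    define N where "N = n1 + n2"
    have nN: "n = real N / 2" by (simp add: n_def N_def)
    obtain G where G: "G \<in> sets P" and GP: "emeasure P (space P - G) \<le>
      ennreal (2 * exp (- real m2 * (9 / 4000000)) + real ((16 * N + 1) ^ N) * (2 * exp (- real m1 * T\<^sup>2 / (216 * \<alpha>\<^sup>2 * F\<^sup>2))))"
      and Gx: "\<And>x. x \<in> G \<Longrightarrow> 66 / 100 * \<alpha> * F \<le> tau x"
        "\<And>x u v. x \<in> G \<Longrightarrow> u \<in> grid n1 N \<Longrightarrow> v \<in> grid n2 N \<Longrightarrow> \<bar>dev u v x\<bar> \<le> real m1 * T"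
      using good_event[OF T finS Sm2 N_def] by blast
    have a: "300 * (n * ln n) \<le> real m2 * (9 / 4000000)"
      unfolding y_def[symmetric] using my m2r by simp
    \<comment> \<open>In terms of w = \<alpha>^2 \<kappa>^2 r^2 the exponent is m1 / (216 * 8000^2 *
      w): one factor r stems from T^2, the other together with \<kappa>^2 from F^2 / d^2.\<close>
    have b: "300 * (n * ln n) \<le> real m1 * T\<^sup>2 / (216 * \<alpha>\<^sup>2 * F\<^sup>2)"
    proof -
      have "T\<^sup>2 = d\<^sup>2 / (64000000 * real r)"
        unfolding T_def q_def[symmetric] by (simp add: power_divide power_mult_distrib q(2))
      moreover have "F\<^sup>2 = real r * \<kappa>\<^sup>2 * d\<^sup>2" unfolding F\<kappa> by (simp add: power_mult_distrib q(2))
      ultimately have "T\<^sup>2 / (216 * \<alpha>\<^sup>2 * F\<^sup>2) = 1 / (13824000000 * w)"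
        unfolding w_def using d r \<kappa>1 \<alpha>4 by (simp add: field_simps power2_eq_square)
      then have eq: "real m1 * T\<^sup>2 / (216 * \<alpha>\<^sup>2 * F\<^sup>2) = real m1 / (13824000000 * w)"
        by (metis times_divide_eq_right mult.right_neutral)
      have "300 * y * (13824000000 * w) \<le> 5 * 10 ^ 12 * (w * y)"
      proof -
        have "0 \<le> w * y" using w16 y by simp
        then show ?thesis by (simp add: algebra_simps)
      qed
      also have "\<dots> \<le> real m1" using mw m1r by simp
      finally show ?thesis unfolding eq y_def[symmetric] using w16 by (simp add: le_divide_eq)
    qed
    have budget: "2 * exp (- real m2 * (9 / 4000000)) + real ((16 * N + 1) ^ N) * (2 * exp (- real m1 * T\<^sup>2 / (216 * \<alpha>\<^sup>2 * F\<^sup>2)))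
        \<le> n powr - 2"
      using probability_budget[OF n nN a b] by simp
    have p: "emeasure P (space P - G) \<le> ennreal (n powr - 2)"
      by (rule order_trans[OF GP ennreal_leI[OF budget]])
    note ev = event_transfer[OF G p powr_ge_zero, folded mm, folded \<Omega>_def]
    define cur where "cur = (\<lambda>\<omega>. \<lambda>i\<in>{1..m}. \<lambda>d\<in>D. \<omega> (i, d) :: real)"
    have Es: "cur -` G \<inter> space \<Omega> \<in> sets \<Omega>" and Ep: "1 - n powr - 2 \<le> measure \<Omega> (cur -` G \<inter> space \<Omega>)"
      using ev unfolding cur_def by auto
    show ?thesis
    proof (intro bexI[OF _ Es] conjI ballI allI impI)
      have "0 < exp (- 2 * real m)" by simp
      then show "1 - n powr (- 2) - exp (- 2 * real m) \<le> measure \<Omega> (cur -` G \<inter> space \<Omega>)" using Ep by linarith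
      fix \<omega> W0
      assume \<omega>: "\<omega> \<in> cur -` G \<inter> space \<Omega>"
        and W0: "is_trunc_spectral_init n1 n2 r m \<alpha> (sensing n1 n2 \<omega>) (observation S \<eta> M (sensing n1 n2 \<omega>)) W0"
      define z where "z = cur \<omega>"
      have zG: "z \<in> G" using \<omega> by (simp add: z_def)
      define K where "K = mat n1 n2 (\<lambda>(j, k). 1 / real m1 * (\<Sum>i = 1..m1. obs z i * z i (j, k) * of_bool (\<bar>obs z i\<bar> \<le> tau z)))"
      have "init_matrix n1 n2 m \<alpha> (sensing n1 n2 \<omega>) (observation S \<eta> M (sensing n1 n2 \<omega>)) = K"
        unfolding K_def z_def cur_def mm
        by (rule init_matrix_eq) (metis m1_def mm)
      with W0 obtain CL Sig CR where svd: "is_trunc_svd r K CL Sig CR"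
        and W0eq: "W0 = (CL * map_mat sqrt Sig) @\<^sub>r (CR * map_mat sqrt Sig)"
        unfolding is_trunc_spectral_init_def by auto
      have bias: "(1 - trunc_moment (tau z / F)) * F \<le> 27 / 1000 * d"
      proof -
        \<comment> \<open>0.66 \<alpha> = 1.32 ln (x + 20), as \<alpha> carries the factor
          2.\<close>
        have "132 / 100 * ln (x + 20) \<le> tau z / F"
          using Gx(1)[OF zG] Fpos by (simp add: \<alpha>_def le_divide_eq)
        then have "1 - trunc_moment (tau z / F) \<le> 1 - trunc_moment (132 / 100 * ln (x + 20))"
          using trunc_moment_mono by simp
        then have "(1 - trunc_moment (tau z / F)) * F \<le> (1 - trunc_moment (132 / 100 * ln (x + 20))) * F"
          using Fpos by (intro mult_right_mono) auto
        also have "\<dots> \<le> (1 - trunc_moment (132 / 100 * ln (x + 20))) * (x\<^sup>2 * d)"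
          unfolding F\<kappa> x2 using \<kappa>01 q d trunc_moment_le_1 by (intro mult_left_mono mult_right_mono) auto
        also have "\<dots> = x\<^sup>2 * (1 - trunc_moment (132 / 100 * ln (x + 20))) * d" by simp
        also have "\<dots> \<le> 27 / 1000 * d" using bias_bound[OF x1] d by (intro mult_right_mono) auto
        finally show ?thesis .
      qed
      have frac: "real (card (I \<inter> S)) / real m1 * F \<le> d / 2000"
      proof -
        \<comment> \<open>All outliers may fall into the first half, which holds at least half of
          the sample, so their fraction there can double to 2 s.\<close>
        have "real (card (I \<inter> S)) \<le> s * real m"
          unfolding cS[symmetric] using finS by (intro of_nat_mono card_mono) auto
        moreover have "0 \<le> s"
        proof -
          have "0 \<le> s * real m" by (simp flip: cS)
          then show ?thesis using m3 by (simp add: zero_le_mult_iff)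
        qed
        moreover have "s * real m \<le> s * (2 * real m1)" using m1r calculation(2) by (intro mult_left_mono) auto
        ultimately have "real (card (I \<inter> S)) / real m1 \<le> 2 * s" using mpos by (simp add: divide_le_eq)
        then have "real (card (I \<inter> S)) / real m1 * F \<le> 2 * s * F" using Fpos by (intro mult_right_mono) auto
        also have "\<dots> = 2 * (s * (q * \<kappa>)) * d" unfolding F\<kappa> by simp
        also have "\<dots> \<le> 2 * (1 / 4000) * d" using sle d by (intro mult_right_mono) auto
        finally show ?thesis by simp
      qed
      have N1: "1 \<le> N" using n nN by simp
      show "mat_dist W0 (X @\<^sub>r Y) \<le> 1 / 24 * sing_val (X @\<^sub>r Y) r"
        unfolding W0eq sZ
      proof (rule spectral_init_close[OF r X Y MXY XY d _ R N_def N1 K_def _ bias frac svd])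
        show "2 * d * frob_inner B B \<le> frob_inner ((X @\<^sub>r Y) * B) ((X @\<^sub>r Y) * B)"
          if "B \<in> carrier_mat r k" for k B
          by (rule lb[OF that])
        show "\<bar>dev u v z\<bar> \<le> real m1 * (d / (8000 * sqrt (real r)))" if "u \<in> grid n1 N" "v \<in> grid n2 N" for u v
          using Gx(2)[OF zG that] by (simp only: T_def)
      qed
    qed
  qed
  show "let Z = X @\<^sub>r Y; n = (real n1 + real n2) / 2; \<kappa> = kappa_bar M r;
           \<alpha> = 2 * ln (real r powr (1 / 4) * \<kappa>0 powr (1 / 2) + 20);
           \<Omega> = gaussian_ensemble n1 n2 m
       in s \<le> 1 / 4000 / (sqrt (real r) * \<kappa>) \<longrightarrow>
          real m \<ge> 10 ^ 13 * \<alpha>\<^sup>2 * \<kappa>\<^sup>2 * n * (real r)\<^sup>2 * ln n \<longrightarrow>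
          (\<exists>E \<in> sets \<Omega>.
             measure \<Omega> E \<ge> 1 - n powr (- 2) - exp (- 2 * real m) \<and>
             (\<forall>\<omega> \<in> E. \<forall>W0.
                let A = sensing n1 n2 \<omega>
                in is_trunc_spectral_init n1 n2 r m \<alpha> A (observation S \<eta> M A) W0 \<longrightarrow>
                   mat_dist W0 Z \<le> 1 / 24 * sing_val Z r))"
    unfolding Let_def
    by (intro impI) (rule main[unfolded n_def \<kappa>_def \<alpha>_def \<Omega>_def x_def])
qed auto

end
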